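(* Let the perturbed system described in the context satisfy the standing assumptions (i)–(iv) listed there. Let $n$ be the integer such that $\Lambda_k(\rho)\equiv0$ for $k\le n-1$ and $\Lambda_n(\rho)\not\equiv0$, and assume that $n<p$, $n\le q$, and $\Lambda_n(\rho)=\rho(\lambda_n+\mathcal O(|\rho|))$ as $\rho\to0$ with a constant $\lambda_n\ne0$. Put $\nu_0=(p-n)/q$ and assume $\lambda_n+\delta_{n,q}\nu_0<0$. Let $\varrho_1(t),\phi_1(t)$ be the solution of the truncated system $$\frac{d\varrho}{dt}=\Lambda_N(\varrho,t),\qquad \frac{d\phi}{dt}=\omega(\varrho)$$ with asymptotics $$\varrho_1(t)\sim\sum_{k=0}^\infty t^{-\nu_0-\frac kq}\rho_k(\log t),\qquad \phi_1(t)\sim\omega(0)t,\qquad t\to\infty,$$ where $\rho_k(\tau)$ are polynomials in $\tau$ and $\rho_0(\tau)\equiv-\mu_p/(\lambda_n+\delta_{n,q}\nu_0)$. Then for all $\varepsilon>0$ there exist $\delta_0>0$ and $t_0\ge t_\ast$ such that every solution $r(t),\varphi(t)$ of the perturbed system with initial data $|r(t_0)-\varrho_1(t_0)|\le\delta_0$ and $\varphi(t_0)\in\mathbb R$ satisfies $$\sup_{t\ge t_0}\left\{t^{\nu_0}|r(t)-\varrho_1(t)|\right\}<\varepsilon,\qquad \varphi(t)\sim\phi_1(t),\quad t\to\infty.$$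
   Context: $\mathbb Z_+=\{1,2,\dots\}$; $\delta_{i,j}$ is the Kronecker delta. Perturbed system: fix $r_0>0$, $q\in\mathbb Z_+$ and consider $$\frac{dr}{dt}=f(r,\varphi,S(t),t),\qquad \frac{d\varphi}{dt}=\omega(r)+r^{-1}g(r,\varphi,S(t),t),$$ where $\omega(r)$, $f(r,\varphi,S,t)$, $g(r,\varphi,S,t)$ are infinitely differentiable, defined for all $|r|\le r_0$, $(\varphi,S)\in\mathbb R^2$, $t>0$, and $2\pi$-periodic with respect to $\varphi$ and $S$; $\omega(r)>0$ for all $|r|\le r_0$. Standing assumptions: (i) as $t\to\infty$, $f(r,\varphi,S,t)\sim\sum_{k=1}^\infty t^{-k/q}f_k(r,\varphi,S)$ and $g(r,\varphi,S,t)\sim\sum_{k=1}^\infty t^{-k/q}g_k(r,\varphi,S)$ for all $|r|\le r_0$, $(\varphi,S)\in\mathbb R^2$, where $f_k,g_k$ are $2\pi$-periodic in $\varphi$ and $S$ and their Fourier series $f_k=\sum_{(k_1,k_2)\in\mathbb Z^2}f_{k,k_1,k_2}(r)e^{i(k_1\varphi+k_2S)}$, $g_k=\sum_{(k_1,k_2)\in\mathbb Z^2}g_{k,k_1,k_2}(r)e^{i(k_1\varphi+k_2S)}$ contain a finite number of harmonics $e^{ik_2S}$; (ii) there is $p\in\mathbb Z_+$ such that $|f_k(r,\varphi,S)|+|g_k(r,\varphi,S)|=\mathcal O(r)$ as $r\to0$ for $k<p$, and $f_{p,0,0}(0)\ne0$; (iii) $S(t)=s_0t+\sum_{k=1}^{q-1}s_kt^{1-k/q}+s_q\log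 t$ with real constants $s_k$, $s_0>0$; (iv) (non-resonance) $k_1\omega(0)+k_2s_0\ne0$ for all $k_1,k_2\in\mathbb Z$ with $|k_1|+|k_2|\ne0$. The functions $\Lambda_k$: fix an integer $N\in[p,2p)$. Let $\langle Z\rangle_{\varphi,S}=(2\pi)^{-2}\int_0^{2\pi}\int_0^{2\pi}Z\,d\varphi\,dS$. Write $S'(t)=s_0+\sum_{i=1}^q\sigma_it^{-i/q}$, i.e. $\sigma_i=(1-i/q)s_i$ for $i<q$, $\sigma_q=s_q$, and $\sigma_i=0$ for $i>q$; put $v_i\equiv0$ for $i<1$ or $i>N$. For $k=1,\dots,N$ define successively $$\mathcal R_k=[\epsilon^k]\sum_{j\ge1}\epsilon^j\Big(\Lambda_j\big(r+\sum_{i\ge1}\epsilon^iv_i\big)-\Lambda_j(r)\Big)-\Big(1-\frac kq\Big)v_{k-q}-\sum_{i+j=k,\ i,j\ge1}\Big(f_i\partial_r+r^{-1}g_i\partial_\varphi+\sigma_i\partial_S\Big)v_j,$$ where $[\epsilon^k]$ is the coefficient of $\epsilon^k$ in the formal Taylor expansion (so $\mathcal R_k$ depends only on $\Lambda_j,v_j$ with $j<k$), $\Lambda_k(r)=\langle f_k-\mathcal R_k\rangle_{\varphi,S}$, and $v_k(r,\varphi,S)$ is the $2\pi$-periodic zero-mean solution of $(\omega(r)\partial_\varphi+s_0\partial_S)v_k=\Lambda_k-f_k+\mathcal R_k$ obtained by dividing the Fourier coefficients of the right-hand side by $i(k_1\omega(r)+k_2s_0)$. Here $|r|\le r_\ast$,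 where $r_\ast\in(0,r_0)$ is chosen so that $k_1\omega(r)+k_2s_0\ne0$ for $|r|\le r_\ast$, all $k_1\in\mathbb Z$ and all $k_2$ in the finite set of $S$-frequencies that occur, $|k_1|+|k_2|\ne0$. Set $\Lambda_N(\rho,t)=\sum_{k=1}^Nt^{-k/q}\Lambda_k(\rho)$. One has $\Lambda_k(\rho)=\mathcal O(|\rho|)$ for $k<p$ and $\Lambda_p(\rho)=\mu_p+\mathcal O(|\rho|)$ as $\rho\to0$, with $\mu_p=f_{p,0,0}(0)\ne0$. The number $t_\ast>0$ is fixed so large that $(r,\varphi,t)\mapsto(V_N,\varphi,t)$, $V_N=r+\sum_{k=1}^Nt^{-k/q}v_k(r,\varphi,S(t))$, is an invertible near-identity change of variables for $|r|\le r_\ast$, $\varphi\in\mathbb R$, $t\ge t_\ast$. The truncated system is considered for $t\ge t_\ast$. *)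

theory Defs
  imports "HOL-Analysis.Analysis" "HOL-Library.Landau_Symbols"
begin

primrec C_diff :: "nat \<Rightarrow> 'a::euclidean_space set \<Rightarrow> ('a \<Rightarrow> real) \<Rightarrow> bool" where
  "C_diff 0 U F \<longleftrightarrow> continuous_on U F"
| "C_diff (Suc m) U F \<longleftrightarrow>
     (\<forall>x\<in>U. F differentiable (at x)) \<and>
     (\<forall>b\<in>Basis. C_diff m U (\<lambda>x. frechet_derivative F (at x) b))"

(* Smoothness on a set that need not be open (here: closed in r): existence of a smooth
   extension to an open neighbourhood. Values outside T are irrelevant. *)
definition smooth_on :: "'a::euclidean_space set \<Rightarrow> ('a \<Rightarrow> real) \<Rightarrow> bool" where
  "smooth_on T F \<longleftrightarrow>
     (\<exists>U G. open U \<and> T \<subseteq> U \<and> (\<forall>x\<in>T. G x = F x) \<and> (\<forall>m. C_diff m U G))"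

definition periodic2 :: "(real \<Rightarrow> real \<Rightarrow> real) \<Rightarrow> bool" where
  "periodic2 Z \<longleftrightarrow> (\<forall>\<phi> S. Z (\<phi> + 2 * pi) S = Z \<phi> S \<and> Z \<phi> (S + 2 * pi) = Z \<phi> S)"

definition mean2 :: "(real \<Rightarrow> real \<Rightarrow> real) \<Rightarrow> real" where
  "mean2 Z = (1 / (2 * pi)^2) *
     integral {0..2 * pi} (\<lambda>S. integral {0..2 * pi} (\<lambda>\<phi>. Z \<phi> S))"

definition fourier_coeff :: "(real \<Rightarrow> real \<Rightarrow> real) \<Rightarrow> int \<Rightarrow> int \<Rightarrow> complex" where
  "fourier_coeff Z k1 k2 = complex_of_real (1 / (2 * pi)^2) *
     integral {0..2 * pi} (\<lambda>S. integral {0..2 * pi} (\<lambda>\<phi>.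
       complex_of_real (Z \<phi> S) * cis (- (of_int k1 * \<phi> + of_int k2 * S))))"

(* Asymptotic expansion in powers of t^(-1/q) as t tends to infinity, uniform in
   |r| \<le> r0 and in the two angles. *)
definition uniform_expansion ::
  "real \<Rightarrow> nat \<Rightarrow> (real \<Rightarrow> real \<Rightarrow> real \<Rightarrow> real \<Rightarrow> real) \<Rightarrow>
   (nat \<Rightarrow> real \<Rightarrow> real \<Rightarrow> real \<Rightarrow> real) \<Rightarrow> bool" where
  "uniform_expansion r0 q F Fk \<longleftrightarrow>
     (\<forall>K. \<exists>C T. T > 0 \<and> (\<forall>t\<ge>T. \<forall>r \<phi> S. \<bar>r\<bar> \<le> r0 \<longrightarrow>
        \<bar>F r \<phi> S t - (\<Sum>k=1..K. t powr (- (real k / real q)) * Fk k r \<phi> S)\<bar>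
          \<le> C * t powr (- (real (Suc K) / real q))))"

definition phase :: "nat \<Rightarrow> (nat \<Rightarrow> real) \<Rightarrow> real \<Rightarrow> real" where
  "phase q s t = s 0 * t + (\<Sum>k=1..<q. s k * t powr (1 - real k / real q)) + s q * ln t"

(* Coefficients of the derivative of the phase: s 0 + (\<Sum>i=1..q. t powr (-i/q) * sigma q s i). *)
definition sigma :: "nat \<Rightarrow> (nat \<Rightarrow> real) \<Rightarrow> nat \<Rightarrow> real" where
  "sigma q s i =
     (if i < q then (1 - real i / real q) * s i else if i = q then s q else 0)"

locale perturbed_system =
  fixes r0 :: real and q p :: nat
    and \<omega> :: "real \<Rightarrow> real"
    and f g :: "real \<Rightarrow> real \<Rightarrow> real \<Rightarrow> real \<Rightarrow> real"
    and fk gk :: "nat \<Rightarrow> real \<Rightarrow> real \<Rightarrow> real \<Rightarrow> real"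
    and s :: "nat \<Rightarrow> real"
  assumes r0_pos: "r0 > 0"
    and q_pos: "q \<ge> 1"
    and p_pos: "p \<ge> 1"
    and omega_smooth: "smooth_on {-r0..r0} \<omega>"
    and omega_pos: "\<And>r. \<bar>r\<bar> \<le> r0 \<Longrightarrow> \<omega> r > 0"
    and f_smooth: "smooth_on ({-r0..r0} \<times> UNIV \<times> UNIV \<times> {0<..}) (\<lambda>(r, \<phi>, S, t). f r \<phi> S t)"
    and g_smooth: "smooth_on ({-r0..r0} \<times> UNIV \<times> UNIV \<times> {0<..}) (\<lambda>(r, \<phi>, S, t). g r \<phi> S t)"
    and f_periodic: "\<And>r t. \<bar>r\<bar> \<le> r0 \<Longrightarrow> t > 0 \<Longrightarrow> periodic2 (\<lambda>\<phi> S. f r \<phi> S t)"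
    and g_periodic: "\<And>r t. \<bar>r\<bar> \<le> r0 \<Longrightarrow> t > 0 \<Longrightarrow> periodic2 (\<lambda>\<phi> S. g r \<phi> S t)"
    and f_expansion: "uniform_expansion r0 q f fk"
    and g_expansion: "uniform_expansion r0 q g gk"
    and fk_smooth: "\<And>k. k \<ge> 1 \<Longrightarrow>
          smooth_on ({-r0..r0} \<times> UNIV \<times> UNIV) (\<lambda>(r, \<phi>, S). fk k r \<phi> S)"
    and gk_smooth: "\<And>k. k \<ge> 1 \<Longrightarrow>
          smooth_on ({-r0..r0} \<times> UNIV \<times> UNIV) (\<lambda>(r, \<phi>, S). gk k r \<phi> S)"
    and fk_periodic: "\<And>k r. k \<ge> 1 \<Longrightarrow> \<bar>r\<bar> \<le> r0 \<Longrightarrow> periodic2 (fk k r)"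
    and gk_periodic: "\<And>k r. k \<ge> 1 \<Longrightarrow> \<bar>r\<bar> \<le> r0 \<Longrightarrow> periodic2 (gk k r)"
    and fk_harmonics: "\<And>k. k \<ge> 1 \<Longrightarrow>
          finite {k2. \<exists>r k1. \<bar>r\<bar> \<le> r0 \<and> fourier_coeff (fk k r) k1 k2 \<noteq> 0}"
    and gk_harmonics: "\<And>k. k \<ge> 1 \<Longrightarrow>
          finite {k2. \<exists>r k1. \<bar>r\<bar> \<le> r0 \<and> fourier_coeff (gk k r) k1 k2 \<noteq> 0}"
    and small_below_p: "\<And>k \<phi> S. 1 \<le> k \<Longrightarrow> k < p \<Longrightarrow>
          (\<lambda>r. \<bar>fk k r \<phi> S\<bar> + \<bar>gk k r \<phi> S\<bar>) \<in> O[at 0](\<lambda>r. r)"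
    and fp_nonzero: "fourier_coeff (fk p 0) 0 0 \<noteq> 0"
    and s0_pos: "s 0 > 0"
    and nonresonance: "\<And>k1 k2 :: int. \<bar>k1\<bar> + \<bar>k2\<bar> \<noteq> 0 \<Longrightarrow>
          of_int k1 * \<omega> 0 + of_int k2 * s 0 \<noteq> 0"

(* Coefficient of X^k in \<Sum>j\<ge>1. X^j * (\<Lambda> j (r + \<Sum>i. X^i * v i) - \<Lambda> j r), where \<Lambda> j is
   replaced by its formal Taylor series at r. Terms with j > k do not contribute. The
   composition is the intended one because v 0 is zero, see averaging below. *)
definition taylor_coeff ::
  "(nat \<Rightarrow> real \<Rightarrow> real) \<Rightarrow> (nat \<Rightarrow> real \<Rightarrow> real \<Rightarrow> real \<Rightarrow> real) \<Rightarrow>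
   nat \<Rightarrow> real \<Rightarrow> real \<Rightarrow> real \<Rightarrow> real" where
  "taylor_coeff \<Lambda> v k r \<phi> S =
     fps_nth (\<Sum>j=1..k. fps_X ^ j *
       (fps_compose (Abs_fps (\<lambda>m. (deriv ^^ m) (\<Lambda> j) r / fact m)) (Abs_fps (\<lambda>i. v i r \<phi> S))
        - fps_const (\<Lambda> j r))) k"

definition averaging_R ::
  "nat \<Rightarrow> (nat \<Rightarrow> real \<Rightarrow> real \<Rightarrow> real \<Rightarrow> real) \<Rightarrow> (nat \<Rightarrow> real \<Rightarrow> real \<Rightarrow> real \<Rightarrow> real) \<Rightarrow>
   (nat \<Rightarrow> real) \<Rightarrow> (nat \<Rightarrow> real \<Rightarrow> real) \<Rightarrow> (nat \<Rightarrow> real \<Rightarrow> real \<Rightarrow> real \<Rightarrow> real) \<Rightarrow>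
   nat \<Rightarrow> real \<Rightarrow> real \<Rightarrow> real \<Rightarrow> real" where
  "averaging_R q fk gk s \<Lambda> v k r \<phi> S =
     taylor_coeff \<Lambda> v k r \<phi> S
     - (if k > q then (1 - real k / real q) * v (k - q) r \<phi> S else 0)
     - (\<Sum>i=1..<k. fk i r \<phi> S * deriv (\<lambda>x. v (k - i) x \<phi> S) r
                  + inverse r * gk i r \<phi> S * deriv (\<lambda>x. v (k - i) r x S) \<phi>
                  + sigma q s i * deriv (\<lambda>x. v (k - i) r \<phi> x) S)"

definition homological_rhs ::
  "nat \<Rightarrow> (nat \<Rightarrow> real \<Rightarrow> real \<Rightarrow> real \<Rightarrow> real) \<Rightarrow> (nat \<Rightarrow> real \<Rightarrow> real \<Rightarrow> real \<Rightarrow> real) \<Rightarrow>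
   (nat \<Rightarrow> real) \<Rightarrow> (nat \<Rightarrow> real \<Rightarrow> real) \<Rightarrow> (nat \<Rightarrow> real \<Rightarrow> real \<Rightarrow> real \<Rightarrow> real) \<Rightarrow>
   nat \<Rightarrow> real \<Rightarrow> real \<Rightarrow> real \<Rightarrow> real" where
  "homological_rhs q fk gk s \<Lambda> v k r \<phi> S =
     \<Lambda> k r - fk k r \<phi> S + averaging_R q fk gk s \<Lambda> v k r \<phi> S"

definition near_identity ::
  "nat \<Rightarrow> (nat \<Rightarrow> real) \<Rightarrow> nat \<Rightarrow> (nat \<Rightarrow> real \<Rightarrow> real \<Rightarrow> real \<Rightarrow> real) \<Rightarrow>
   real \<Rightarrow> real \<Rightarrow> real \<Rightarrow> real" where
  "near_identity q s N v r \<phi> t =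
     r + (\<Sum>k=1..N. t powr (- (real k / real q)) * v k r \<phi> (phase q s t))"

definition truncated_rhs :: "nat \<Rightarrow> nat \<Rightarrow> (nat \<Rightarrow> real \<Rightarrow> real) \<Rightarrow> real \<Rightarrow> real \<Rightarrow> real" where
  "truncated_rhs q N \<Lambda> \<rho> t = (\<Sum>k=1..N. t powr (- (real k / real q)) * \<Lambda> k \<rho>)"

(* The recursion determines \<Lambda> k and v k for 0 < |r| < rs; together with continuity this fixes
   them for |r| \<le> rs. The point r = 0 is left out of the recursion because of the factor 1/r
   (a removable singularity for k < 2 * p, whereas inverse 0 = 0 would give wrong values),
   the points r = rs and r = -rs because deriv is two-sided. In the Fourier division, quotients
   with a vanishing denominator have a vanishing numerator by divisors_nonzero. *)
locale averaging = perturbed_system r0 q p \<omega> f g fk gk s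
  for r0 :: real and q p :: nat
    and \<omega> :: "real \<Rightarrow> real"
    and f g :: "real \<Rightarrow> real \<Rightarrow> real \<Rightarrow> real \<Rightarrow> real"
    and fk gk :: "nat \<Rightarrow> real \<Rightarrow> real \<Rightarrow> real \<Rightarrow> real"
    and s :: "nat \<Rightarrow> real" +
  fixes N :: nat and rs ts :: real
    and \<Lambda> :: "nat \<Rightarrow> real \<Rightarrow> real"
    and v :: "nat \<Rightarrow> real \<Rightarrow> real \<Rightarrow> real \<Rightarrow> real"
  assumes N_range: "p \<le> N" "N < 2 * p"
    and rs_range: "0 < rs" "rs < r0"
    and divisors_nonzero: "\<And>k r r' k1 k1' k2. k \<in> {1..N} \<Longrightarrow> 0 < \<bar>r'\<bar> \<Longrightarrow> \<bar>r'\<bar> < rs \<Longrightarrow>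
          fourier_coeff (homological_rhs q fk gk s \<Lambda> v k r') k1' k2 \<noteq> 0 \<Longrightarrow>
          \<bar>r\<bar> \<le> rs \<Longrightarrow> \<bar>k1\<bar> + \<bar>k2\<bar> \<noteq> 0 \<Longrightarrow>
          of_int k1 * \<omega> r + of_int k2 * s 0 \<noteq> 0"
    and v_convention: "\<And>i r \<phi> S. i < 1 \<or> i > N \<Longrightarrow> v i r \<phi> S = 0"
    and Lambda_smooth: "\<And>k. k \<in> {1..N} \<Longrightarrow> smooth_on {-rs..rs} (\<Lambda> k)"
    and v_smooth: "\<And>k. k \<in> {1..N} \<Longrightarrow>
          smooth_on ({-rs..rs} \<times> UNIV \<times> UNIV) (\<lambda>(r, \<phi>, S). v k r \<phi> S)"
    and v_periodic: "\<And>k r. k \<in> {1..N} \<Longrightarrow> \<bar>r\<bar> \<le> rs \<Longrightarrow> periodic2 (v k r)"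
    and v_zero_mean: "\<And>k r. k \<in> {1..N} \<Longrightarrow> \<bar>r\<bar> \<le> rs \<Longrightarrow> mean2 (v k r) = 0"
    and Lambda_eq: "\<And>k r. k \<in> {1..N} \<Longrightarrow> 0 < \<bar>r\<bar> \<Longrightarrow> \<bar>r\<bar> < rs \<Longrightarrow>
          \<Lambda> k r = mean2 (\<lambda>\<phi> S. fk k r \<phi> S - averaging_R q fk gk s \<Lambda> v k r \<phi> S)"
    and v_equation: "\<And>k r \<phi> S. k \<in> {1..N} \<Longrightarrow> 0 < \<bar>r\<bar> \<Longrightarrow> \<bar>r\<bar> < rs \<Longrightarrow>
          \<omega> r * deriv (\<lambda>x. v k r x S) \<phi> + s 0 * deriv (\<lambda>x. v k r \<phi> x) S
            = homological_rhs q fk gk s \<Lambda> v k r \<phi> S"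
    and v_fourier: "\<And>k r k1 k2. k \<in> {1..N} \<Longrightarrow> 0 < \<bar>r\<bar> \<Longrightarrow> \<bar>r\<bar> < rs \<Longrightarrow> \<bar>k1\<bar> + \<bar>k2\<bar> \<noteq> 0 \<Longrightarrow>
          fourier_coeff (v k r) k1 k2
            = fourier_coeff (homological_rhs q fk gk s \<Lambda> v k r) k1 k2
              / (\<i> * complex_of_real (of_int k1 * \<omega> r + of_int k2 * s 0))"
    and ts_pos: "ts > 0"
    and change_injective: "inj_on (\<lambda>(r, \<phi>, t). (near_identity q s N v r \<phi> t, \<phi>, t))
          ({-rs..rs} \<times> UNIV \<times> {ts..})"
    and change_regular: "\<And>r \<phi> t. \<bar>r\<bar> < rs \<Longrightarrow> t \<ge> ts \<Longrightarrow>
          deriv (\<lambda>x. near_identity q s N v x \<phi> t) r > 0"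

(* The system has the factor 1/r, so r is required not to vanish along a solution. *)
definition perturbed_solution ::
  "real \<Rightarrow> nat \<Rightarrow> (nat \<Rightarrow> real) \<Rightarrow> (real \<Rightarrow> real) \<Rightarrow>
   (real \<Rightarrow> real \<Rightarrow> real \<Rightarrow> real \<Rightarrow> real) \<Rightarrow> (real \<Rightarrow> real \<Rightarrow> real \<Rightarrow> real \<Rightarrow> real) \<Rightarrow>
   real \<Rightarrow> (real \<Rightarrow> real) \<Rightarrow> (real \<Rightarrow> real) \<Rightarrow> bool" where
  "perturbed_solution r0 q s \<omega> f g t0 r \<phi> \<longleftrightarrow>
     (\<forall>t\<ge>t0. r t \<noteq> 0 \<and> \<bar>r t\<bar> \<le> r0 \<and>
        (r has_real_derivative f (r t) (\<phi> t) (phase q s t) t) (at t within {t0..}) \<and>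
        (\<phi> has_real_derivative \<omega> (r t) + inverse (r t) * g (r t) (\<phi> t) (phase q s t) t)
          (at t within {t0..}))"

definition truncated_solution ::
  "nat \<Rightarrow> nat \<Rightarrow> (real \<Rightarrow> real) \<Rightarrow> (nat \<Rightarrow> real \<Rightarrow> real) \<Rightarrow> real \<Rightarrow> real \<Rightarrow>
   (real \<Rightarrow> real) \<Rightarrow> (real \<Rightarrow> real) \<Rightarrow> bool" where
  "truncated_solution q N \<omega> \<Lambda> rs ts \<rho> \<phi> \<longleftrightarrow>
     (\<forall>t\<ge>ts. \<bar>\<rho> t\<bar> \<le> rs \<and>
        (\<rho> has_real_derivative truncated_rhs q N \<Lambda> (\<rho> t) t) (at t within {ts..}) \<and>
        (\<phi> has_real_derivative \<omega> (\<rho> t)) (at t within {ts..}))"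

definition log_power_expansion :: "(real \<Rightarrow> real) \<Rightarrow> real \<Rightarrow> nat \<Rightarrow> (nat \<Rightarrow> real poly) \<Rightarrow> bool" where
  "log_power_expansion x \<nu> q P \<longleftrightarrow>
     (\<forall>K. (\<lambda>t. x t - (\<Sum>k\<le>K. t powr (- \<nu> - real k / real q) * poly (P k) (ln t)))
            \<in> o[at_top](\<lambda>t. t powr (- \<nu> - real K / real q)))"

end

theory Submission
  imports Defs
begin

text \<open>
Write \<open>e = t powr (- 1/q)\<close>, so that the expansions in \<open>t\<close> proceed in powers of \<open>e\<close> and \<open>t powr \<nu>0\<close> is
\<open>1 / e\<^bsup>p-n\<^esup>\<close>. The proof compares both the perturbed solution and the given solution \<open>\<rho>1\<close> with the
number \<open>x0 = - \<mu> / d\<close>: the expansion of \<open>\<rho>1\<close> says that \<open>t powr \<nu>0 * \<rho>1 t\<close> tends to \<open>x0\<close>, so it is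
enough to keep \<open>t powr \<nu>0 * r t\<close> close to \<open>x0\<close> for all times.

The change of variables \<open>V = r + (\<Sum>k\<le>p. e\<^sup>k v\<^sub>k)\<close> is made so that, by the homological equations, the
terms of order \<open>k \<le> p\<close> in \<open>dV/dt\<close> are \<open>\<Lambda>\<^sub>k\<close> and the Taylor terms of the composition with \<open>V\<close>. In the
tube where \<open>r\<close> is comparable with \<open>e\<^bsup>p-n\<^esup>\<close>, only two of them matter: \<open>dV/dt\<close> is
\<open>lam e\<^sup>n r + \<mu> e\<^sup>p\<close> up to \<open>O(e\<^bsup>p+1\<^esup>)\<close> (\<open>drift_bigo\<close>). After rescaling, \<open>w = t powr \<nu>0 * V - x0\<close>
satisfies \<open>w' = e\<^sup>n (d w + O(e))\<close>, where the derivative of the factor \<open>t powr \<nu>0\<close> contributes to \<open>d\<close>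
exactly when \<open>n = q\<close> (\<open>scaled_drift_bigo\<close>). Since \<open>d < 0\<close>, small intervals around \<open>w = 0\<close> cannot be
left (\<open>trapping\<close>).

The delicate point is the factor \<open>1/r\<close> in the angular equation, which grows in the tube. It always meets
an angular derivative of some \<open>v\<^sub>k\<close>, and for \<open>k < p\<close> the function \<open>v\<^sub>k\<close> vanishes at \<open>r = 0\<close>
(\<open>v_vanishes_at_zero\<close>): in the limit \<open>r \<rightarrow> 0\<close> the homological equation says that \<open>v\<^sub>k\<close> is invariant under
a non-resonant linear flow on the torus, hence constant, hence equal to its mean zero. The same limit gives
\<open>\<Lambda>\<^sub>k 0 = 0\<close> for \<open>k < p\<close> and \<open>\<Lambda>\<^sub>p 0 = \<mu>\<close>.

For the existence of solutions, the radius is replaced by its projection onto the tube in the right-hand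
sides. The modified system is bounded and locally Lipschitz, so Picard iteration solves it for all times;
trapping shows that the modification is never active (\<open>solution_exists_in_tube\<close>). Finally, the angular
velocity tends to \<open>\<omega> 0\<close> in the tube, which gives the asymptotics of the phase.
\<close>

section \<open>Smooth functions on sets\<close>

lemma C_diff_partial:
  assumes "\<forall>m. C_diff m U G" "b \<in> Basis"
  shows "\<forall>m. C_diff m U (\<lambda>x. frechet_derivative G (at x) b)"
  using assms by (metis C_diff.simps(2))

lemma C_diff_imp_differentiable:
  assumes "\<forall>m. C_diff m U G" "x \<in> U"
  shows "G differentiable (at x)"
  using assms by (metis C_diff.simps(2))

lemma C_diff_imp_continuous_on: "\<forall>m. C_diff m U G \<Longrightarrow> continuous_on U G"
  by (metis C_diff.simps(1))

lemma smooth_onE: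
  assumes "smooth_on T F"
  obtains U G where "open U" "T \<subseteq> U" "\<forall>x\<in>T. G x = F x" "\<forall>m. C_diff m U G"
  using assms unfolding smooth_on_def by (elim exE conjE) (rule that)

lemma smooth_onI:
  assumes "open U" "T \<subseteq> U" "\<And>x. x \<in> T \<Longrightarrow> G x = F x" "\<forall>m. C_diff m U G"
  shows "smooth_on T F"
  unfolding smooth_on_def using assms by (intro exI[of _ U] exI[of _ G]) auto

lemma smooth_on_subset: "smooth_on T F \<Longrightarrow> T' \<subseteq> T \<Longrightarrow> smooth_on T' F"
  unfolding smooth_on_def by (elim exE conjE, intro exI conjI) auto

lemma smooth_on_cong:
  assumes "smooth_on T F" "\<And>x. x \<in> T \<Longrightarrow> F x = F' x"
  shows "smooth_on T F'"
proof -
  obtain U G where "open U" "T \<subseteq> U" "\<forall>x\<in>T. G x = F x" "\<forall>m. C_diff m U G"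
    using assms(1) by (rule smooth_onE)
  then show ?thesis
    using assms(2) by (intro smooth_onI) auto
qed

lemma smooth_on_imp_continuous_on:
  assumes "smooth_on T F"
  shows "continuous_on T F"
proof -
  obtain U G where *: "open U" "T \<subseteq> U" "\<forall>x\<in>T. G x = F x" "\<forall>m. C_diff m U G"
    using assms by (rule smooth_onE)
  have "continuous_on T G"
    using continuous_on_subset[OF C_diff_imp_continuous_on[OF *(4)] *(2)] .
  then show ?thesis using *(3) continuous_on_cong by force
qed

lemma frechet_derivative_eq_local:
  assumes "open T" "x \<in> T" "\<And>y. y \<in> T \<Longrightarrow> G y = F y" "G differentiable (at x)"
  shows "F differentiable (at x)" "frechet_derivative F (at x) = frechet_derivative G (at x)"
proof -
  have "(G has_derivative frechet_derivative G (at x)) (at x)"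
    using assms(4) frechet_derivative_works by blast
  then have *: "(F has_derivative frechet_derivative G (at x)) (at x)"
    using has_derivative_transform_within_open assms by blast
  then show "F differentiable (at x)" by (auto simp: differentiable_def)
  show "frechet_derivative F (at x) = frechet_derivative G (at x)"
    using frechet_derivative_at[OF *] by simp
qed

lemma smooth_on_open_differentiable:
  assumes "smooth_on T F" "open T" "x \<in> T"
  shows "F differentiable (at x)"
proof -
  obtain U G where *: "T \<subseteq> U" "\<forall>x\<in>T. G x = F x" "\<forall>m. C_diff m U G"
    using assms(1) by (rule smooth_onE)
  show ?thesis
    by (rule frechet_derivative_eq_local(1)[of T x G F])
       (use * assms C_diff_imp_differentiable[OF *(3), of x] in auto)
qed

lemma smooth_on_open_partial:
  assumes "smooth_on T F" "open T" "b \<in> Basis"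
  shows "smooth_on T (\<lambda>x. frechet_derivative F (at x) b)"
proof -
  obtain U G where *: "open U" "T \<subseteq> U" "\<forall>x\<in>T. G x = F x" "\<forall>m. C_diff m U G"
    using assms(1) by (rule smooth_onE)
  have "frechet_derivative F (at x) = frechet_derivative G (at x)" if "x \<in> T" for x
    by (rule frechet_derivative_eq_local(2)[of T x G F])
       (use * assms(2) that C_diff_imp_differentiable[OF *(4), of x] in auto)
  then show ?thesis
    by (intro smooth_onI[OF *(1,2) _ C_diff_partial[OF *(4) assms(3)]]) simp
qed

text \<open>The partial derivatives of a smooth extension are bounded on a compact set, and convexity makes the mean value inequality applicable with that bound.\<close>
lemma smooth_on_lipschitz_compact:
  fixes F :: "'a::euclidean_space \<Rightarrow> real"
  assumes "smooth_on T F" "compact K" "convex K" "K \<subseteq> T"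
  shows "\<exists>L\<ge>0. \<forall>x\<in>K. \<forall>y\<in>K. \<bar>F x - F y\<bar> \<le> L * norm (x - y)"
proof -
  obtain U G where *: "open U" "T \<subseteq> U" "\<forall>x\<in>T. G x = F x" "\<forall>m. C_diff m U G"
    using assms(1) by (rule smooth_onE)
  define D where "D x = frechet_derivative G (at x)" for x
  have der: "(G has_derivative D x) (at x)" if "x \<in> U" for x
    unfolding D_def frechet_derivative_works[symmetric] by (rule C_diff_imp_differentiable[OF *(4) that])
  have "\<exists>M. \<forall>x\<in>K. \<bar>D x b\<bar> \<le> M" if "b \<in> Basis" for b
  proof -
    have "continuous_on K (\<lambda>x. D x b)"
      using C_diff_imp_continuous_on[OF C_diff_partial[OF *(4) that]] assms(4) *(2)
      unfolding D_def by (elim continuous_on_subset) auto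
    then have "bounded ((\<lambda>x. D x b) ` K)"
      using assms(2) compact_continuous_image compact_imp_bounded by blast
    then show ?thesis unfolding bounded_iff by auto
  qed
  then obtain M where M: "\<And>b x. b \<in> Basis \<Longrightarrow> x \<in> K \<Longrightarrow> \<bar>D x b\<bar> \<le> M b" by metis
  define L where "L = (\<Sum>b\<in>Basis. \<bar>M b\<bar>)"
  have on: "onorm (D x) \<le> L" if "x \<in> K" for x
  proof (rule onorm_le)
    fix y
    have lin: "linear (D x)"
      using der[of x] that assms(4) *(2) has_derivative_bounded_linear bounded_linear.linear by blast
    have "D x y = D x (\<Sum>b\<in>Basis. (y \<bullet> b) *\<^sub>R b)" by (simp add: euclidean_representation)
    also have "\<dots> = (\<Sum>b\<in>Basis. (y \<bullet> b) * D x b)"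
      using lin by (simp add: linear_sum linear_cmul)
    finally have "\<bar>D x y\<bar> \<le> (\<Sum>b\<in>Basis. \<bar>(y \<bullet> b) * D x b\<bar>)"
      using sum_abs by metis
    also have "\<dots> \<le> (\<Sum>b\<in>Basis. norm y * \<bar>M b\<bar>)"
    proof (rule sum_mono)
      fix b :: 'a assume b: "b \<in> Basis"
      have "\<bar>D x b\<bar> \<le> \<bar>M b\<bar>" using M[OF b that] by linarith
      then show "\<bar>(y \<bullet> b) * D x b\<bar> \<le> norm y * \<bar>M b\<bar>"
        unfolding abs_mult using Basis_le_norm[OF b, of y] by (intro mult_mono) auto
    qed
    also have "\<dots> = L * norm y" by (simp add: L_def sum_distrib_left mult.commute)
    finally show "norm (D x y) \<le> L * norm y" by simp
  qed
  have "\<bar>F x - F y\<bar> \<le> L * norm (x - y)" if "x \<in> K" "y \<in> K" for x y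
  proof -
    have "norm (G x - G y) \<le> L * norm (x - y)"
    proof (rule differentiable_bound[OF assms(3) _ on that])
      show "(G has_derivative D z) (at z within K)" if "z \<in> K" for z
        using der[of z] that assms(4) *(2) has_derivative_at_withinI by blast
    qed auto
    then show ?thesis using *(3) that assms(4) by (metis subsetD real_norm_def)
  qed
  moreover have "L \<ge> 0" unfolding L_def by (simp add: sum_nonneg)
  ultimately show ?thesis by blast
qed

lemma smooth_on_deriv_real:
  fixes F :: "real \<Rightarrow> real"
  assumes "smooth_on T F" "open T"
  shows "smooth_on T (deriv F)"
proof -
  have s: "smooth_on T (\<lambda>x. frechet_derivative F (at x) 1)"
    using smooth_on_open_partial[OF assms] by simp
  have eq: "deriv F x = frechet_derivative F (at x) 1" if x: "x \<in> T" for x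
  proof -
    obtain D where D: "(F has_real_derivative D) (at x)"
      using smooth_on_open_differentiable[OF assms x] real_differentiable_def by blast
    then have "(F has_derivative (*) D) (at x)" by (simp add: has_field_derivative_def)
    from frechet_derivative_at[OF this] DERIV_imp_deriv[OF D]
    show ?thesis by (metis mult.right_neutral)
  qed
  show ?thesis by (rule smooth_on_cong[OF s]) (simp add: eq)
qed

lemma smooth_on_higher_deriv_real:
  fixes F :: "real \<Rightarrow> real"
  assumes "smooth_on T F" "open T"
  shows "smooth_on T ((deriv ^^ m) F)"
proof (induction m)
  case 0 show ?case using assms(1) by simp
next
  case (Suc m) show ?case using smooth_on_deriv_real[OF Suc assms(2)] by simp
qed

section \<open>Smooth periodic functions near the circle of radius zero\<close>

text \<open>Convergence of the radius to \<open>0\<close> through nonzero values, with no condition on the two angles. A Landau estimate along this filter is uniform in the angles, and \<open>fst\<close> is the radius as a function on it.\<close>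
definition zero_radius :: "(real \<times> real \<times> real) filter" where
  "zero_radius = filtercomap fst (at 0)"

text \<open>An open set, so that smoothness on it provides two-sided derivatives.\<close>
definition cylinder :: "real \<Rightarrow> (real \<times> real \<times> real) set" where
  "cylinder R = {-R<..<R} \<times> UNIV"

lemma open_cylinder: "open (cylinder R)"
  unfolding cylinder_def by (intro open_Times) auto

lemma mem_cylinder [simp]: "(r, \<phi>, S) \<in> cylinder R \<longleftrightarrow> \<bar>r\<bar> < R"
  unfolding cylinder_def by auto

text \<open>The averaging recursion is written with derivatives along the coordinates; these formulas connect it with the chain rule and with the smoothness of the partial derivatives.\<close>
lemma cylinder_total_derivative:
  fixes H :: "real \<Rightarrow> real \<Rightarrow> real \<Rightarrow> real"
  assumes "smooth_on (cylinder R) (\<lambda>(r, \<phi>, S). H r \<phi> S)" "\<bar>r\<bar> < R"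
  shows "((\<lambda>(r, \<phi>, S). H r \<phi> S) has_derivative
           (\<lambda>(a, b, c). deriv (\<lambda>x. H x \<phi> S) r * a + deriv (\<lambda>x. H r x S) \<phi> * b + deriv (\<lambda>x. H r \<phi> x) S * c))
           (at (r, \<phi>, S))"
    and "frechet_derivative (\<lambda>(r, \<phi>, S). H r \<phi> S) (at (r, \<phi>, S)) (1, 0, 0) = deriv (\<lambda>x. H x \<phi> S) r"
    and "frechet_derivative (\<lambda>(r, \<phi>, S). H r \<phi> S) (at (r, \<phi>, S)) (0, 1, 0) = deriv (\<lambda>x. H r x S) \<phi>"
    and "frechet_derivative (\<lambda>(r, \<phi>, S). H r \<phi> S) (at (r, \<phi>, S)) (0, 0, 1) = deriv (\<lambda>x. H r \<phi> x) S"
    and "((\<lambda>x. H x \<phi> S) has_real_derivative deriv (\<lambda>x. H x \<phi> S) r) (at r)"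
    and "((\<lambda>x. H r x S) has_real_derivative deriv (\<lambda>x. H r x S) \<phi>) (at \<phi>)"
    and "((\<lambda>x. H r \<phi> x) has_real_derivative deriv (\<lambda>x. H r \<phi> x) S) (at S)"
proof -
  define H' where "H' = (\<lambda>(r, \<phi>, S). H r \<phi> S)"
  define D where "D = frechet_derivative H' (at (r, \<phi>, S))"
  have D: "(H' has_derivative D) (at (r, \<phi>, S))"
    unfolding D_def frechet_derivative_works[symmetric] H'_def
    by (rule smooth_on_open_differentiable[OF assms(1) open_cylinder]) (simp add: assms(2))
  have lin: "linear D" by (rule bounded_linear.linear[OF has_derivative_bounded_linear[OF D]])
  have line: "((\<lambda>x. H' (c x)) has_real_derivative D u) (at x)"
    if "(c has_derivative (\<lambda>h. h *\<^sub>R u)) (at x)" "c x = (r, \<phi>, S)" for c u and x :: real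
  proof -
    have "((\<lambda>x. H' (c x)) has_derivative (\<lambda>h. D (h *\<^sub>R u))) (at x)"
      using has_derivative_compose[OF that(1)] D that(2) by simp
    moreover have "(\<lambda>h. D (h *\<^sub>R u)) = (*) (D u)"
      by (rule ext) (simp add: linear_cmul[OF lin])
    ultimately show ?thesis by (simp only: has_field_derivative_def)
  qed
  have axes: "((\<lambda>x. (x, \<phi>, S)) has_derivative (\<lambda>h. (h, 0, 0))) (at r)"
    "((\<lambda>x. (r, x, S)) has_derivative (\<lambda>h. (0, h, 0))) (at \<phi>)"
    "((\<lambda>x. (r, \<phi>, x)) has_derivative (\<lambda>h. (0, 0, h))) (at S)"
    by (intro has_derivative_Pair has_derivative_ident has_derivative_const)+
  have 1: "((\<lambda>x. H x \<phi> S) has_real_derivative D (1, 0, 0)) (at r)"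
    using line[of "\<lambda>x. (x, \<phi>, S)" "(1, 0, 0)" r] axes by (simp add: H'_def)
  have 2: "((\<lambda>x. H r x S) has_real_derivative D (0, 1, 0)) (at \<phi>)"
    using line[of "\<lambda>x. (r, x, S)" "(0, 1, 0)" \<phi>] axes by (simp add: H'_def)
  have 3: "((\<lambda>x. H r \<phi> x) has_real_derivative D (0, 0, 1)) (at S)"
    using line[of "\<lambda>x. (r, \<phi>, x)" "(0, 0, 1)" S] axes by (simp add: H'_def)
  note e = DERIV_imp_deriv[OF 1] DERIV_imp_deriv[OF 2] DERIV_imp_deriv[OF 3]
  have D_eq: "D (a, b, c) = D (1, 0, 0) * a + D (0, 1, 0) * b + D (0, 0, 1) * c" for a b c
  proof -
    have "(a, b, c) = a *\<^sub>R (1, 0, 0) + b *\<^sub>R (0, 1, 0) + c *\<^sub>R (0, 0, 1::real)" by simp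
    then have "D (a, b, c) = D (a *\<^sub>R (1, 0, 0) + b *\<^sub>R (0, 1, 0) + c *\<^sub>R (0, 0, 1))" by (rule arg_cong)
    also have "\<dots> = a *\<^sub>R D (1, 0, 0) + b *\<^sub>R D (0, 1, 0) + c *\<^sub>R D (0, 0, 1)"
      by (simp only: linear_add[OF lin] linear_cmul[OF lin])
    finally show ?thesis by simp
  qed
  have "D = (\<lambda>(a, b, c). deriv (\<lambda>x. H x \<phi> S) r * a + deriv (\<lambda>x. H r x S) \<phi> * b + deriv (\<lambda>x. H r \<phi> x) S * c)"
  proof
    show "D z = (case z of (a, b, c) \<Rightarrow> deriv (\<lambda>x. H x \<phi> S) r * a + deriv (\<lambda>x. H r x S) \<phi> * b + deriv (\<lambda>x. H r \<phi> x) S * c)" for z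
    proof -
      obtain a b c where "z = (a, b, c)" by (cases z)
      then show ?thesis using D_eq[of a b c] unfolding e by simp
    qed
  qed
  with D show "((\<lambda>(r, \<phi>, S). H r \<phi> S) has_derivative
           (\<lambda>(a, b, c). deriv (\<lambda>x. H x \<phi> S) r * a + deriv (\<lambda>x. H r x S) \<phi> * b + deriv (\<lambda>x. H r \<phi> x) S * c))
           (at (r, \<phi>, S))" unfolding H'_def by simp
  show "frechet_derivative (\<lambda>(r, \<phi>, S). H r \<phi> S) (at (r, \<phi>, S)) (1, 0, 0) = deriv (\<lambda>x. H x \<phi> S) r"
    "frechet_derivative (\<lambda>(r, \<phi>, S). H r \<phi> S) (at (r, \<phi>, S)) (0, 1, 0) = deriv (\<lambda>x. H r x S) \<phi>"
    "frechet_derivative (\<lambda>(r, \<phi>, S). H r \<phi> S) (at (r, \<phi>, S)) (0, 0, 1) = deriv (\<lambda>x. H r \<phi> x) S"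
    unfolding e unfolding D_def H'_def by (rule refl)+
  show "((\<lambda>x. H x \<phi> S) has_real_derivative deriv (\<lambda>x. H x \<phi> S) r) (at r)"
    "((\<lambda>x. H r x S) has_real_derivative deriv (\<lambda>x. H r x S) \<phi>) (at \<phi>)"
    "((\<lambda>x. H r \<phi> x) has_real_derivative deriv (\<lambda>x. H r \<phi> x) S) (at S)"
    unfolding e by (rule 1, rule 2, rule 3)
qed

lemma cylinder_smooth_partials:
  fixes H :: "real \<Rightarrow> real \<Rightarrow> real \<Rightarrow> real"
  assumes "smooth_on (cylinder R) (\<lambda>(r, \<phi>, S). H r \<phi> S)"
  shows "smooth_on (cylinder R) (\<lambda>(r, \<phi>, S). deriv (\<lambda>x. H x \<phi> S) r)"
    and "smooth_on (cylinder R) (\<lambda>(r, \<phi>, S). deriv (\<lambda>x. H r x S) \<phi>)"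
    and "smooth_on (cylinder R) (\<lambda>(r, \<phi>, S). deriv (\<lambda>x. H r \<phi> x) S)"
proof -
  note p = smooth_on_open_partial[OF assms open_cylinder]
  note q = cylinder_total_derivative(2-4)[OF assms]
  have B: "(1, 0, 0) \<in> (Basis :: (real \<times> real \<times> real) set)" "(0, 1, 0) \<in> (Basis :: (real \<times> real \<times> real) set)"
    "(0, 0, 1) \<in> (Basis :: (real \<times> real \<times> real) set)" by (auto simp: Basis_prod_def zero_prod_def)
  show "smooth_on (cylinder R) (\<lambda>(r, \<phi>, S). deriv (\<lambda>x. H x \<phi> S) r)"
    by (rule smooth_on_cong[OF p[OF B(1)]]) (auto simp: q)
  show "smooth_on (cylinder R) (\<lambda>(r, \<phi>, S). deriv (\<lambda>x. H r x S) \<phi>)"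
    by (rule smooth_on_cong[OF p[OF B(2)]]) (auto simp: q)
  show "smooth_on (cylinder R) (\<lambda>(r, \<phi>, S). deriv (\<lambda>x. H r \<phi> x) S)"
    by (rule smooth_on_cong[OF p[OF B(3)]]) (auto simp: q)
qed

lemma periodic2_deriv:
  assumes "\<And>r. \<bar>r\<bar> < R \<Longrightarrow> periodic2 (H r)" "\<bar>r\<bar> < R"
  shows "periodic2 (\<lambda>\<phi> S. deriv (\<lambda>x. H x \<phi> S) r)"
    and "periodic2 (\<lambda>\<phi> S. deriv (\<lambda>x. H r x S) \<phi>)"
    and "periodic2 (\<lambda>\<phi> S. deriv (\<lambda>x. H r \<phi> x) S)"
proof -
  have H: "H r (\<phi> + 2 * pi) S = H r \<phi> S" "H r \<phi> (S + 2 * pi) = H r \<phi> S" if "\<bar>r\<bar> < R" for r \<phi> S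
    using assms(1)[OF that] unfolding periodic2_def by auto
  have "eventually (\<lambda>x. \<bar>x\<bar> < R) (nhds r)"
    by (rule eventually_mono[OF eventually_nhds_in_open[of "{-R<..<R}" r]]) (use assms(2) in auto)
  note near = eventually_mono[OF this H(1)] eventually_mono[OF this H(2)]
  show "periodic2 (\<lambda>\<phi> S. deriv (\<lambda>x. H x \<phi> S) r)"
    unfolding periodic2_def by (intro allI conjI deriv_cong_ev[OF near(1)] deriv_cong_ev[OF near(2)] refl)
  have shift: "deriv h (x + 2 * pi) = deriv h x" if "\<And>x. h (x + 2 * pi) = h x" for h :: "real \<Rightarrow> real" and x
  proof -
    have "(h has_real_derivative D) (at (x + 2 * pi)) \<longleftrightarrow> (h has_real_derivative D) (at x)" for D
      using DERIV_shift[of h D x "2 * pi"] that by simp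
    then show ?thesis unfolding deriv_def by simp
  qed
  show "periodic2 (\<lambda>\<phi> S. deriv (\<lambda>x. H r x S) \<phi>)"
    unfolding periodic2_def by (intro allI conjI shift) (simp_all add: H assms(2))
  have "H r (\<phi> + 2 * pi) = H r \<phi>" for \<phi>
    using H(1)[OF assms(2)] by blast
  then show "periodic2 (\<lambda>\<phi> S. deriv (\<lambda>x. H r \<phi> x) S)"
    unfolding periodic2_def by (intro allI conjI shift) (simp_all add: H assms(2))
qed

lemma periodic_shift_int:
  fixes h :: "real \<Rightarrow> 'a"
  assumes "\<And>x. h (x + c) = h x"
  shows "h (x + of_int m * c) = h x"
proof (induction m rule: int_induct[where k = 0])
  case (step1 i) then show ?case using assms[of "x + of_int i * c"] by (simp add: algebra_simps)
next
  case (step2 i) then show ?case using assms[of "x + of_int (i - 1) * c"] by (simp add: algebra_simps)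
qed simp

lemma periodic2_fundamental_domain:
  assumes "\<And>r. r \<in> I \<Longrightarrow> periodic2 (H r)"
  obtains \<phi>' S' where "\<phi>' \<in> {0..2 * pi}" "S' \<in> {0..2 * pi}" "\<And>r. r \<in> I \<Longrightarrow> H r \<phi>' S' = H r \<phi> S"
proof -
  define red where "red x = x + of_int (- \<lfloor>x / (2 * pi)\<rfloor>) * (2 * pi)" for x :: real
  have red: "red x \<in> {0..2 * pi}" for x
  proof -
    have "of_int \<lfloor>x / (2 * pi)\<rfloor> * (2 * pi) \<le> x" "x < (of_int \<lfloor>x / (2 * pi)\<rfloor> + 1) * (2 * pi)"
      by (intro floor_divide_lower floor_divide_upper; simp)+
    then show ?thesis by (simp add: red_def algebra_simps)
  qed
  have "H r (red \<phi>) (red S) = H r \<phi> S" if "r \<in> I" for r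
  proof -
    have p: "H r (x + 2 * pi) y = H r x y" "H r x (y + 2 * pi) = H r x y" for x y
      using assms[OF that] unfolding periodic2_def by auto
    have "H r (red \<phi>) (red S) = H r \<phi> (red S)"
      unfolding red_def[of \<phi>] by (rule periodic_shift_int[where h = "\<lambda>x. H r x (red S)"]) (simp add: p)
    also have "\<dots> = H r \<phi> S"
      unfolding red_def[of S] by (rule periodic_shift_int[where h = "\<lambda>x. H r \<phi> x"]) (simp add: p)
    finally show ?thesis .
  qed
  then show ?thesis by (intro that[of "red \<phi>" "red S"] red)
qed

text \<open>By periodicity the angles can be moved into a compact square without changing any of the values on the same fibre, so that bounds over a compact set become uniform bounds.\<close>
lemma periodic_uniform_bounds:
  fixes H :: "real \<Rightarrow> real \<Rightarrow> real \<Rightarrow> real"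
  assumes "smooth_on ({-R..R} \<times> UNIV) (\<lambda>(r, \<phi>, S). H r \<phi> S)" "\<And>r. \<bar>r\<bar> \<le> R \<Longrightarrow> periodic2 (H r)" "R > 0"
  shows "\<exists>C. \<forall>r \<phi> S. \<bar>r\<bar> \<le> R \<longrightarrow> \<bar>H r \<phi> S - H 0 \<phi> S\<bar> \<le> C * \<bar>r\<bar>"
    and "\<exists>C. \<forall>r \<phi> S. \<bar>r\<bar> \<le> R \<longrightarrow> \<bar>H r \<phi> S\<bar> \<le> C"
proof -
  define K :: "(real \<times> real \<times> real) set" where "K = {-R..R} \<times> {0..2 * pi} \<times> {0..2 * pi}"
  have K: "compact K" "convex K" "K \<subseteq> {-R..R} \<times> UNIV"
    unfolding K_def by (auto intro!: compact_Times convex_Times)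
  obtain L where L: "\<And>x y. x \<in> K \<Longrightarrow> y \<in> K \<Longrightarrow> \<bar>(\<lambda>(r, \<phi>, S). H r \<phi> S) x - (\<lambda>(r, \<phi>, S). H r \<phi> S) y\<bar> \<le> L * norm (x - y)"
    using smooth_on_lipschitz_compact[OF assms(1) K] by blast
  have "continuous_on K (\<lambda>(r, \<phi>, S). H r \<phi> S)"
    using smooth_on_imp_continuous_on[OF assms(1)] K(3) continuous_on_subset by blast
  then have "bounded ((\<lambda>(r, \<phi>, S). H r \<phi> S) ` K)"
    using K(1) compact_continuous_image compact_imp_bounded by blast
  then obtain M where M: "\<And>x. x \<in> K \<Longrightarrow> \<bar>(\<lambda>(r, \<phi>, S). H r \<phi> S) x\<bar> \<le> M"
    unfolding bounded_iff ball_simps real_norm_def by (meson that)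
  have red: "\<exists>\<phi>' S'. \<phi>' \<in> {0..2 * pi} \<and> S' \<in> {0..2 * pi} \<and> (\<forall>r. \<bar>r\<bar> \<le> R \<longrightarrow> H r \<phi>' S' = H r \<phi> S)" for \<phi> S
  proof -
    obtain \<phi>' S' where "\<phi>' \<in> {0..2 * pi}" "S' \<in> {0..2 * pi}" "\<And>r. r \<in> {-R..R} \<Longrightarrow> H r \<phi>' S' = H r \<phi> S"
    proof (rule periodic2_fundamental_domain[of "{-R..R}" H \<phi> S])
      show "periodic2 (H r)" if "r \<in> {-R..R}" for r
        by (rule assms(2)) (use that in auto)
    qed (rule that)
    note * = this
    show ?thesis by (rule exI[of _ \<phi>'], rule exI[of _ S']) (use * in \<open>simp add: abs_le_iff\<close>)
  qed
  show "\<exists>C. \<forall>r \<phi> S. \<bar>r\<bar> \<le> R \<longrightarrow> \<bar>H r \<phi> S - H 0 \<phi> S\<bar> \<le> C * \<bar>r\<bar>"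
  proof (intro exI allI impI)
    fix r \<phi> S :: real assume r: "\<bar>r\<bar> \<le> R"
    obtain \<phi>' S' where *: "\<phi>' \<in> {0..2 * pi}" "S' \<in> {0..2 * pi}" "\<And>r. \<bar>r\<bar> \<le> R \<Longrightarrow> H r \<phi>' S' = H r \<phi> S"
      using red by metis
    have "\<bar>H r \<phi>' S' - H 0 \<phi>' S'\<bar> \<le> L * norm ((r, \<phi>', S') - (0, \<phi>', S'))"
      using L[of "(r, \<phi>', S')" "(0, \<phi>', S')"] * r assms(3) by (simp add: K_def abs_le_iff)
    moreover have "H r \<phi>' S' = H r \<phi> S" "H 0 \<phi>' S' = H 0 \<phi> S" using *(3) r assms(3) by auto
    ultimately show "\<bar>H r \<phi> S - H 0 \<phi> S\<bar> \<le> L * \<bar>r\<bar>" by simp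
  qed
  show "\<exists>C. \<forall>r \<phi> S. \<bar>r\<bar> \<le> R \<longrightarrow> \<bar>H r \<phi> S\<bar> \<le> C"
  proof (intro exI allI impI)
    fix r \<phi> S :: real assume r: "\<bar>r\<bar> \<le> R"
    obtain \<phi>' S' where *: "\<phi>' \<in> {0..2 * pi}" "S' \<in> {0..2 * pi}" "\<And>r. \<bar>r\<bar> \<le> R \<Longrightarrow> H r \<phi>' S' = H r \<phi> S"
      using red by metis
    show "\<bar>H r \<phi> S\<bar> \<le> M"
      using M[of "(r, \<phi>', S')"] *(1,2) *(3)[OF r] r by (simp add: K_def abs_le_iff)
  qed
qed

lemma eventually_zero_radius:
  "R > 0 \<Longrightarrow> eventually (\<lambda>(r, \<phi>, S). r \<noteq> 0 \<and> \<bar>r\<bar> < R) zero_radius"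
  unfolding zero_radius_def eventually_filtercomap
  by (rule exI[of _ "\<lambda>r. r \<noteq> 0 \<and> \<bar>r\<bar> < R"]) (auto simp: eventually_at intro!: exI[of _ R])

lemma periodic_bigo:
  fixes H :: "real \<Rightarrow> real \<Rightarrow> real \<Rightarrow> real"
  assumes "smooth_on (cylinder R) (\<lambda>(r, \<phi>, S). H r \<phi> S)" "\<And>r. \<bar>r\<bar> < R \<Longrightarrow> periodic2 (H r)" "R > 0"
  shows "(\<lambda>(r, \<phi>, S). H r \<phi> S - H 0 \<phi> S) \<in> O[zero_radius](fst)"
    and "(\<lambda>(r, \<phi>, S). H r \<phi> S) \<in> O[zero_radius](\<lambda>_. 1)"
proof -
  have "smooth_on ({-(R/2)..R/2} \<times> UNIV) (\<lambda>(r, \<phi>, S). H r \<phi> S)"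
    by (rule smooth_on_subset[OF assms(1)]) (use assms(3) in \<open>auto simp: cylinder_def\<close>)
  then have b: "\<exists>C. \<forall>r \<phi> S. \<bar>r\<bar> \<le> R/2 \<longrightarrow> \<bar>H r \<phi> S - H 0 \<phi> S\<bar> \<le> C * \<bar>r\<bar>"
    "\<exists>C. \<forall>r \<phi> S. \<bar>r\<bar> \<le> R/2 \<longrightarrow> \<bar>H r \<phi> S\<bar> \<le> C"
    by (rule periodic_uniform_bounds; use assms(2,3) in simp)+
  have ev: "eventually (\<lambda>(r, \<phi>, S). r \<noteq> 0 \<and> \<bar>r\<bar> < R/2) zero_radius"
    by (rule eventually_zero_radius) (use assms(3) in simp)
  obtain C1 where "\<forall>r \<phi> S. \<bar>r\<bar> \<le> R/2 \<longrightarrow> \<bar>H r \<phi> S - H 0 \<phi> S\<bar> \<le> C1 * \<bar>r\<bar>" using b(1) ..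
  then show "(\<lambda>(r, \<phi>, S). H r \<phi> S - H 0 \<phi> S) \<in> O[zero_radius](fst)"
    by (intro bigoI[of _ C1]) (rule eventually_mono[OF ev], auto)
  obtain C2 where "\<forall>r \<phi> S. \<bar>r\<bar> \<le> R/2 \<longrightarrow> \<bar>H r \<phi> S\<bar> \<le> C2" using b(2) ..
  then show "(\<lambda>(r, \<phi>, S). H r \<phi> S) \<in> O[zero_radius](\<lambda>_. 1)"
    by (intro bigoI[of _ C2]) (rule eventually_mono[OF ev], auto)
qed

section \<open>Formal Taylor coefficients\<close>

text \<open>A coefficient of a positive power of \<open>W\<close> is a sum of products of coefficients of \<open>W\<close>; one factor supplies \<open>b\<close>, the others are bounded.\<close>
lemma fps_power_nth_bigo:
  fixes W :: "'a \<Rightarrow> real fps" and b :: "'a \<Rightarrow> real"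
  assumes "\<And>i. i < k \<Longrightarrow> (\<lambda>z. fps_nth (W z) i) \<in> O[F](b)" "b \<in> O[F](\<lambda>_. 1)" "m \<ge> 1" "i < k"
  shows "(\<lambda>z. fps_nth (W z ^ m) i) \<in> O[F](b)"
  using assms(3,4)
proof (induction m arbitrary: i rule: nat_induct_at_least)
  case base
  then show ?case using assms(1) by simp
next
  case (Suc m)
  have "(\<lambda>z. fps_nth (W z) j * fps_nth (W z ^ m) (i - j)) \<in> O[F](b)" if "j \<in> {0..i}" for j
  proof -
    have "(\<lambda>z. fps_nth (W z) j * fps_nth (W z ^ m) (i - j)) \<in> O[F](\<lambda>z. b z * 1)"
      using that Suc by (intro landau_o.big.mult assms(1) landau_o.big.trans[OF Suc.IH assms(2)]) auto
    then show ?thesis by simp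
  qed
  then show ?case unfolding power_Suc fps_mult_nth by (rule big_sum_in_bigo)
qed

text \<open>The subtracted constant removes the zeroth Taylor coefficient. Every remaining term therefore contains a coefficient of a positive power of the series \<open>v\<close>, which is what makes both estimates below possible.\<close>
lemma taylor_coeff_expand:
  "taylor_coeff \<Lambda> v k r \<phi> S =
     (\<Sum>j=1..k. \<Sum>i=1..k-j. (deriv ^^ i) (\<Lambda> j) r / fact i * fps_nth (Abs_fps (\<lambda>i. v i r \<phi> S) ^ i) (k - j))"
proof -
  define W where "W = Abs_fps (\<lambda>i. v i r \<phi> S)"
  have "fps_nth (fps_X ^ j * (fps_compose (Abs_fps (\<lambda>m. (deriv ^^ m) (\<Lambda> j) r / fact m)) W - fps_const (\<Lambda> j r))) k
     = (\<Sum>i=1..k-j. (deriv ^^ i) (\<Lambda> j) r / fact i * fps_nth (W ^ i) (k - j))" if "j \<in> {1..k}" for j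
  proof -
    have "{0..k-j} = insert 0 {1..k-j}" by auto
    then show ?thesis using that
      by (simp add: fps_X_power_mult_nth fps_compose_nth)
  qed
  then show ?thesis
    unfolding taylor_coeff_def W_def[symmetric] fps_sum_nth by (intro sum.cong) auto
qed

lemma real_bigo_punctured:
  fixes h :: "real \<Rightarrow> real"
  assumes "smooth_on {-R<..<R} h" "R > 0"
  shows "(\<lambda>z. h (fst z)) \<in> O[zero_radius](\<lambda>_. 1)"
proof -
  have "isCont h 0"
    using smooth_on_imp_continuous_on[OF assms(1)] assms(2)
    by (simp add: continuous_on_eq_continuous_at)
  then have "(h \<longlongrightarrow> h 0) (at 0)" by (simp add: isCont_def)
  then have "h \<in> O[at 0](\<lambda>_. 1)" by (intro bigoI_tendsto[where c = "h 0"]) auto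
  then show ?thesis
    by (rule landau_o.big.compose) (simp add: zero_radius_def filterlim_filtercomap)
qed

lemma taylor_coeff_bigo:
  assumes "\<And>i. i < k \<Longrightarrow> (\<lambda>(r, \<phi>, S). v i r \<phi> S) \<in> O[zero_radius](fst)"
    and "\<And>j. j \<in> {1..k} \<Longrightarrow> smooth_on {-R<..<R} (\<Lambda> j)" "R > 0"
  shows "(\<lambda>(r, \<phi>, S). taylor_coeff \<Lambda> v k r \<phi> S) \<in> O[zero_radius](fst)"
proof -
  define W where "W z = Abs_fps (\<lambda>i. (case z of (r, \<phi>, S) \<Rightarrow> v i r \<phi> S))" for z
  have fst1: "fst \<in> O[zero_radius](\<lambda>_. 1 :: real)"
    by (rule bigoI[of _ 1], rule eventually_mono[OF eventually_zero_radius[of 1]]) auto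
  have W: "(\<lambda>z. fps_nth (W z ^ i) m) \<in> O[zero_radius](fst)" if "i \<ge> 1" "m < k" for i m
    using assms(1) that by (intro fps_power_nth_bigo[OF _ fst1]) (auto simp: W_def)
  have D: "(\<lambda>z. (deriv ^^ i) (\<Lambda> j) (fst z)) \<in> O[zero_radius](\<lambda>_. 1)" if "j \<in> {1..k}" for i j
    using assms(2)[OF that] assms(3) by (intro real_bigo_punctured smooth_on_higher_deriv_real) auto
  have "(\<lambda>z. (deriv ^^ i) (\<Lambda> j) (fst z) / fact i * fps_nth (W z ^ i) (k - j)) \<in> O[zero_radius](fst)"
    if "j \<in> {1..k}" "i \<in> {1..k-j}" for i j
  proof -
    have "(\<lambda>z. (deriv ^^ i) (\<Lambda> j) (fst z) / fact i * fps_nth (W z ^ i) (k - j)) \<in> O[zero_radius](\<lambda>z. 1 * fst z)"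
      using that D[OF that(1), of i] by (intro landau_o.big.mult W) auto
    then show ?thesis by simp
  qed
  then have "(\<lambda>z. \<Sum>j=1..k. \<Sum>i=1..k-j. (deriv ^^ i) (\<Lambda> j) (fst z) / fact i * fps_nth (W z ^ i) (k - j))
     \<in> O[zero_radius](fst)"
    by (intro big_sum_in_bigo)
  then show ?thesis by (simp add: taylor_coeff_expand W_def case_prod_unfold)
qed

lemma higher_deriv_zero:
  fixes h :: "real \<Rightarrow> real"
  assumes "\<And>r. \<bar>r\<bar> < R \<Longrightarrow> h r = 0" "\<bar>r\<bar> < R"
  shows "(deriv ^^ i) h r = 0"
  using assms(2)
proof (induction i arbitrary: r)
  case 0
  then show ?case using assms(1) by simp
next
  case (Suc i)
  have "eventually (\<lambda>x. x \<in> {-R<..<R}) (nhds r)"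
    using Suc.prems by (intro eventually_nhds_in_open) auto
  then have "eventually (\<lambda>x. (deriv ^^ i) h x = (\<lambda>_. 0) x) (nhds r)"
    by (rule eventually_mono) (simp add: Suc.IH abs_less_iff)
  then show ?case by (simp add: deriv_cong_ev)
qed

text \<open>A term of index \<open>j\<close> with a positive power of the series \<open>v\<close>, which starts in degree one, has degree at least \<open>j + 1\<close>. If the functions below index \<open>n\<close> vanish, nothing is left in degrees up to \<open>n\<close>.\<close>
lemma taylor_coeff_zero:
  assumes "\<And>j r. 1 \<le> j \<Longrightarrow> j < n \<Longrightarrow> \<bar>r\<bar> < R \<Longrightarrow> \<Lambda> j r = 0" "k \<le> n" "\<bar>r\<bar> < R"
  shows "taylor_coeff \<Lambda> v k r \<phi> S = 0"
proof -
  have "(deriv ^^ i) (\<Lambda> j) r = 0" if "j \<in> {1..k}" "i \<in> {1..k-j}" for i j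
    using that assms(2) by (intro higher_deriv_zero[OF assms(1) assms(3)]) auto
  then show ?thesis by (simp add: taylor_coeff_expand)
qed

section \<open>Means and irrational flows on the torus\<close>

text \<open>The flow returns to the circle of a fixed first angle after shifting the second angle by an irrational multiple of the period. By density of the fractional parts, \<open>h\<close> is constant on this circle, and the flow carries the value to all other circles.\<close>
lemma irrational_flow_invariant_constant:
  fixes h :: "real \<Rightarrow> real \<Rightarrow> real"
  assumes per: "periodic2 h" and cont: "continuous_on UNIV (\<lambda>(x, y). h x y)"
    and inv: "\<And>x y \<tau>. h (x + a * \<tau>) (y + b * \<tau>) = h x y"
    and nonres: "\<And>k1 k2 :: int. \<bar>k1\<bar> + \<bar>k2\<bar> \<noteq> 0 \<Longrightarrow> of_int k1 * a + of_int k2 * b \<noteq> 0"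
  shows "h x y = h 0 0"
proof -
  have a: "a \<noteq> 0" using nonres[of 1 0] by simp
  have p1: "h (x + of_int m * (2 * pi)) y = h x y" for x y m
    by (rule periodic_shift_int[where h = "\<lambda>x. h x y"]) (use per in \<open>auto simp: periodic2_def\<close>)
  have p2: "h x (y + of_int m * (2 * pi)) = h x y" for x y m
    by (rule periodic_shift_int[where h = "\<lambda>y. h x y"]) (use per in \<open>auto simp: periodic2_def\<close>)
  have irr: "b / a \<notin> \<rat>"
  proof
    assume "b / a \<in> \<rat>"
    then obtain m n :: int where *: "n > 0" "b / a = of_int m / of_int n" by (rule Rats_cases')
    then have "of_int m * a + of_int (- n) * b = 0" using a by (simp add: field_simps)
    moreover have "\<bar>m\<bar> + \<bar>- n\<bar> \<noteq> 0" using *(1) by linarith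
    ultimately show False using nonres by blast
  qed
  \<comment> \<open>Following the flow for the time \<open>2 \<pi> k / a\<close> adds \<open>k\<close> periods to the first angle.\<close>
  have orbit: "h x (y + 2 * pi * (of_int k * (b / a) - of_int m)) = h x y" for x y k m
  proof -
    have "h x (y + 2 * pi * (of_int k * (b / a) - of_int m)) = h x ((y + 2 * pi * (of_int k * (b / a))) + of_int (- m) * (2 * pi))"
      by (simp add: algebra_simps)
    also have "\<dots> = h (x + of_int k * (2 * pi)) (y + 2 * pi * (of_int k * (b / a)))" by (simp only: p1 p2)
    also have "\<dots> = h (x + a * (of_int k * (2 * pi) / a)) (y + b * (of_int k * (2 * pi) / a))"
      using a by (simp add: algebra_simps)
    finally show ?thesis by (simp only: inv)
  qed
  have vert: "h x y = h x 0" for x y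
  proof (rule ccontr)
    assume ne: "h x y \<noteq> h x 0"
    define e where "e = \<bar>h x y - h x 0\<bar>"
    have "e > 0" using ne by (simp add: e_def)
    have "continuous_on UNIV (\<lambda>y. (\<lambda>(x, y). h x y) (x, y))"
      by (rule continuous_on_compose2[OF cont]) (auto intro!: continuous_intros)
    then have "isCont (\<lambda>y. h x y) y" by (simp add: continuous_on_eq_continuous_at)
    then obtain d where d: "d > 0" "\<And>z. dist z y < d \<Longrightarrow> dist (h x z) (h x y) < e"
      using \<open>e > 0\<close> unfolding continuous_at_eps_delta by metis
    have "d / (2 * pi) > 0" using d(1) by simp
    then obtain m k :: int
      where km: "\<bar>of_int k * (b / a) - of_int m - y / (2 * pi)\<bar> < d / (2 * pi)"
      by (rule sequence_of_fractional_parts_is_dense[OF irr, where \<alpha> = "y / (2 * pi)"]) (rule that)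
    define z where "z = 2 * pi * (of_int k * (b / a) - of_int m)"
    have "z - y = 2 * pi * (of_int k * (b / a) - of_int m - y / (2 * pi))" by (simp add: z_def algebra_simps)
    then have "\<bar>z - y\<bar> = 2 * pi * \<bar>of_int k * (b / a) - of_int m - y / (2 * pi)\<bar>" by (simp add: abs_mult)
    also have "\<dots> < d" using km by (simp add: field_simps)
    finally have "dist (h x z) (h x y) < e" using d(2) by (simp add: dist_real_def)
    moreover have "h x z = h x 0" using orbit[of x 0 k m] by (simp add: z_def)
    ultimately show False by (simp add: e_def dist_real_def abs_minus_commute)
  qed
  have "h x y = h x (b * (x / a))" using vert by metis
  also have "\<dots> = h (0 + a * (x / a)) (0 + b * (x / a))" using a by simp
  also have "\<dots> = h 0 0" by (rule inv)
  finally show ?thesis .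
qed

lemma mean2_const: "mean2 (\<lambda>_ _. c) = c"
  by (simp add: mean2_def power2_eq_square)

lemma mean2_integrable:
  fixes Z :: "real \<Rightarrow> real \<Rightarrow> real"
  assumes "continuous_on UNIV (\<lambda>(x, y). Z x y)"
  shows "(\<lambda>\<phi>. Z \<phi> S) integrable_on {0..2 * pi}"
    and "(\<lambda>S. integral {0..2 * pi} (\<lambda>\<phi>. Z \<phi> S)) integrable_on {0..2 * pi}"
proof -
  have "continuous_on {0..2 * pi} (\<lambda>\<phi>. (\<lambda>(x, y). Z x y) (\<phi>, S))"
    by (rule continuous_on_compose2[OF assms]) (auto intro!: continuous_intros)
  then show "(\<lambda>\<phi>. Z \<phi> S) integrable_on {0..2 * pi}" by (simp add: integrable_continuous_real)
  have "continuous_on (UNIV \<times> cbox 0 (2 * pi)) (\<lambda>z. (\<lambda>(x, y). Z x y) (snd z, fst z))"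
    by (rule continuous_on_compose2[OF assms]) (auto intro!: continuous_intros)
  then have "continuous_on (UNIV \<times> cbox 0 (2 * pi)) (\<lambda>(S, \<phi>). Z \<phi> S)" by (simp add: case_prod_unfold)
  then have "continuous_on UNIV (\<lambda>S. integral (cbox 0 (2 * pi)) (\<lambda>\<phi>. Z \<phi> S))"
    by (rule integral_continuous_on_param)
  then have "continuous_on {0..2 * pi} (\<lambda>S. integral {0..2 * pi} (\<lambda>\<phi>. Z \<phi> S))"
    using continuous_on_subset by force
  then show "(\<lambda>S. integral {0..2 * pi} (\<lambda>\<phi>. Z \<phi> S)) integrable_on {0..2 * pi}"
    by (rule integrable_continuous_real)
qed

lemma mean2_linear:
  fixes X Y :: "real \<Rightarrow> real \<Rightarrow> real"
  assumes "continuous_on UNIV (\<lambda>(x, y). X x y)" "continuous_on UNIV (\<lambda>(x, y). Y x y)"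
  shows "mean2 (\<lambda>\<phi> S. a * X \<phi> S + b * Y \<phi> S) = a * mean2 X + b * mean2 Y"
proof -
  have "integral {0..2 * pi} (\<lambda>\<phi>. a * X \<phi> S + b * Y \<phi> S)
      = a * integral {0..2 * pi} (\<lambda>\<phi>. X \<phi> S) + b * integral {0..2 * pi} (\<lambda>\<phi>. Y \<phi> S)" for S
    using mean2_integrable(1)[OF assms(1)] mean2_integrable(1)[OF assms(2)] by (simp add: integral_add integrable_on_mult_right)
  then show ?thesis
    using mean2_integrable(2)[OF assms(1)] mean2_integrable(2)[OF assms(2)]
    by (simp add: mean2_def integral_add integrable_on_mult_right algebra_simps)
qed

lemma integral_derivative_periodic:
  fixes h :: "real \<Rightarrow> real"
  assumes "\<And>x. (h has_real_derivative h' x) (at x)" "h (2 * pi) = h 0"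
  shows "integral {0..2 * pi} h' = 0"
proof -
  have "(h' has_integral (h (2 * pi) - h 0)) {0..2 * pi}"
    by (rule fundamental_theorem_of_calculus)
       (auto intro!: has_field_derivative_at_within[OF assms(1)]
             simp flip: has_real_derivative_iff_has_vector_derivative)
  then show ?thesis using assms(2) by (simp add: integral_unique)
qed

text \<open>Each partial derivative integrates to zero over a period of its own variable; for the second variable the order of integration has to be exchanged first.\<close>
lemma mean2_directional_derivative:
  fixes h h1 h2 :: "real \<Rightarrow> real \<Rightarrow> real"
  assumes "periodic2 h"
    and "\<And>x y. ((\<lambda>x. h x y) has_real_derivative h1 x y) (at x)"
    and "\<And>x y. ((\<lambda>y. h x y) has_real_derivative h2 x y) (at y)"
    and "continuous_on UNIV (\<lambda>(x, y). h1 x y)" "continuous_on UNIV (\<lambda>(x, y). h2 x y)"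
  shows "mean2 (\<lambda>x y. a * h1 x y + b * h2 x y) = 0"
proof -
  have p: "h (2 * pi) y = h 0 y" "h x (2 * pi) = h x 0" for x y
    using assms(1) unfolding periodic2_def by (metis add_0)+
  have 1: "integral {0..2 * pi} (\<lambda>x. h1 x y) = 0" for y
    by (rule integral_derivative_periodic[OF assms(2)]) (rule p)
  have 2: "integral {0..2 * pi} (\<lambda>y. h2 x y) = 0" for x
    by (rule integral_derivative_periodic[OF assms(3)]) (rule p)
  have "integral (cbox 0 (2 * pi)) (\<lambda>y. integral (cbox 0 (2 * pi)) (\<lambda>x. h2 x y))
      = integral (cbox 0 (2 * pi)) (\<lambda>x. integral (cbox 0 (2 * pi)) (\<lambda>y. h2 x y))"
    by (rule integral_swap_continuous[symmetric])
       (rule continuous_on_subset[OF assms(5)], simp)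
  then have "mean2 h2 = 0" using 2 by (simp add: mean2_def)
  moreover have "mean2 h1 = 0" using 1 by (simp add: mean2_def)
  ultimately show ?thesis using mean2_linear[OF assms(4,5)] by simp
qed

section \<open>The averaging recursion at radius zero\<close>

lemma tendsto_zero_slice:
  fixes H :: "real \<Rightarrow> real \<Rightarrow> real \<Rightarrow> real"
  assumes "smooth_on (cylinder R) (\<lambda>(r, \<phi>, S). H r \<phi> S)" "R > 0"
  shows "((\<lambda>r. H r \<phi> S) \<longlongrightarrow> H 0 \<phi> S) (at 0)"
proof -
  have "isCont (\<lambda>r. H r \<phi> S) 0"
    by (rule DERIV_isCont[OF cylinder_total_derivative(5)[OF assms(1)]]) (use assms(2) in simp)
  then show ?thesis by (simp add: isCont_def)
qed

lemma slice_continuous_on: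
  fixes H :: "real \<Rightarrow> real \<Rightarrow> real \<Rightarrow> real"
  assumes "smooth_on (cylinder R) (\<lambda>(r, \<phi>, S). H r \<phi> S)" "\<bar>r\<bar> < R"
  shows "continuous_on UNIV (\<lambda>(\<phi>, S). H r \<phi> S)"
proof -
  have "continuous_on UNIV (\<lambda>z. (\<lambda>(r, \<phi>, S). H r \<phi> S) (r, fst z, snd z))"
    by (rule continuous_on_compose2[OF smooth_on_imp_continuous_on[OF assms(1)]])
       (use assms(2) in \<open>auto intro!: continuous_intros\<close>)
  then show ?thesis by (simp add: case_prod_unfold)
qed

lemma bigo_punctured_slice:
  fixes F :: "real \<times> real \<times> real \<Rightarrow> real"
  assumes "F \<in> O[zero_radius](fst)"
  shows "((\<lambda>r. F (r, \<phi>, S)) \<longlongrightarrow> 0) (at 0)"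
proof -
  have "filterlim (\<lambda>r. (r, \<phi>, S)) zero_radius (at 0)"
    unfolding zero_radius_def filterlim_filtercomap_iff by (simp add: o_def filterlim_ident)
  from landau_o.big.compose[OF assms this] have "(\<lambda>r. F (r, \<phi>, S)) \<in> O[at 0](\<lambda>r. r)" by simp
  also have "(\<lambda>r. r) \<in> o[at 0](\<lambda>_. 1 :: real)" by (rule smalloI_tendsto) auto
  finally show ?thesis by (auto dest: smalloD_tendsto)
qed

lemma fourier_coeff_zero_eq_mean2:
  assumes "continuous_on UNIV (\<lambda>(x, y). Z x y)"
  shows "fourier_coeff Z 0 0 = complex_of_real (mean2 Z)"
proof -
  have inner: "(\<lambda>\<phi>. Z \<phi> S) integrable_on {0..2 * pi}"
    and outer: "(\<lambda>S. integral {0..2 * pi} (\<lambda>\<phi>. Z \<phi> S)) integrable_on {0..2 * pi}" for S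
    using mean2_integrable[OF assms] by auto
  have real: "integral A (\<lambda>x. complex_of_real (f x)) = complex_of_real (integral A f)" if "f integrable_on A" for A :: "real set" and f
    using integral_linear[OF that bounded_linear_of_real] by (simp add: o_def)
  show ?thesis
    using real[OF inner] real[OF outer] by (simp add: fourier_coeff_def mean2_def)
qed

context averaging
begin

lemma rs_pos: "rs > 0" using rs_range by simp

lemma v_smooth_cylinder: "k \<in> {1..N} \<Longrightarrow> smooth_on (cylinder rs) (\<lambda>(r, \<phi>, S). v k r \<phi> S)"
  by (rule smooth_on_subset[OF v_smooth]) (auto simp: cylinder_def)

lemma fk_smooth_cylinder: "k \<ge> 1 \<Longrightarrow> smooth_on (cylinder rs) (\<lambda>(r, \<phi>, S). fk k r \<phi> S)"
  by (rule smooth_on_subset[OF fk_smooth]) (use rs_range in \<open>auto simp: cylinder_def\<close>)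

lemma gk_smooth_cylinder: "k \<ge> 1 \<Longrightarrow> smooth_on (cylinder rs) (\<lambda>(r, \<phi>, S). gk k r \<phi> S)"
  by (rule smooth_on_subset[OF gk_smooth]) (use rs_range in \<open>auto simp: cylinder_def\<close>)

lemma Lambda_smooth_open: "k \<in> {1..N} \<Longrightarrow> smooth_on {-rs<..<rs} (\<Lambda> k)"
  by (rule smooth_on_subset[OF Lambda_smooth]) auto

text \<open>The pointwise bound by \<open>r\<close> says that both coefficients tend to \<open>0\<close>, and they are continuous.\<close>
lemma coefficients_vanish_at_zero:
  assumes "1 \<le> k" "k < p"
  shows "fk k 0 \<phi> S = 0" "gk k 0 \<phi> S = 0"
proof -
  have "((\<lambda>r. \<bar>fk k r \<phi> S\<bar> + \<bar>gk k r \<phi> S\<bar>) \<longlongrightarrow> \<bar>fk k 0 \<phi> S\<bar> + \<bar>gk k 0 \<phi> S\<bar>) (at 0)"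
    using assms(1) by (intro tendsto_intros tendsto_zero_slice[OF fk_smooth_cylinder rs_pos]
       tendsto_zero_slice[OF gk_smooth_cylinder rs_pos])
  moreover have "((\<lambda>r. \<bar>fk k r \<phi> S\<bar> + \<bar>gk k r \<phi> S\<bar>) \<longlongrightarrow> 0) (at 0)"
  proof -
    have "(\<lambda>r. \<bar>fk k r \<phi> S\<bar> + \<bar>gk k r \<phi> S\<bar>) \<in> O[at 0](\<lambda>r. r)"
      by (rule small_below_p[OF assms])
    also have "(\<lambda>r. r) \<in> o[at 0](\<lambda>_. 1 :: real)" by (rule smalloI_tendsto) auto
    finally show ?thesis by (auto dest: smalloD_tendsto)
  qed
  ultimately have "\<bar>fk k 0 \<phi> S\<bar> + \<bar>gk k 0 \<phi> S\<bar> = 0" using tendsto_unique[OF at_neq_bot] by blast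
  then show "fk k 0 \<phi> S = 0" "gk k 0 \<phi> S = 0" by linarith+
qed

lemma fk_bigo:
  assumes "1 \<le> k" "k < p"
  shows "(\<lambda>(r, \<phi>, S). fk k r \<phi> S) \<in> O[zero_radius](fst)"
proof -
  have "(\<lambda>(r, \<phi>, S). fk k r \<phi> S - fk k 0 \<phi> S) \<in> O[zero_radius](fst)"
    by (rule periodic_bigo(1)[OF fk_smooth_cylinder fk_periodic rs_pos]) (use assms rs_range in auto)
  then show ?thesis using coefficients_vanish_at_zero(1)[OF assms] by simp
qed

lemma gk_bigo:
  assumes "1 \<le> k" "k < p"
  shows "(\<lambda>(r, \<phi>, S). gk k r \<phi> S) \<in> O[zero_radius](fst)"
proof -
  have "(\<lambda>(r, \<phi>, S). gk k r \<phi> S - gk k 0 \<phi> S) \<in> O[zero_radius](fst)"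
    by (rule periodic_bigo(1)[OF gk_smooth_cylinder gk_periodic rs_pos]) (use assms rs_range in auto)
  then show ?thesis using coefficients_vanish_at_zero(2)[OF assms] by simp
qed

lemma gk_over_r_bigo:
  assumes "1 \<le> k" "k < p"
  shows "(\<lambda>(r, \<phi>, S). inverse r * gk k r \<phi> S) \<in> O[zero_radius](\<lambda>_. 1)"
proof -
  have "(\<lambda>z. inverse (fst z) * (\<lambda>(r, \<phi>, S). gk k r \<phi> S) z) \<in> O[zero_radius](\<lambda>z. inverse (fst z) * fst z)"
    by (intro landau_o.big.mult gk_bigo assms) simp
  also have "(\<lambda>z. inverse (fst z) * fst z) \<in> O[zero_radius](\<lambda>_. 1 :: real)"
    by (rule bigoI[of _ 1], rule eventually_mono[OF eventually_zero_radius[of 1]]) auto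
  finally show ?thesis by (simp add: case_prod_unfold)
qed

lemma v_periodic_open: "k \<in> {1..N} \<Longrightarrow> \<bar>r\<bar> < rs \<Longrightarrow> periodic2 (v k r)"
  using v_periodic by simp

lemma v_bigo_1:
  assumes "k \<in> {1..N}"
  shows "(\<lambda>(r, \<phi>, S). v k r \<phi> S) \<in> O[zero_radius](\<lambda>_. 1)"
    and "(\<lambda>(r, \<phi>, S). deriv (\<lambda>x. v k x \<phi> S) r) \<in> O[zero_radius](\<lambda>_. 1)"
    and "(\<lambda>(r, \<phi>, S). deriv (\<lambda>x. v k r x S) \<phi>) \<in> O[zero_radius](\<lambda>_. 1)"
    and "(\<lambda>(r, \<phi>, S). deriv (\<lambda>x. v k r \<phi> x) S) \<in> O[zero_radius](\<lambda>_. 1)"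
proof -
  note s = v_smooth_cylinder[OF assms] and per = v_periodic_open[OF assms]
  note d = cylinder_smooth_partials[OF s] and pd = periodic2_deriv[of rs "v k", OF per]
  show "(\<lambda>(r, \<phi>, S). v k r \<phi> S) \<in> O[zero_radius](\<lambda>_. 1)"
    by (rule periodic_bigo(2)[OF s per rs_pos])
  show "(\<lambda>(r, \<phi>, S). deriv (\<lambda>x. v k x \<phi> S) r) \<in> O[zero_radius](\<lambda>_. 1)"
    by (rule periodic_bigo(2)[OF d(1) pd(1) rs_pos])
  show "(\<lambda>(r, \<phi>, S). deriv (\<lambda>x. v k r x S) \<phi>) \<in> O[zero_radius](\<lambda>_. 1)"
    by (rule periodic_bigo(2)[OF d(2) pd(2) rs_pos])
  show "(\<lambda>(r, \<phi>, S). deriv (\<lambda>x. v k r \<phi> x) S) \<in> O[zero_radius](\<lambda>_. 1)"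
    by (rule periodic_bigo(2)[OF d(3) pd(3) rs_pos])
qed

text \<open>If \<open>v k\<close> vanishes identically on the circle \<open>r = 0\<close>, so do its derivatives along the angles. The derivative in \<open>r\<close> is only bounded.\<close>
lemma v_bigo_r:
  assumes "k \<in> {1..N}" "\<And>\<phi> S. v k 0 \<phi> S = 0"
  shows "(\<lambda>(r, \<phi>, S). v k r \<phi> S) \<in> O[zero_radius](fst)"
    and "(\<lambda>(r, \<phi>, S). deriv (\<lambda>x. v k r x S) \<phi>) \<in> O[zero_radius](fst)"
    and "(\<lambda>(r, \<phi>, S). deriv (\<lambda>x. v k r \<phi> x) S) \<in> O[zero_radius](fst)"
proof -
  note s = v_smooth_cylinder[OF assms(1)] and per = v_periodic_open[OF assms(1)]
  note d = cylinder_smooth_partials[OF s] and pd = periodic2_deriv[of rs "v k", OF per]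
  have "(\<lambda>(r, \<phi>, S). v k r \<phi> S - v k 0 \<phi> S) \<in> O[zero_radius](fst)"
    by (rule periodic_bigo(1)[OF s per rs_pos])
  then show "(\<lambda>(r, \<phi>, S). v k r \<phi> S) \<in> O[zero_radius](fst)" by (simp add: assms(2))
  have "(\<lambda>(r, \<phi>, S). deriv (\<lambda>x. v k r x S) \<phi> - deriv (\<lambda>x. v k 0 x S) \<phi>) \<in> O[zero_radius](fst)"
    by (rule periodic_bigo(1)[OF d(2) pd(2) rs_pos])
  then show "(\<lambda>(r, \<phi>, S). deriv (\<lambda>x. v k r x S) \<phi>) \<in> O[zero_radius](fst)" by (simp add: assms(2))
  have "(\<lambda>(r, \<phi>, S). deriv (\<lambda>x. v k r \<phi> x) S - deriv (\<lambda>x. v k 0 \<phi> x) S) \<in> O[zero_radius](fst)"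
    by (rule periodic_bigo(1)[OF d(3) pd(3) rs_pos])
  then show "(\<lambda>(r, \<phi>, S). deriv (\<lambda>x. v k r \<phi> x) S) \<in> O[zero_radius](fst)" by (simp add: assms(2))
qed

lemma taylor_bigo:
  assumes "k \<in> {1..N}" "\<And>i \<phi> S. 1 \<le> i \<Longrightarrow> i < k \<Longrightarrow> v i 0 \<phi> S = 0"
  shows "(\<lambda>(r, \<phi>, S). taylor_coeff \<Lambda> v k r \<phi> S) \<in> O[zero_radius](fst)"
proof (rule taylor_coeff_bigo[OF _ _ rs_pos])
  fix i assume "i < k"
  show "(\<lambda>(r, \<phi>, S). v i r \<phi> S) \<in> O[zero_radius](fst)"
  proof (cases "i = 0")
    case True
    then show ?thesis by (simp add: v_convention case_prod_unfold)
  next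
    case False
    then show ?thesis using \<open>i < k\<close> assms by (intro v_bigo_r) auto
  qed
next
  fix j assume "j \<in> {1..k}"
  then show "smooth_on {-rs<..<rs} (\<Lambda> j)" using assms(1) by (intro Lambda_smooth_open) auto
qed

text \<open>Each summand has a factor of index below \<open>p\<close> that vanishes at \<open>r = 0\<close>: the Taylor terms and the terms without \<open>\<partial>\<^sub>r\<close> contain some \<open>v\<close> or an angular derivative of it, and \<open>f\<^sub>i \<partial>\<^sub>r v\<close> contains \<open>f\<^sub>i\<close>. The pole of \<open>1/r\<close> is cancelled by \<open>g\<^sub>i\<close>.\<close>
lemma averaging_R_bigo:
  assumes "1 \<le> k" "k \<le> p" "\<And>i \<phi> S. 1 \<le> i \<Longrightarrow> i < k \<Longrightarrow> v i 0 \<phi> S = 0"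
  shows "(\<lambda>(r, \<phi>, S). averaging_R q fk gk s \<Lambda> v k r \<phi> S) \<in> O[zero_radius](fst)"
proof -
  have kN: "k \<in> {1..N}" using assms N_range by auto
  define A where "A z = (case z of (r, \<phi>, S) \<Rightarrow> taylor_coeff \<Lambda> v k r \<phi> S)" for z
  define B where "B z = (if k > q then (1 - real k / real q) * (case z of (r, \<phi>, S) \<Rightarrow> v (k - q) r \<phi> S) else 0)" for z
  define C1 where "C1 i z = (case z of (r, \<phi>, S) \<Rightarrow> fk i r \<phi> S) * (case z of (r, \<phi>, S) \<Rightarrow> deriv (\<lambda>x. v (k - i) x \<phi> S) r)" for i z
  define C2 where "C2 i z = (case z of (r, \<phi>, S) \<Rightarrow> inverse r * gk i r \<phi> S) * (case z of (r, \<phi>, S) \<Rightarrow> deriv (\<lambda>x. v (k - i) r x S) \<phi>)" for i z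
  define C3 where "C3 i z = sigma q s i * (case z of (r, \<phi>, S) \<Rightarrow> deriv (\<lambda>x. v (k - i) r \<phi> x) S)" for i z
  have A: "A \<in> O[zero_radius](fst)"
    unfolding A_def[abs_def] by (rule taylor_bigo[OF kN assms(3)])
  have B: "B \<in> O[zero_radius](fst)"
  proof (cases "k > q")
    case True
    then have "(\<lambda>(r, \<phi>, S). v (k - q) r \<phi> S) \<in> O[zero_radius](fst)"
      using kN q_pos assms(3) by (intro v_bigo_r) auto
    then show ?thesis unfolding B_def[abs_def] using True by simp
  qed (simp add: B_def[abs_def])
  have C: "C1 i \<in> O[zero_radius](fst)" "C2 i \<in> O[zero_radius](fst)" "C3 i \<in> O[zero_radius](fst)"
    if i: "i \<in> {1..<k}" for i
  proof -
    have ki: "k - i \<in> {1..N}" and ip: "1 \<le> i" "i < p" using kN i assms(2) by auto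
    have v0: "v (k - i) 0 \<phi> S = 0" for \<phi> S using assms(3)[of "k - i"] i by auto
    have "C1 i \<in> O[zero_radius](\<lambda>z. fst z * 1)"
      unfolding C1_def[abs_def] by (intro landau_o.big.mult fk_bigo v_bigo_1 ki ip)
    then show "C1 i \<in> O[zero_radius](fst)" by simp
    have "C2 i \<in> O[zero_radius](\<lambda>z. 1 * fst z)"
      unfolding C2_def[abs_def] by (intro landau_o.big.mult gk_over_r_bigo v_bigo_r ki ip v0)
    then show "C2 i \<in> O[zero_radius](fst)" by simp
    show "C3 i \<in> O[zero_radius](fst)"
      unfolding C3_def[abs_def] using v_bigo_r(3)[OF ki v0] by simp
  qed
  have "(\<lambda>z. A z - B z - (\<Sum>i=1..<k. C1 i z + C2 i z + C3 i z)) \<in> O[zero_radius](fst)"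
    by (intro sum_in_bigo big_sum_in_bigo A B C)
  moreover have "(\<lambda>(r, \<phi>, S). averaging_R q fk gk s \<Lambda> v k r \<phi> S) = (\<lambda>z. A z - B z - (\<Sum>i=1..<k. C1 i z + C2 i z + C3 i z))"
    by (rule ext) (simp add: A_def B_def C1_def C2_def C3_def averaging_R_def split: prod.split)
  ultimately show ?thesis by simp
qed

text \<open>The recursion is stated for \<open>r \<noteq> 0\<close>; this is its limit, in which the term \<open>R\<^sub>k\<close> disappears.\<close>
lemma homological_equation_at_zero:
  assumes "1 \<le> k" "k \<le> p" "\<And>i \<phi> S. 1 \<le> i \<Longrightarrow> i < k \<Longrightarrow> v i 0 \<phi> S = 0"
  shows "\<omega> 0 * deriv (\<lambda>x. v k 0 x S) \<phi> + s 0 * deriv (\<lambda>x. v k 0 \<phi> x) S = \<Lambda> k 0 - fk k 0 \<phi> S"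
proof -
  have kN: "k \<in> {1..N}" using assms N_range by auto
  note d = cylinder_smooth_partials[OF v_smooth_cylinder[OF kN]]
  have om: "(\<omega> \<longlongrightarrow> \<omega> 0) (at 0)"
  proof -
    have "continuous_on {-r0<..<r0} \<omega>"
      by (rule continuous_on_subset[OF smooth_on_imp_continuous_on[OF omega_smooth]]) auto
    then show ?thesis using r0_pos by (simp add: continuous_on_eq_continuous_at isCont_def)
  qed
  have lam: "(\<Lambda> k \<longlongrightarrow> \<Lambda> k 0) (at 0)"
    using smooth_on_imp_continuous_on[OF Lambda_smooth_open[OF kN]] rs_pos
    by (simp add: continuous_on_eq_continuous_at isCont_def)
  have R: "((\<lambda>r. averaging_R q fk gk s \<Lambda> v k r \<phi> S) \<longlongrightarrow> 0) (at 0)"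
    using bigo_punctured_slice[OF averaging_R_bigo[OF assms], of \<phi> S] by simp
  have "((\<lambda>r. \<omega> r * deriv (\<lambda>x. v k r x S) \<phi> + s 0 * deriv (\<lambda>x. v k r \<phi> x) S) \<longlongrightarrow>
       \<omega> 0 * deriv (\<lambda>x. v k 0 x S) \<phi> + s 0 * deriv (\<lambda>x. v k 0 \<phi> x) S) (at 0)"
    by (intro tendsto_intros om tendsto_zero_slice[OF d(2) rs_pos] tendsto_zero_slice[OF d(3) rs_pos])
  moreover have "eventually (\<lambda>r. \<omega> r * deriv (\<lambda>x. v k r x S) \<phi> + s 0 * deriv (\<lambda>x. v k r \<phi> x) S
      = \<Lambda> k r - fk k r \<phi> S + averaging_R q fk gk s \<Lambda> v k r \<phi> S) (at 0)"
    unfolding eventually_at by (rule exI[of _ rs]) (auto simp: rs_pos v_equation[OF kN] homological_rhs_def)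
  ultimately have "((\<lambda>r. \<Lambda> k r - fk k r \<phi> S + averaging_R q fk gk s \<Lambda> v k r \<phi> S) \<longlongrightarrow>
       \<omega> 0 * deriv (\<lambda>x. v k 0 x S) \<phi> + s 0 * deriv (\<lambda>x. v k 0 \<phi> x) S) (at 0)"
    by (rule Lim_transform_eventually)
  moreover have "((\<lambda>r. \<Lambda> k r - fk k r \<phi> S + averaging_R q fk gk s \<Lambda> v k r \<phi> S) \<longlongrightarrow>
       \<Lambda> k 0 - fk k 0 \<phi> S + 0) (at 0)"
    using assms(1) by (intro tendsto_intros lam R tendsto_zero_slice[OF fk_smooth_cylinder rs_pos])
  ultimately show ?thesis using tendsto_unique[OF at_neq_bot] by fastforce
qed

text \<open>The left-hand side of the limit equation is a derivative along a constant vector field on the torus and has mean zero.\<close>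
lemma Lambda_at_zero:
  assumes "1 \<le> k" "k \<le> p" "\<And>i \<phi> S. 1 \<le> i \<Longrightarrow> i < k \<Longrightarrow> v i 0 \<phi> S = 0"
  shows "\<Lambda> k 0 = mean2 (fk k 0)"
proof -
  have kN: "k \<in> {1..N}" using assms N_range by auto
  note s = v_smooth_cylinder[OF kN]
  note d = cylinder_smooth_partials[OF s]
  have z: "\<bar>0\<bar> < rs" using rs_pos by simp
  have "mean2 (\<lambda>\<phi> S. \<omega> 0 * deriv (\<lambda>x. v k 0 x S) \<phi> + s 0 * deriv (\<lambda>x. v k 0 \<phi> x) S) = 0"
    by (rule mean2_directional_derivative[where h = "v k 0"])
       (intro v_periodic_open kN z cylinder_total_derivative(6,7)[OF s] slice_continuous_on[OF d(2)] slice_continuous_on[OF d(3)])+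
  moreover have "mean2 (\<lambda>\<phi> S. 1 * (\<lambda>_ _. \<Lambda> k 0) \<phi> S + (- 1) * fk k 0 \<phi> S) = 1 * mean2 (\<lambda>_ _. \<Lambda> k 0) + (- 1) * mean2 (fk k 0)"
    by (rule mean2_linear) (use slice_continuous_on[OF fk_smooth_cylinder[OF assms(1)] z] in simp_all)
  ultimately show ?thesis by (simp add: homological_equation_at_zero[OF assms] mean2_const)
qed

text \<open>By induction. For \<open>k < p\<close> the limit equation has right-hand side zero, so \<open>v k\<close> is constant along the flow with frequencies \<open>\<omega> 0\<close> and \<open>s 0\<close>. Non-resonance makes it constant on the torus, and its mean is zero.\<close>
lemma v_vanishes_at_zero:
  assumes "1 \<le> k" "k < p"
  shows "v k 0 \<phi> S = 0"
  using assms
proof (induction k arbitrary: \<phi> S rule: less_induct)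
  case (less k)
  have kN: "k \<in> {1..N}" using less.prems N_range by auto
  have z: "\<bar>0\<bar> < rs" using rs_pos by simp
  have IH: "v i 0 \<phi> S = 0" if "1 \<le> i" "i < k" for i \<phi> S
    using less.IH[OF that(2,1)] less.prems that by simp
  have f0: "fk k 0 = (\<lambda>_ _. 0)"
    using coefficients_vanish_at_zero(1)[OF less.prems] by (intro ext)
  have lam: "\<Lambda> k 0 = 0"
    using Lambda_at_zero[OF less.prems(1) _ IH] less.prems by (simp add: f0 mean2_const)
  have dir: "deriv (\<lambda>x. v k 0 x S) \<phi> * \<omega> 0 + deriv (\<lambda>x. v k 0 \<phi> x) S * s 0 = 0" for \<phi> S
    using homological_equation_at_zero[OF less.prems(1) _ IH, of S \<phi>] less.prems
    by (simp add: f0 lam mult.commute)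
  note s = v_smooth_cylinder[OF kN]
  have inv: "v k 0 (x + \<omega> 0 * \<tau>) (y + s 0 * \<tau>) = v k 0 x y" for x y \<tau>
  proof -
    have "((\<lambda>\<tau>. v k 0 (x + \<omega> 0 * \<tau>) (y + s 0 * \<tau>)) has_real_derivative 0) (at \<tau>)" for \<tau>
    proof -
      have 1: "((\<lambda>\<tau>. (0, x + \<omega> 0 * \<tau>, y + s 0 * \<tau>)) has_derivative (\<lambda>h. (0, \<omega> 0 * h, s 0 * h))) (at \<tau>)"
        by (auto intro!: derivative_eq_intros)
      show ?thesis
        using has_derivative_compose[OF 1 cylinder_total_derivative(1)[OF s z]]
          dir[of "y + s 0 * \<tau>" "x + \<omega> 0 * \<tau>"]
        by (simp add: has_field_derivative_def mult.assoc[symmetric] distrib_right[symmetric] lambda_zero[symmetric])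
    qed
    then show ?thesis using DERIV_isconst_all[of "\<lambda>\<tau>. v k 0 (x + \<omega> 0 * \<tau>) (y + s 0 * \<tau>)" \<tau> 0] by simp
  qed
  have const: "v k 0 x y = v k 0 0 0" for x y
    by (rule irrational_flow_invariant_constant[OF v_periodic_open[OF kN z] slice_continuous_on[OF s z] inv nonresonance])
  then have "v k 0 = (\<lambda>_ _. v k 0 0 0)" by blast
  then have "mean2 (v k 0) = v k 0 0 0" using mean2_const by metis
  then show ?case using const v_zero_mean[OF kN, of 0] rs_pos by simp
qed

lemma Lambda_below_p_at_zero: "1 \<le> k \<Longrightarrow> k < p \<Longrightarrow> \<Lambda> k 0 = 0"
  using Lambda_at_zero[of k] v_vanishes_at_zero coefficients_vanish_at_zero(1)[of k]
  by (metis (no_types, lifting) ext less_imp_le mean2_const less_trans)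

lemma Lambda_p_at_zero:
  "complex_of_real (\<Lambda> p 0) = fourier_coeff (fk p 0) 0 0"
proof -
  have "\<Lambda> p 0 = mean2 (fk p 0)"
    by (rule Lambda_at_zero) (use p_pos v_vanishes_at_zero in auto)
  then show ?thesis
    using fourier_coeff_zero_eq_mean2[OF slice_continuous_on[OF fk_smooth_cylinder[OF p_pos]]] rs_pos by simp
qed

end

section \<open>Powers of the small parameter\<close>

text \<open>The expansions in powers of \<open>t\<close> become power series in this quantity.\<close>
definition small_parameter :: "nat \<Rightarrow> real \<Rightarrow> real" where
  "small_parameter q t = t powr (- (1 / real q))"

lemma small_parameter_power:
  assumes "t > 0"
  shows "small_parameter q t ^ k = t powr (- (real k / real q))"
proof -
  have "small_parameter q t ^ k = small_parameter q t powr real k"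
    using assms by (simp add: small_parameter_def powr_realpow)
  then show ?thesis by (simp add: small_parameter_def powr_powr)
qed

lemma small_parameter_pos: "t > 0 \<Longrightarrow> small_parameter q t > 0"
  by (simp add: small_parameter_def)

lemma small_parameter_tendsto:
  assumes "q \<ge> 1"
  shows "(small_parameter q \<longlongrightarrow> 0) at_top"
  unfolding small_parameter_def by (rule tendsto_neg_powr) (use assms in \<open>auto simp: filterlim_ident\<close>)

lemma phase_has_derivative:
  assumes "t > 0" "q \<ge> 1"
  shows "(phase q s has_real_derivative s 0 + (\<Sum>i=1..q. sigma q s i * small_parameter q t ^ i)) (at t)"
proof -
  have "{1..q} = insert q {1..<q}" using assms(2) by auto
  then have "(\<Sum>i=1..q. sigma q s i * small_parameter q t ^ i)
      = s q * inverse t + (\<Sum>i=1..<q. (1 - real i / real q) * s i * t powr (- (real i / real q)))"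
    using assms by (simp add: small_parameter_power sigma_def powr_minus)
  moreover have "((\<lambda>t. s 0 * t + (\<Sum>k=1..<q. s k * t powr (1 - real k / real q)) + s q * ln t) has_real_derivative
      s 0 + (\<Sum>i=1..<q. s i * ((1 - real i / real q) * t powr (1 - real i / real q - 1))) + s q * inverse t) (at t)"
    using assms(1) by (auto intro!: derivative_eq_intros sum.cong simp: divide_inverse)
  ultimately show ?thesis by (simp add: phase_def[abs_def] mult_ac add_ac)
qed

text \<open>The pairs \<open>(i, m - i)\<close> with \<open>i < m \<le> p\<close> are exactly the pairs of positive indices with sum at most \<open>p\<close>.\<close>
lemma cauchy_product_truncated:
  fixes c :: "nat \<Rightarrow> nat \<Rightarrow> real"
  shows "(\<Sum>m=1..p. \<Sum>i=1..<m. c i (m - i)) = (\<Sum>k=1..p. \<Sum>i=1..<p. if i + k \<le> p then c i k else 0)"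
proof -
  have "(\<Sum>m=1..p. \<Sum>i=1..<m. c i (m - i)) = (\<Sum>(m, i)\<in>Sigma {1..p} (\<lambda>m. {1..<m}). c i (m - i))"
    by (simp add: sum.Sigma)
  also have "\<dots> = (\<Sum>(k, i)\<in>{(k, i) \<in> {1..p} \<times> {1..<p}. i + k \<le> p}. c i k)"
    by (rule sum.reindex_bij_witness[of _ "\<lambda>(k, i). (k + i, i)" "\<lambda>(m, i). (m - i, i)"]) auto
  also have "\<dots> = (\<Sum>(k, i)\<in>{1..p} \<times> {1..<p}. if i + k \<le> p then c i k else 0)"
    by (rule sum.mono_neutral_cong_left) (auto split: if_splits)
  also have "\<dots> = (\<Sum>k=1..p. \<Sum>i=1..<p. if i + k \<le> p then c i k else 0)"
    by (simp add: sum.cartesian_product)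
  finally show ?thesis .
qed

lemma power_bigo_power:
  fixes e :: "'a \<Rightarrow> real"
  assumes "e \<in> O[F](\<lambda>_. 1)" "i \<le> j"
  shows "(\<lambda>z. e z ^ j) \<in> O[F](\<lambda>z. e z ^ i)"
proof -
  have "(\<lambda>z. e z ^ i * e z ^ (j - i)) \<in> O[F](\<lambda>z. e z ^ i * 1 ^ (j - i))"
    by (intro landau_o.big.mult landau_o.big_power assms(1)) auto
  then show ?thesis using assms(2) by (simp add: power_add[symmetric])
qed

text \<open>The pairs of indices with sum above \<open>p\<close> contribute only to the error. The condition on the remainder of \<open>A\<close> is imposed on its product with \<open>e\<^sup>k b\<^sub>k\<close>, because for \<open>A = g/r\<close> the remainder is not small by itself: the factor \<open>1/r\<close> grows and has to be compensated by \<open>b\<^sub>k\<close>.\<close>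
lemma truncated_product_bigo:
  fixes e :: "'a \<Rightarrow> real" and a b :: "nat \<Rightarrow> 'a \<Rightarrow> real"
  assumes e: "e \<in> O[F](\<lambda>_. 1)"
    and a: "\<And>i. i \<in> {1..<p} \<Longrightarrow> a i \<in> O[F](\<lambda>_. 1)"
    and b: "\<And>k. k \<in> {1..p} \<Longrightarrow> b k \<in> O[F](\<lambda>_. 1)"
    and A: "\<And>k. k \<in> {1..p} \<Longrightarrow> (\<lambda>z. (A z - (\<Sum>i=1..<p. e z ^ i * a i z)) * (e z ^ k * b k z)) \<in> O[F](\<lambda>z. e z ^ (p + 1))"
  shows "(\<lambda>z. (\<Sum>k=1..p. e z ^ k * (b k z * A z)) - (\<Sum>k=1..p. e z ^ k * (\<Sum>i=1..<k. a i z * b (k - i) z)))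
     \<in> O[F](\<lambda>z. e z ^ (p + 1))"
proof -
  have high: "(\<lambda>z. if i + k \<le> p then 0 else e z ^ (i + k) * (a i z * b k z)) \<in> O[F](\<lambda>z. e z ^ (p + 1))"
    if "k \<in> {1..p}" "i \<in> {1..<p}" for i k
  proof (cases "i + k \<le> p")
    case False
    have "(\<lambda>z. e z ^ (i + k) * (a i z * b k z)) \<in> O[F](\<lambda>z. e z ^ (p + 1) * (1 * 1))"
      using False that by (intro landau_o.big.mult power_bigo_power e a b) auto
    then show ?thesis using False by simp
  qed simp
  have eq: "(\<Sum>k=1..p. e z ^ k * (b k z * A z)) - (\<Sum>k=1..p. e z ^ k * (\<Sum>i=1..<k. a i z * b (k - i) z))
     = (\<Sum>k=1..p. (A z - (\<Sum>i=1..<p. e z ^ i * a i z)) * (e z ^ k * b k z))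
       + (\<Sum>k=1..p. \<Sum>i=1..<p. if i + k \<le> p then 0 else e z ^ (i + k) * (a i z * b k z))" for z
  proof -
    define c where "c i k = e z ^ (i + k) * (a i z * b k z)" for i k
    have "(\<Sum>k=1..p. e z ^ k * (\<Sum>i=1..<k. a i z * b (k - i) z)) = (\<Sum>m=1..p. \<Sum>i=1..<m. c i (m - i))"
      by (intro sum.cong refl) (simp add: sum_distrib_left c_def)
    also have "\<dots> = (\<Sum>k=1..p. \<Sum>i=1..<p. if i + k \<le> p then c i k else 0)"
      by (rule cauchy_product_truncated)
    finally have 1: "(\<Sum>k=1..p. e z ^ k * (\<Sum>i=1..<k. a i z * b (k - i) z))
      = (\<Sum>k=1..p. \<Sum>i=1..<p. if i + k \<le> p then c i k else 0)" .
    have "(\<Sum>k=1..p. e z ^ k * (b k z * A z)) - (\<Sum>k=1..p. (A z - (\<Sum>i=1..<p. e z ^ i * a i z)) * (e z ^ k * b k z))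
      = (\<Sum>k=1..p. (\<Sum>i=1..<p. e z ^ i * a i z) * (e z ^ k * b k z))"
      unfolding sum_subtractf[symmetric] by (intro sum.cong refl) (simp add: algebra_simps)
    also have "\<dots> = (\<Sum>k=1..p. \<Sum>i=1..<p. c i k)"
      unfolding sum_distrib_right by (intro sum.cong refl) (simp add: c_def power_add mult_ac)
    also have "\<dots> = (\<Sum>k=1..p. \<Sum>i=1..<p. if i + k \<le> p then c i k else 0) + (\<Sum>k=1..p. \<Sum>i=1..<p. if i + k \<le> p then 0 else c i k)"
      unfolding sum.distrib[symmetric] by (intro sum.cong refl) auto
    finally show ?thesis using 1 unfolding c_def by linarith
  qed
  show ?thesis unfolding eq by (intro sum_in_bigo big_sum_in_bigo A high)
qed

text \<open>Differentiating \<open>e\<^sup>k\<close> in time gives \<open>- (k/q) e\<^bsup>k+q\<^esup>\<close>. Reindexing by \<open>k + q\<close> turns these terms into the summand \<open>(1 - k/q) v\<^bsub>k-q\<^esub>\<close> of the recursion, up to the indices above \<open>p\<close>.\<close>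
lemma shifted_sum_bigo:
  fixes e :: "'a \<Rightarrow> real" and b :: "nat \<Rightarrow> 'a \<Rightarrow> real"
  assumes e: "e \<in> O[F](\<lambda>_. 1)" and q: "q \<ge> 1"
    and b: "\<And>k. k \<in> {1..p} \<Longrightarrow> b k \<in> O[F](\<lambda>_. 1)"
  shows "(\<lambda>z. (\<Sum>k=1..p. e z ^ k * (if k > q then (1 - real k / real q) * b (k - q) z else 0))
            + (\<Sum>k=1..p. real k / real q * e z ^ (k + q) * b k z)) \<in> O[F](\<lambda>z. e z ^ (p + 1))"
proof -
  have eq: "(\<Sum>k=1..p. e z ^ k * (if k > q then (1 - real k / real q) * b (k - q) z else 0))
            + (\<Sum>k=1..p. real k / real q * e z ^ (k + q) * b k z)
         = (\<Sum>k=1..p. if k + q \<le> p then 0 else real k / real q * e z ^ (k + q) * b k z)" for z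
  proof -
    have "(\<Sum>k=1..p. e z ^ k * (if k > q then (1 - real k / real q) * b (k - q) z else 0))
        = (\<Sum>k\<in>{q<..p}. e z ^ k * ((1 - real k / real q) * b (k - q) z))"
      by (rule sum.mono_neutral_cong_right) auto
    also have "\<dots> = (\<Sum>k\<in>{k\<in>{1..p}. k + q \<le> p}. - (real k / real q * e z ^ (k + q) * b k z))"
      by (rule sum.reindex_bij_witness[of _ "\<lambda>k. k + q" "\<lambda>k. k - q"]) (use q in \<open>auto simp: of_nat_diff field_simps\<close>)
    also have "\<dots> = (\<Sum>k=1..p. if k + q \<le> p then - (real k / real q * e z ^ (k + q) * b k z) else 0)"
      by (rule sum.mono_neutral_cong_left) auto
    finally have 1: "(\<Sum>k=1..p. e z ^ k * (if k > q then (1 - real k / real q) * b (k - q) z else 0))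
        = (\<Sum>k=1..p. if k + q \<le> p then - (real k / real q * e z ^ (k + q) * b k z) else 0)" .
    show ?thesis unfolding 1 sum.distrib[symmetric] by (intro sum.cong refl) auto
  qed
  have "(\<lambda>z. if k + q \<le> p then 0 else real k / real q * e z ^ (k + q) * b k z) \<in> O[F](\<lambda>z. e z ^ (p + 1))"
    if "k \<in> {1..p}" for k
  proof (cases "k + q \<le> p")
    case False
    have "(\<lambda>z. real k / real q * e z ^ (k + q) * b k z) \<in> O[F](\<lambda>z. e z ^ (p + 1) * 1)"
      using False that by (intro landau_o.big.mult b landau_o.big.cmult_in_iff[THEN iffD2] power_bigo_power e disjI1) auto
    then show ?thesis using False by simp
  qed simp
  then show ?thesis unfolding eq by (intro big_sum_in_bigo)
qed

section \<open>Global solutions and barriers for differential equations\<close>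

text \<open>Picard iteration on the whole half-line. The bound on \<open>F\<close> keeps all iterates in a common ball on each compact time interval, so a local Lipschitz constant \<open>L\<close> suffices there; weighted by \<open>exp (2 L (t - t0))\<close>, successive differences are halved in each step.\<close>
lemma picard_global_existence:
  fixes F :: "real \<Rightarrow> 'a::euclidean_space \<Rightarrow> 'a" and t0 M :: real and x0 :: 'a
  assumes cont: "continuous_on ({t0..} \<times> UNIV) (\<lambda>(t, x). F t x)"
    and bdd: "\<And>t x. t \<ge> t0 \<Longrightarrow> norm (F t x) \<le> M"
    and lip: "\<And>T R. \<exists>L. \<forall>t\<in>{t0..T}. \<forall>x y. norm x \<le> R \<longrightarrow> norm y \<le> R \<longrightarrow> norm (F t x - F t y) \<le> L * norm (x - y)"
  shows "\<exists>x. x t0 = x0 \<and> (\<forall>t\<ge>t0. (x has_vector_derivative F t (x t)) (at t within {t0..}))"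
proof -
  define X where "X = rec_nat (\<lambda>_. x0) (\<lambda>_ x t. x0 + integral {t0..t} (\<lambda>s. F s (x s)))"
  have X0: "X 0 = (\<lambda>_. x0)" and XS: "X (Suc n) = (\<lambda>t. x0 + integral {t0..t} (\<lambda>s. F s (X n s)))" for n
    by (simp_all add: X_def)
  have contF: "continuous_on {t0..T} (\<lambda>s. F s (y s))" if "continuous_on {t0..T} y" for y T
  proof -
    have "continuous_on {t0..T} (\<lambda>s. (\<lambda>(t, x). F t x) (s, y s))"
      by (rule continuous_on_compose2[OF cont]) (auto intro!: continuous_intros that)
    then show ?thesis by simp
  qed
  have contX: "continuous_on {t0..T} (X n)" for n T
  proof (induction n)
    case 0 show ?case by (simp add: X0)
  next
    case (Suc n)
    have "continuous_on {t0..T} (\<lambda>t. integral {t0..t} (\<lambda>s. F s (X n s)))"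
      by (rule indefinite_integral_continuous_1[OF integrable_continuous_real[OF contF[OF Suc]]])
    then show ?case unfolding XS by (intro continuous_intros)
  qed
  have integ: "(\<lambda>s. F s (X n s)) integrable_on {t0..t}" for n t
    by (rule integrable_continuous_real[OF contF[OF contX]])
  have M0: "M \<ge> 0" using bdd[of t0 0] norm_ge_zero order_trans by blast
  have step: "norm (integral {t0..t} (\<lambda>s. F s (X n s))) \<le> M * (t - t0)" if "t \<ge> t0" for n t
  proof -
    have "norm (integral {t0..t} (\<lambda>s. F s (X n s))) \<le> integral {t0..t} (\<lambda>_. M)"
      by (rule integral_norm_bound_integral[OF integ]) (auto intro: bdd)
    then show ?thesis using that by (simp add: mult.commute)
  qed
  define R where "R T = norm x0 + M * (T - t0)" for T
  have bound: "norm (X n t) \<le> R T" if "t \<in> {t0..T}" for n t T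
  proof (cases n)
    case 0
    then show ?thesis using that M0 by (simp add: X0 R_def)
  next
    case (Suc m)
    have "norm (X n t) \<le> norm x0 + norm (integral {t0..t} (\<lambda>s. F s (X m s)))"
      unfolding Suc XS by (rule norm_triangle_ineq)
    also have "\<dots> \<le> norm x0 + M * (t - t0)" using step[of t m] that by simp
    also have "\<dots> \<le> R T" using that M0 by (simp add: R_def mult_left_mono)
    finally show ?thesis .
  qed
  define x where "x t = x0 + (\<Sum>n. X (Suc n) t - X n t)" for t
  have unif: "uniform_limit {t0..T} X x sequentially"
    and lipT: "\<exists>L>0. \<forall>t\<in>{t0..T}. \<forall>y z. norm y \<le> R T \<longrightarrow> norm z \<le> R T \<longrightarrow> norm (F t y - F t z) \<le> L * norm (y - z)" for T
  proof -
    obtain L' where L': "\<forall>t\<in>{t0..T}. \<forall>y z. norm y \<le> R T \<longrightarrow> norm z \<le> R T \<longrightarrow> norm (F t y - F t z) \<le> L' * norm (y - z)"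
      using lip[of T "R T"] by blast
    \<comment> \<open>Positivity is needed for the factor \<open>1 / (2 L)\<close> from integrating the weight.\<close>
    define L where "L = \<bar>L'\<bar> + 1"
    have L: "L > 0" by (simp add: L_def)
    have Lip: "norm (F t y - F t z) \<le> L * norm (y - z)" if "t \<in> {t0..T}" "norm y \<le> R T" "norm z \<le> R T" for t y z
    proof -
      have "norm (F t y - F t z) \<le> L' * norm (y - z)" using L' that by blast
      also have "\<dots> \<le> L * norm (y - z)" by (rule mult_right_mono) (simp_all add: L_def)
      finally show ?thesis .
    qed
    show "\<exists>L>0. \<forall>t\<in>{t0..T}. \<forall>y z. norm y \<le> R T \<longrightarrow> norm z \<le> R T \<longrightarrow> norm (F t y - F t z) \<le> L * norm (y - z)"
      using L Lip by blast
    define C where "C = M * (T - t0)"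
    have geo: "norm (X (Suc n) t - X n t) \<le> C * (1/2) ^ n * exp (2 * L * (t - t0))" if "t \<in> {t0..T}" for n t
      using that
    proof (induction n arbitrary: t)
      case 0
      have "norm (X (Suc 0) t - X 0 t) \<le> M * (t - t0)" using step[of t 0] 0 by (simp add: XS X0)
      also have "\<dots> \<le> C" using 0 M0 by (simp add: C_def mult_left_mono)
      also have "\<dots> \<le> C * exp (2 * L * (t - t0))"
        using mult_left_mono[of 1 "exp (2 * L * (t - t0))" C] 0 M0 L by (simp add: C_def)
      finally show ?case by simp
    next
      case (Suc n)
      define w where "w t = C * (1/2) ^ n / 2 * exp (2 * L * (t - t0))" for t
      have "((\<lambda>s. L * (C * (1/2) ^ n * exp (2 * L * (s - t0)))) has_integral (w t - w t0)) {t0..t}"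
      proof (rule fundamental_theorem_of_calculus)
        show "t0 \<le> t" using Suc.prems by simp
        show "(w has_vector_derivative L * (C * (1/2) ^ n * exp (2 * L * (s - t0)))) (at s within {t0..t})" for s
          unfolding w_def has_real_derivative_iff_has_vector_derivative[symmetric]
          by (auto intro!: derivative_eq_intros)
      qed
      note w = integral_unique[OF this] has_integral_integrable[OF this]
      have "norm (X (Suc (Suc n)) t - X (Suc n) t) = norm (integral {t0..t} (\<lambda>s. F s (X (Suc n) s) - F s (X n s)))"
        unfolding XS[of "Suc n"] XS[of n] using integral_diff[OF integ[of "Suc n" t] integ[of n t]]
        by (simp add: XS)
      also have "\<dots> \<le> integral {t0..t} (\<lambda>s. L * (C * (1/2) ^ n * exp (2 * L * (s - t0))))"
      proof (rule integral_norm_bound_integral[OF integrable_diff[OF integ integ] w(2)])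
        fix s assume "s \<in> {t0..t}"
        then have s: "s \<in> {t0..T}" using Suc.prems by auto
        have "norm (F s (X (Suc n) s) - F s (X n s)) \<le> L * norm (X (Suc n) s - X n s)"
          by (intro Lip s bound)
        also have "\<dots> \<le> L * (C * (1/2) ^ n * exp (2 * L * (s - t0)))"
          using Suc.IH[OF s] L by (intro mult_left_mono) auto
        finally show "norm (F s (X (Suc n) s) - F s (X n s)) \<le> L * (C * (1/2) ^ n * exp (2 * L * (s - t0)))" .
      qed
      also have "\<dots> \<le> w t"
        using w(1) M0 Suc.prems by (simp add: w_def C_def)
      finally show ?case by (simp add: w_def)
    qed
    have "uniform_limit {t0..T} (\<lambda>n t. \<Sum>i<n. X (Suc i) t - X i t) (\<lambda>t. \<Sum>i. X (Suc i) t - X i t) sequentially"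
    proof (rule Weierstrass_m_test[where M = "\<lambda>n. C * exp (2 * L * (T - t0)) * (1/2) ^ n"])
      show "norm (X (Suc n) t - X n t) \<le> C * exp (2 * L * (T - t0)) * (1/2) ^ n" if t: "t \<in> {t0..T}" for n t
      proof -
        have "C * (1/2) ^ n * exp (2 * L * (t - t0)) \<le> C * (1/2) ^ n * exp (2 * L * (T - t0))"
          using t L M0 by (intro mult_left_mono) (auto simp: C_def)
        then show ?thesis using geo[OF t, of n] by (simp add: mult_ac)
      qed
    qed (intro summable_mult summable_geometric, simp)
    then have "uniform_limit {t0..T} (\<lambda>n t. x0 + (\<Sum>i<n. X (Suc i) t - X i t)) x sequentially"
      unfolding x_def by (intro uniform_limit_intros)
    moreover have "x0 + (\<Sum>i<n. X (Suc i) t - X i t) = X n t" for n t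
      using sum_lessThan_telescope[of "\<lambda>i. X i t" n] by (simp add: X0)
    ultimately show "uniform_limit {t0..T} X x sequentially" by (simp only:)
  qed
  have contx: "continuous_on {t0..T} x" for T
    by (rule uniform_limit_theorem[OF _ unif]) (auto intro: contX always_eventually)
  have lim: "(\<lambda>n. X n t) \<longlonglongrightarrow> x t" if "t \<ge> t0" for t
    by (rule tendsto_uniform_limitI[OF unif[of t]]) (use that in auto)
  have boundx: "norm (x t) \<le> R T" if "t \<in> {t0..T}" for t T
    by (rule tendsto_upperbound[OF tendsto_norm[OF lim]]) (use that bound in \<open>auto intro: always_eventually\<close>)
  have fix_point: "x t = x0 + integral {t0..t} (\<lambda>s. F s (x s))" if t: "t \<ge> t0" for t
  proof -
    obtain L where L: "L > 0" "\<forall>s\<in>{t0..t}. \<forall>y z. norm y \<le> R t \<longrightarrow> norm z \<le> R t \<longrightarrow> norm (F s y - F s z) \<le> L * norm (y - z)"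
      using lipT by blast
    have "uniform_limit {t0..t} (\<lambda>n s. F s (X n s)) (\<lambda>s. F s (x s)) sequentially"
    proof (rule uniform_limitI)
      fix \<epsilon> :: real assume "\<epsilon> > 0"
      then have "\<epsilon> / L > 0" using L(1) by simp
      have "eventually (\<lambda>n. \<forall>s\<in>{t0..t}. dist (X n s) (x s) < \<epsilon> / L) sequentially"
        by (rule uniform_limitD[OF unif]) fact
      then show "eventually (\<lambda>n. \<forall>s\<in>{t0..t}. dist (F s (X n s)) (F s (x s)) < \<epsilon>) sequentially"
      proof (rule eventually_mono, intro ballI)
        fix n s assume *: "\<forall>s\<in>{t0..t}. dist (X n s) (x s) < \<epsilon> / L" and s: "s \<in> {t0..t}"
        have "norm (F s (X n s) - F s (x s)) \<le> L * norm (X n s - x s)"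
          using L(2) s bound[OF s] boundx[OF s] by blast
        also have "\<dots> < L * (\<epsilon> / L)" using * s L(1) by (intro mult_strict_left_mono) (auto simp: dist_norm)
        finally show "dist (F s (X n s)) (F s (x s)) < \<epsilon>" using L(1) by (simp add: dist_norm)
      qed
    qed
    from uniform_limit_integral[OF this] obtain I J where
      IJ: "\<And>n. ((\<lambda>s. F s (X n s)) has_integral I n) {t0..t}" "((\<lambda>s. F s (x s)) has_integral J) {t0..t}" "I \<longlonglongrightarrow> J"
      using contF[OF contX] by auto
    then have "(\<lambda>n. X (Suc n) t) \<longlonglongrightarrow> x0 + J"
      unfolding XS integral_unique[OF IJ(1)] by (intro tendsto_intros)
    moreover have "(\<lambda>n. X (Suc n) t) \<longlonglongrightarrow> x t"
      using lim[OF t] by (rule LIMSEQ_Suc)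
    ultimately have "x t = x0 + J" using LIMSEQ_unique by blast
    then show ?thesis using IJ(2) by (simp add: integral_unique)
  qed
  have "(x has_vector_derivative F t (x t)) (at t within {t0..})" if t: "t \<ge> t0" for t
  proof -
    have "((\<lambda>u. integral {t0..u} (\<lambda>s. F s (x s))) has_vector_derivative F t (x t)) (at t within {t0..t+1})"
      by (rule integral_has_vector_derivative[OF contF[OF contx]]) (use t in auto)
    then have "((\<lambda>u. x0 + integral {t0..u} (\<lambda>s. F s (x s))) has_vector_derivative F t (x t)) (at t within {t0..t+1})"
      by (auto intro!: derivative_eq_intros)
    then have "(x has_vector_derivative F t (x t)) (at t within {t0..t+1})"
      by (rule has_vector_derivative_transform[rotated 2]) (use t fix_point in auto)
    moreover have "at t within {t0..t+1} = at t within {t0..}"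
      by (rule at_within_nhd[of _ "{..<t+1}"]) auto
    ultimately show ?thesis by simp
  qed
  moreover have "x t0 = x0" using fix_point[of t0] by simp
  ultimately show ?thesis by blast
qed

text \<open>The planar form requires Lipschitz bounds only for bounded second components, with no restriction on the first: this is the situation after the radius has been clamped.\<close>
lemma picard_global_existence_plane:
  fixes A B :: "real \<Rightarrow> real \<Rightarrow> real \<Rightarrow> real" and t0 M a b :: real
  assumes cont: "continuous_on ({t0..} \<times> UNIV) (\<lambda>(t, r, \<phi>). A t r \<phi>)" "continuous_on ({t0..} \<times> UNIV) (\<lambda>(t, r, \<phi>). B t r \<phi>)"
    and bdd: "\<And>t r \<phi>. t \<ge> t0 \<Longrightarrow> \<bar>A t r \<phi>\<bar> \<le> M" "\<And>t r \<phi>. t \<ge> t0 \<Longrightarrow> \<bar>B t r \<phi>\<bar> \<le> M"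
    and lip: "\<And>T R. \<exists>L. \<forall>t\<in>{t0..T}. \<forall>r r' \<phi> \<phi>'. \<bar>\<phi>\<bar> \<le> R \<longrightarrow> \<bar>\<phi>'\<bar> \<le> R \<longrightarrow>
        \<bar>A t r \<phi> - A t r' \<phi>'\<bar> \<le> L * (\<bar>r - r'\<bar> + \<bar>\<phi> - \<phi>'\<bar>) \<and> \<bar>B t r \<phi> - B t r' \<phi>'\<bar> \<le> L * (\<bar>r - r'\<bar> + \<bar>\<phi> - \<phi>'\<bar>)"
  shows "\<exists>r \<phi>. r t0 = a \<and> \<phi> t0 = b \<and> (\<forall>t\<ge>t0. (r has_real_derivative A t (r t) (\<phi> t)) (at t within {t0..})
      \<and> (\<phi> has_real_derivative B t (r t) (\<phi> t)) (at t within {t0..}))"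
proof -
  define F where "F t x = (A t (fst x) (snd x), B t (fst x) (snd x))" for t and x :: "real \<times> real"
  have "\<exists>x. x t0 = (a, b) \<and> (\<forall>t\<ge>t0. (x has_vector_derivative F t (x t)) (at t within {t0..}))"
  proof (rule picard_global_existence[where M = "M + M"])
    have "(\<lambda>(t, x). F t x) = (\<lambda>z. ((\<lambda>(t, r, \<phi>). A t r \<phi>) z, (\<lambda>(t, r, \<phi>). B t r \<phi>) z))"
      by (auto simp: F_def)
    then show "continuous_on ({t0..} \<times> UNIV) (\<lambda>(t, x). F t x)"
      using continuous_on_Pair[OF cont] by (simp only:)
  next
    fix t x assume "t \<ge> t0"
    then show "norm (F t x) \<le> M + M"
      using norm_Pair_le[of "A t (fst x) (snd x)" "B t (fst x) (snd x)"] bdd[of t "fst x" "snd x"]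
      unfolding F_def real_norm_def by linarith
  next
    fix T R
    obtain L where L: "\<forall>t\<in>{t0..T}. \<forall>r r' \<phi> \<phi>'. \<bar>\<phi>\<bar> \<le> R \<longrightarrow> \<bar>\<phi>'\<bar> \<le> R \<longrightarrow>
        \<bar>A t r \<phi> - A t r' \<phi>'\<bar> \<le> L * (\<bar>r - r'\<bar> + \<bar>\<phi> - \<phi>'\<bar>) \<and> \<bar>B t r \<phi> - B t r' \<phi>'\<bar> \<le> L * (\<bar>r - r'\<bar> + \<bar>\<phi> - \<phi>'\<bar>)"
      using lip by blast
    have "norm (F t x - F t y) \<le> (4 * \<bar>L\<bar>) * norm (x - y)"
      if t: "t \<in> {t0..T}" and xy: "norm x \<le> R" "norm y \<le> R" for t x y
    proof -
      have comp: "\<bar>fst x - fst y\<bar> \<le> norm (x - y)" "\<bar>snd x - snd y\<bar> \<le> norm (x - y)"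
        using norm_fst_le[of "fst (x - y)" "snd (x - y)"] norm_snd_le[of "snd (x - y)" "fst (x - y)"]
        unfolding prod.collapse by auto
      have "\<bar>snd x\<bar> \<le> R" "\<bar>snd y\<bar> \<le> R" using norm_snd_le[of "snd x" "fst x"] norm_snd_le[of "snd y" "fst y"] xy by auto
      from L[rule_format, OF t this, of "fst x" "fst y"]
      have "\<bar>A t (fst x) (snd x) - A t (fst y) (snd y)\<bar> \<le> L * (\<bar>fst x - fst y\<bar> + \<bar>snd x - snd y\<bar>)"
        "\<bar>B t (fst x) (snd x) - B t (fst y) (snd y)\<bar> \<le> L * (\<bar>fst x - fst y\<bar> + \<bar>snd x - snd y\<bar>)" by auto
      moreover have "L * (\<bar>fst x - fst y\<bar> + \<bar>snd x - snd y\<bar>) \<le> \<bar>L\<bar> * (2 * norm (x - y))"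
        using comp by (intro mult_mono) auto
      ultimately show ?thesis
        using norm_Pair_le[of "A t (fst x) (snd x) - A t (fst y) (snd y)" "B t (fst x) (snd x) - B t (fst y) (snd y)"]
        unfolding F_def diff_Pair real_norm_def by linarith
    qed
    then show "\<exists>L. \<forall>t\<in>{t0..T}. \<forall>x y. norm x \<le> R \<longrightarrow> norm y \<le> R \<longrightarrow> norm (F t x - F t y) \<le> L * norm (x - y)"
      by (intro exI[of _ "4 * \<bar>L\<bar>"]) auto
  qed
  then obtain x where x: "x t0 = (a, b)" "\<forall>t\<ge>t0. (x has_vector_derivative F t (x t)) (at t within {t0..})"
    by (elim exE conjE) (rule that)
  have "((\<lambda>t. fst (x t)) has_real_derivative A t (fst (x t)) (snd (x t))) (at t within {t0..})"
    "((\<lambda>t. snd (x t)) has_real_derivative B t (fst (x t)) (snd (x t))) (at t within {t0..})" if "t \<ge> t0" for t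
  proof -
    have d: "(x has_vector_derivative F t (x t)) (at t within {t0..})" using x(2) that by simp
    from bounded_linear.has_vector_derivative[OF bounded_linear_fst d]
    show "((\<lambda>t. fst (x t)) has_real_derivative A t (fst (x t)) (snd (x t))) (at t within {t0..})"
      unfolding has_real_derivative_iff_has_vector_derivative F_def by simp
    from bounded_linear.has_vector_derivative[OF bounded_linear_snd d]
    show "((\<lambda>t. snd (x t)) has_real_derivative B t (fst (x t)) (snd (x t))) (at t within {t0..})"
      unfolding has_real_derivative_iff_has_vector_derivative F_def by simp
  qed
  then show ?thesis
    using x(1) by (intro exI[of _ "\<lambda>t. fst (x t)"] exI[of _ "\<lambda>t. snd (x t)"]) auto
qed

text \<open>After the last time at which \<open>w\<close> lies in the interval, \<open>w\<^sup>2\<close> cannot increase.\<close>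
lemma barrier:
  fixes w w' :: "real \<Rightarrow> real"
  assumes "a \<le> b" and cont: "continuous_on {a..b} w" and start: "\<bar>w a\<bar> \<le> m"
    and der: "\<And>t. a < t \<Longrightarrow> t < b \<Longrightarrow> (w has_real_derivative w' t) (at t)"
    and inward: "\<And>t. a < t \<Longrightarrow> t < b \<Longrightarrow> \<bar>w t\<bar> > m \<Longrightarrow> w t * w' t \<le> 0"
  shows "\<bar>w b\<bar> \<le> m"
proof (rule ccontr)
  assume nb: "\<not> \<bar>w b\<bar> \<le> m"
  define A where "A = {t \<in> {a..b}. \<bar>w t\<bar> \<le> m}"
  have "closed A"
    unfolding A_def by (intro continuous_on_closed_Collect_le continuous_intros cont closed_atLeastAtMost)
  moreover have "bounded A"
    by (rule bounded_subset[of "{a..b}"]) (auto simp: A_def)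
  ultimately have "compact A" by (simp add: compact_eq_bounded_closed)
  moreover have "a \<in> A" using assms(1) start by (simp add: A_def)
  ultimately obtain c where c: "c \<in> A" "\<And>t. t \<in> A \<Longrightarrow> t \<le> c"
    using compact_attains_sup[of A] by blast
  have cb: "a \<le> c" "c < b" "\<bar>w c\<bar> \<le> m"
    using c(1) nb by (auto simp: A_def order_le_less)
  have out: "\<bar>w t\<bar> > m" if "c < t" "t \<le> b" for t
    using c(2)[of t] that cb by (force simp: A_def)
  have "(\<lambda>t. w t * w t) c \<ge> (\<lambda>t. w t * w t) b"
  proof (rule DERIV_nonpos_imp_decreasing_open[where f = "\<lambda>t. w t * w t"])
    fix t assume t: "c < t" "t < b"
    have d: "(w has_real_derivative w' t) (at t)" using der t cb by simp
    have "((\<lambda>t. w t * w t) has_real_derivative 2 * (w t * w' t)) (at t)"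
      using DERIV_mult[OF d d] by (simp add: mult.commute)
    moreover have "2 * (w t * w' t) \<le> 0" using inward[of t] out[of t] t cb by simp
    ultimately show "\<exists>y. ((\<lambda>t. w t * w t) has_real_derivative y) (at t) \<and> y \<le> 0" by blast
  qed (use cb in \<open>auto intro!: continuous_intros continuous_on_subset[OF cont]\<close>)
  then have "(w b)\<^sup>2 \<le> (w c)\<^sup>2" by (simp add: power2_eq_square)
  then have "\<bar>w b\<bar> \<le> \<bar>w c\<bar>" by (simp add: abs_le_square_iff)
  then show False using nb cb by linarith
qed

lemma first_exit:
  fixes u :: "real \<Rightarrow> real"
  assumes cont: "continuous_on {a..b} u" and "a \<le> b" and "\<bar>u a\<bar> < c" and "c \<le> \<bar>u b\<bar>"
  obtains t where "a \<le> t" "t \<le> b" "\<bar>u t\<bar> = c" "\<And>s. a \<le> s \<Longrightarrow> s \<le> t \<Longrightarrow> \<bar>u s\<bar> \<le> c"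
proof -
  define A where "A = {t \<in> {a..b}. c \<le> \<bar>u t\<bar>}"
  have "closed A"
    unfolding A_def by (intro continuous_on_closed_Collect_le continuous_intros cont closed_atLeastAtMost)
  moreover have "bounded A"
    by (rule bounded_subset[of "{a..b}"]) (auto simp: A_def)
  ultimately have "compact A" by (simp add: compact_eq_bounded_closed)
  moreover have "b \<in> A" using assms by (simp add: A_def)
  ultimately obtain t where t: "t \<in> A" "\<And>s. s \<in> A \<Longrightarrow> t \<le> s"
    using compact_attains_inf[of A] by blast
  have tab: "a \<le> t" "t \<le> b" "c \<le> \<bar>u t\<bar>" using t(1) by (auto simp: A_def)
  have before: "\<bar>u s\<bar> < c" if "a \<le> s" "s < t" for s
    using t(2)[of s] that tab by (force simp: A_def)
  have "\<exists>x\<ge>a. x \<le> t \<and> \<bar>u x\<bar> = c"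
    by (rule IVT') (use assms(3) tab in \<open>auto intro!: continuous_intros continuous_on_subset[OF cont]\<close>)
  then obtain x where x: "a \<le> x" "x \<le> t" "\<bar>u x\<bar> = c" by blast
  have "x = t"
  proof (rule ccontr)
    assume "x \<noteq> t"
    then show False using before[of x] x by simp
  qed
  then have eq: "\<bar>u t\<bar> = c" using x(3) by simp
  have "\<bar>u s\<bar> \<le> c" if "a \<le> s" "s \<le> t" for s
    using before[of s] eq that by (cases "s = t") auto
  then show thesis by (rule that[OF tab(1,2) eq])
qed

text \<open>Integrating \<open>|\<phi>' - c| < \<kappa>\<close> bounds the deviation from \<open>c t\<close> by \<open>\<kappa> t\<close> plus a constant.\<close>
lemma asymp_equiv_linear:
  fixes \<phi> \<phi>' :: "real \<Rightarrow> real"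
  assumes der: "\<And>t. t > t0 \<Longrightarrow> (\<phi> has_real_derivative \<phi>' t) (at t)" and lim: "(\<phi>' \<longlongrightarrow> c) at_top" and "c > 0"
  shows "\<phi> \<sim>[at_top] (\<lambda>t. c * t)"
proof (rule smallo_imp_asymp_equiv, rule landau_o.smallI)
  fix \<epsilon> :: real assume "\<epsilon> > 0"
  define \<kappa> where "\<kappa> = \<epsilon> * c / 2"
  have \<kappa>: "\<kappa> > 0" using \<open>\<epsilon> > 0\<close> \<open>c > 0\<close> by (simp add: \<kappa>_def)
  have "eventually (\<lambda>t. dist (\<phi>' t) c < \<kappa>) at_top" using lim \<kappa> by (rule tendstoD)
  then obtain T0 where T0: "\<And>t. t \<ge> T0 \<Longrightarrow> dist (\<phi>' t) c < \<kappa>" unfolding eventually_at_top_linorder by blast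
  define T where "T = max (max T0 (t0 + 1)) 1"
  define D where "D = \<bar>\<phi> T - c * T\<bar>"
  have key: "\<bar>\<phi> t - c * t\<bar> \<le> D + \<kappa> * t" if t: "t \<ge> T" for t
  proof -
    have "norm ((\<phi> t - c * t) - (\<phi> T - c * T)) \<le> \<kappa> * norm (t - T)"
    proof (rule field_differentiable_bound[where S = "{T..}"])
      fix x assume "x \<in> {T..}"
      then have x: "x > t0" "x \<ge> T0" by (auto simp: T_def)
      show "((\<lambda>t. \<phi> t - c * t) has_field_derivative \<phi>' x - c) (at x within {T..})"
        by (rule has_field_derivative_at_within) (auto intro!: derivative_eq_intros der x)
      show "norm (\<phi>' x - c) \<le> \<kappa>" using T0[OF x(2)] by (simp add: dist_real_def)
    qed (use t in auto)
    moreover have "\<kappa> * norm (t - T) \<le> \<kappa> * t" using t \<kappa> by (intro mult_left_mono) (auto simp: T_def)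
    ultimately show ?thesis unfolding D_def real_norm_def by linarith
  qed
  have "eventually (\<lambda>t. t \<ge> T \<and> t \<ge> D / \<kappa>) at_top"
    by (intro eventually_conj eventually_ge_at_top)
  then show "eventually (\<lambda>t. norm (\<phi> t - c * t) \<le> \<epsilon> * norm (c * t)) at_top"
  proof (rule eventually_mono)
    fix t assume t: "t \<ge> T \<and> t \<ge> D / \<kappa>"
    then have "D \<le> \<kappa> * t" using \<kappa> by (simp add: field_simps)
    then have "\<bar>\<phi> t - c * t\<bar> \<le> 2 * \<kappa> * t" using key[of t] t by simp
    also have "\<dots> = \<epsilon> * norm (c * t)" using t \<open>c > 0\<close> by (simp add: \<kappa>_def T_def abs_mult)
    finally show "norm (\<phi> t - c * t) \<le> \<epsilon> * norm (c * t)" by simp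
  qed
qed

section \<open>The tube around the attracting solution\<close>

text \<open>The dissipative situation: the first nonzero averaged coefficient is \<open>\<Lambda> n\<close>, \<open>\<nu>\<close> is the decay exponent of the attracting solution and \<open>d\<close> the rate at which rescaled deviations from it contract.\<close>

locale stable_averaging = averaging r0 q p \<omega> f g fk gk s N rs ts \<Lambda> v
  for r0 :: real and q p :: nat
    and \<omega> :: "real \<Rightarrow> real"
    and f g :: "real \<Rightarrow> real \<Rightarrow> real \<Rightarrow> real \<Rightarrow> real"
    and fk gk :: "nat \<Rightarrow> real \<Rightarrow> real \<Rightarrow> real \<Rightarrow> real"
    and s :: "nat \<Rightarrow> real"
    and N :: nat and rs ts :: real
    and \<Lambda> :: "nat \<Rightarrow> real \<Rightarrow> real"
    and v :: "nat \<Rightarrow> real \<Rightarrow> real \<Rightarrow> real \<Rightarrow> real" +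
  fixes n :: nat and lam \<nu> d :: real
  assumes n_range: "1 \<le> n" "n < p" "n \<le> q"
    and Lambda_below_n: "\<And>k \<rho>. k \<in> {1..<n} \<Longrightarrow> \<bar>\<rho>\<bar> \<le> rs \<Longrightarrow> \<Lambda> k \<rho> = 0"
    and Lambda_n: "\<exists>h\<in>O[at 0](\<lambda>\<rho>. \<bar>\<rho>\<bar>). \<forall>\<rho>. \<bar>\<rho>\<bar> \<le> rs \<longrightarrow> \<Lambda> n \<rho> = \<rho> * (lam + h \<rho>)"
    and nu_eq: "\<nu> = (real p - real n) / real q"
    and d_eq: "d = lam + (if n = q then \<nu> else 0)"
    and d_neg: "d < 0"
begin

abbreviation e :: "real \<Rightarrow> real" where "e \<equiv> small_parameter q"

abbreviation eps :: "real \<times> real \<times> real \<Rightarrow> real" where "eps z \<equiv> e (fst z)"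

text \<open>The stationary point of the leading part \<open>d x + \<Lambda> p 0\<close> of the rescaled averaged equation.\<close>
definition x0 :: real where "x0 = - \<Lambda> p 0 / d"

text \<open>Points are triples \<open>(t, x, \<phi>)\<close>, where \<open>x\<close> is the rescaled radius \<open>t powr \<nu> * r\<close>. The filter lets \<open>t\<close> tend to infinity while \<open>x\<close> stays in a fixed neighbourhood of \<open>x0\<close> that excludes \<open>0\<close>; estimates along it are uniform in \<open>x\<close> and \<open>\<phi>\<close>.\<close>
definition tube :: "(real \<times> real \<times> real) filter" where
  "tube = inf (filtercomap fst at_top) (principal {(t, x, \<phi>). \<bar>x - x0\<bar> \<le> \<bar>x0\<bar> / 2})"

definition rad :: "real \<times> real \<times> real \<Rightarrow> real" where
  "rad z = fst z powr (- \<nu>) * fst (snd z)"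

abbreviation ang :: "real \<times> real \<times> real \<Rightarrow> real" where "ang z \<equiv> snd (snd z)"

abbreviation phs :: "real \<times> real \<times> real \<Rightarrow> real" where "phs z \<equiv> phase q s (fst z)"

abbreviation f_tube :: "real \<times> real \<times> real \<Rightarrow> real" where "f_tube z \<equiv> f (rad z) (ang z) (phs z) (fst z)"

abbreviation g_tube :: "real \<times> real \<times> real \<Rightarrow> real" where "g_tube z \<equiv> g (rad z) (ang z) (phs z) (fst z)"

lemma x0_nonzero: "x0 \<noteq> 0"
proof -
  have "\<Lambda> p 0 \<noteq> 0" using fp_nonzero Lambda_p_at_zero by force
  then show ?thesis using d_neg by (simp add: x0_def)
qed

lemma eventually_tube:
  "eventually P tube \<longleftrightarrow> (\<exists>T. \<forall>t\<ge>T. \<forall>x \<phi>. \<bar>x - x0\<bar> \<le> \<bar>x0\<bar> / 2 \<longrightarrow> P (t, x, \<phi>))"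
  unfolding tube_def eventually_inf_principal eventually_filtercomap_at_top_linorder by simp

lemma tube_zero_bigo: "eventually (\<lambda>z. h z = (0::real)) tube \<Longrightarrow> h \<in> O[tube](b)" for b :: "real \<times> real \<times> real \<Rightarrow> real"
  by (rule bigoI[of _ 0]) (auto elim: eventually_mono)

lemma tube_bigo_cong:
  fixes h h' b :: "real \<times> real \<times> real \<Rightarrow> real"
  assumes "eventually (\<lambda>z. h z = h' z) tube" "h' \<in> O[tube](b)"
  shows "h \<in> O[tube](b)"
  using landau_o.big.in_cong[OF assms(1)] assms(2) by (rule iffD2)

lemma eventually_tube_time: "eventually P at_top \<Longrightarrow> eventually (\<lambda>z. P (fst z)) tube"
  unfolding eventually_tube eventually_at_top_linorder by auto

lemma eventually_tube_pos: "eventually (\<lambda>z. fst z > 0) tube"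
  by (rule eventually_tube_time) (rule eventually_gt_at_top)

lemma filterlim_fst_tube: "filterlim fst at_top tube"
  unfolding tube_def by (rule filterlim_mono[OF filterlim_filtercomap order_refl inf_le1])

lemma nu_pos: "\<nu> > 0"
  using n_range q_pos by (simp add: nu_eq)

lemma e_tendsto: "((\<lambda>z. eps z) \<longlongrightarrow> 0) tube"
  using filterlim_compose[OF small_parameter_tendsto[OF q_pos] filterlim_fst_tube] .

lemma e_bigo_1: "(\<lambda>z. eps z) \<in> O[tube](\<lambda>_. 1)"
  by (rule bigoI_tendsto[where c = 0]) (use e_tendsto in auto)

lemma e_power_mono: "i \<le> j \<Longrightarrow> (\<lambda>z. eps z ^ j) \<in> O[tube](\<lambda>z. eps z ^ i)"
  by (rule power_bigo_power[OF e_bigo_1])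

lemma powr_nu_eq: "t > 0 \<Longrightarrow> t powr (- \<nu>) = e t ^ (p - n)"
  using n_range by (simp add: small_parameter_power nu_eq of_nat_diff)

lemma eventually_tube_bounds: "eventually (\<lambda>z. \<bar>x0\<bar> / 2 \<le> \<bar>fst (snd z)\<bar> \<and> \<bar>fst (snd z)\<bar> \<le> 2 * \<bar>x0\<bar>) tube"
  unfolding eventually_tube
proof (intro exI[of _ 0] allI impI)
  fix t x \<phi> :: real assume "\<bar>x - x0\<bar> \<le> \<bar>x0\<bar> / 2"
  then have "\<bar>x0\<bar> / 2 \<le> \<bar>x\<bar> \<and> \<bar>x\<bar> \<le> 2 * \<bar>x0\<bar>" by linarith
  then show "\<bar>x0\<bar> / 2 \<le> \<bar>fst (snd (t, x, \<phi>))\<bar> \<and> \<bar>fst (snd (t, x, \<phi>))\<bar> \<le> 2 * \<bar>x0\<bar>" by simp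
qed

lemma x_bigo_1: "(\<lambda>z. fst (snd z)) \<in> O[tube](\<lambda>_. 1)"
  by (rule bigoI[of _ "2 * \<bar>x0\<bar>"], rule eventually_mono[OF eventually_tube_bounds]) auto

lemma rad_eq: "eventually (\<lambda>z. rad z = eps z ^ (p - n) * fst (snd z)) tube"
  by (rule eventually_mono[OF eventually_tube_pos]) (simp add: rad_def powr_nu_eq)

lemma rad_bigo: "rad \<in> O[tube](\<lambda>z. eps z ^ (p - n))"
proof -
  have "(\<lambda>z. eps z ^ (p - n) * fst (snd z)) \<in> O[tube](\<lambda>z. eps z ^ (p - n) * 1)"
    by (intro landau_o.big.mult x_bigo_1) simp
  then show ?thesis using rad_eq by (subst landau_o.big.in_cong[OF rad_eq]) simp
qed

text \<open>In the tube the radius is also bounded from below, which controls the factor \<open>1/r\<close>.\<close>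
lemma e_bigo_rad: "(\<lambda>z. eps z ^ (p - n)) \<in> O[tube](rad)"
proof (rule bigoI[of _ "2 / \<bar>x0\<bar>"])
  show "eventually (\<lambda>z. norm (eps z ^ (p - n)) \<le> 2 / \<bar>x0\<bar> * norm (rad z)) tube"
    using rad_eq eventually_tube_bounds
  proof eventually_elim
    case (elim z)
    have "1 \<le> 2 / \<bar>x0\<bar> * \<bar>fst (snd z)\<bar>" using elim(2) x0_nonzero by (simp add: field_simps)
    from mult_left_mono[OF this, of "\<bar>eps z ^ (p - n)\<bar>"] show ?case
      using elim(1) by (simp add: abs_mult mult_ac)
  qed
qed

lemma filterlim_tube_punctured: "filterlim (\<lambda>z. (rad z, ang z, phs z)) zero_radius tube"
proof -
  have "rad \<in> O[tube](\<lambda>z. eps z ^ 1)"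
    by (rule landau_o.big.trans[OF rad_bigo e_power_mono]) (use n_range in auto)
  also have "(\<lambda>z. eps z ^ 1) \<in> o[tube](\<lambda>_. 1)"
    by (rule smalloI_tendsto) (use e_tendsto in auto)
  finally have "(rad \<longlongrightarrow> 0) tube" by (auto dest: smalloD_tendsto)
  moreover have "eventually (\<lambda>z. rad z \<noteq> 0) tube"
    using eventually_tube_pos eventually_tube_bounds
    by eventually_elim (use x0_nonzero in \<open>auto simp: rad_def\<close>)
  ultimately show ?thesis
    unfolding zero_radius_def filterlim_filtercomap_iff by (auto simp: filterlim_at o_def)
qed

text \<open>Estimates near \<open>r = 0\<close> that are uniform in the angles hold in particular along the tube.\<close>
lemma tube_pullback:
  assumes "(\<lambda>(r, \<phi>, S). H r \<phi> S) \<in> O[zero_radius](B)"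
  shows "(\<lambda>z. H (rad z) (ang z) (phs z)) \<in> O[tube](\<lambda>z. B (rad z, ang z, phs z))"
  using landau_o.big.compose[OF assms filterlim_tube_punctured] by simp

lemma eventually_tube_small: "c > 0 \<Longrightarrow> eventually (\<lambda>z. rad z \<noteq> 0 \<and> \<bar>rad z\<bar> < c) tube"
  using eventually_compose_filterlim[OF eventually_zero_radius filterlim_tube_punctured] by simp

lemma expansion_bigo:
  assumes "uniform_expansion r0 q F Fk"
  shows "(\<lambda>z. F (rad z) (ang z) (phs z) (fst z) - (\<Sum>k=1..K. eps z ^ k * Fk k (rad z) (ang z) (phs z)))
     \<in> O[tube](\<lambda>z. eps z ^ (K + 1))"
proof -
  obtain C T where CT: "T > 0" "\<forall>t\<ge>T. \<forall>r \<phi> S. \<bar>r\<bar> \<le> r0 \<longrightarrow>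
        \<bar>F r \<phi> S t - (\<Sum>k=1..K. t powr (- (real k / real q)) * Fk k r \<phi> S)\<bar>
          \<le> C * t powr (- (real (Suc K) / real q))"
    using assms[unfolded uniform_expansion_def, THEN spec, of K] by (elim exE conjE) (rule that)
  show ?thesis
  proof (rule bigoI[of _ C])
    show "eventually (\<lambda>z. norm (F (rad z) (ang z) (phs z) (fst z) - (\<Sum>k=1..K. eps z ^ k * Fk k (rad z) (ang z) (phs z)))
      \<le> C * norm (eps z ^ (K + 1))) tube"
      using eventually_tube_small[OF r0_pos] eventually_tube_time[OF eventually_ge_at_top[of T]]
    proof eventually_elim
      case (elim z)
      then have "fst z > 0" using CT(1) by linarith
      then have "norm (eps z ^ (K + 1)) = fst z powr (- (real (Suc K) / real q))"
        by (simp add: small_parameter_power del: power_Suc)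
      then show ?case using CT(2)[rule_format, of "fst z" "rad z" "ang z" "phs z"] elim \<open>fst z > 0\<close>
        by (simp add: small_parameter_power del: power_Suc)
    qed
  qed
qed

section \<open>The averaged drift in the tube\<close>

text \<open>The time derivative of \<open>near_identity q s p v r \<phi> t\<close> along the perturbed system. The change of variables is truncated at order \<open>p\<close>, the order of the forcing term that balances the linear decay.\<close>
definition drift :: "real \<Rightarrow> real \<Rightarrow> real \<Rightarrow> real" where
  "drift t r \<phi> = f r \<phi> (phase q s t) t + (\<Sum>k=1..p.
     e t ^ k * (deriv (\<lambda>x. v k x \<phi> (phase q s t)) r * f r \<phi> (phase q s t) t
              + deriv (\<lambda>x. v k r x (phase q s t)) \<phi> * (\<omega> r + inverse r * g r \<phi> (phase q s t) t)
              + deriv (\<lambda>x. v k r \<phi> x) (phase q s t) * (s 0 + (\<Sum>i=1..q. sigma q s i * e t ^ i)))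
     - real k / real q * e t ^ (k + q) * v k r \<phi> (phase q s t))"

text \<open>The coefficients and their derivatives as functions on the tube.\<close>
definition v_at where "v_at k z = v k (rad z) (ang z) (phs z)"
definition dr_v where "dr_v k z = deriv (\<lambda>x. v k x (ang z) (phs z)) (rad z)"
definition dphi_v where "dphi_v k z = deriv (\<lambda>x. v k (rad z) x (phs z)) (ang z)"
definition dS_v where "dS_v k z = deriv (\<lambda>x. v k (rad z) (ang z) x) (phs z)"
definition f_at where "f_at i z = fk i (rad z) (ang z) (phs z)"
definition g_over_r where "g_over_r i z = inverse (rad z) * gk i (rad z) (ang z) (phs z)"
definition taylor_at where "taylor_at k z = taylor_coeff \<Lambda> v k (rad z) (ang z) (phs z)"

lemma index_range: "k \<in> {1..p} \<Longrightarrow> k \<in> {1..N}"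
  using N_range by auto

lemma v_tube_bigo:
  assumes "k \<in> {1..p}"
  shows "v_at k \<in> O[tube](\<lambda>_. 1)" "dr_v k \<in> O[tube](\<lambda>_. 1)" "dphi_v k \<in> O[tube](\<lambda>_. 1)" "dS_v k \<in> O[tube](\<lambda>_. 1)"
  using v_bigo_1[OF index_range[OF assms], THEN tube_pullback]
  unfolding v_at_def[abs_def] dr_v_def[abs_def] dphi_v_def[abs_def] dS_v_def[abs_def] by auto

lemma v_tube_bigo_rad:
  assumes "k \<in> {1..<p}"
  shows "v_at k \<in> O[tube](rad)" "dphi_v k \<in> O[tube](rad)"
proof -
  have kN: "k \<in> {1..N}" using assms N_range by auto
  have "v k 0 \<phi> S = 0" for \<phi> S by (rule v_vanishes_at_zero) (use assms in auto)
  note b = v_bigo_r[OF kN this, THEN tube_pullback]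
  show "v_at k \<in> O[tube](rad)" "dphi_v k \<in> O[tube](rad)"
    using b(1,2) unfolding v_at_def[abs_def] dphi_v_def[abs_def] by auto
qed

lemma f_at_bigo: "i \<in> {1..<p} \<Longrightarrow> f_at i \<in> O[tube](\<lambda>_. 1)"
proof -
  assume i: "i \<in> {1..<p}"
  have "(\<lambda>z. fk i (rad z) (ang z) (phs z)) \<in> O[tube](\<lambda>z. fst (rad z, ang z, phs z))"
    by (rule tube_pullback[OF fk_bigo]) (use i in auto)
  then have "f_at i \<in> O[tube](rad)" by (simp add: f_at_def[abs_def])
  also have "rad \<in> O[tube](\<lambda>z. eps z ^ (p - n))" by (rule rad_bigo)
  also have "(\<lambda>z. eps z ^ (p - n)) \<in> O[tube](\<lambda>z. eps z ^ 0)" by (rule e_power_mono) simp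
  finally show ?thesis by simp
qed

lemma g_over_r_bigo: "i \<in> {1..<p} \<Longrightarrow> g_over_r i \<in> O[tube](\<lambda>_. 1)"
  using tube_pullback[OF gk_over_r_bigo[of i]] unfolding g_over_r_def[abs_def] by auto

lemma expansion_bigo_below_p:
  assumes "uniform_expansion r0 q F Fk"
  shows "(\<lambda>z. F (rad z) (ang z) (phs z) (fst z) - (\<Sum>k=1..<p. eps z ^ k * Fk k (rad z) (ang z) (phs z)))
     \<in> O[tube](\<lambda>z. eps z ^ p)"
proof -
  have "{1..p - 1} = {1..<p}" using p_pos by auto
  then show ?thesis using expansion_bigo[OF assms, of "p - 1"] p_pos by simp
qed

text \<open>For \<open>k < p\<close> the angular derivative is itself \<open>O(r)\<close>. For \<open>k = p\<close> it is only bounded, but then \<open>e\<^sup>p = e\<^sup>n e\<^bsup>p-n\<^esup>\<close>, where the second factor is \<open>O(r)\<close> in the tube and \<open>n \<ge> 1\<close>.\<close>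
lemma rad_product_bigo:
  assumes "k \<in> {1..p}"
  shows "(\<lambda>z. eps z ^ k * dphi_v k z) \<in> O[tube](\<lambda>z. rad z * eps z)"
proof (cases "k < p")
  case True
  have "(\<lambda>z. eps z ^ k * dphi_v k z) \<in> O[tube](\<lambda>z. eps z ^ 1 * rad z)"
    using True assms by (intro landau_o.big.mult e_power_mono v_tube_bigo_rad) auto
  then show ?thesis by (simp add: mult.commute)
next
  case False
  then have kp: "k = p" using assms by auto
  have eq: "eps z ^ k = eps z ^ (p - n) * eps z ^ n" for z
    using n_range by (simp add: kp power_add[symmetric])
  have "(\<lambda>z. eps z ^ (p - n) * eps z ^ n * dphi_v k z) \<in> O[tube](\<lambda>z. rad z * eps z ^ 1 * 1)"
    using n_range assms by (intro landau_o.big.mult e_bigo_rad e_power_mono v_tube_bigo) auto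
  then show ?thesis unfolding eq by simp
qed

lemma product_f_bigo:
  "(\<lambda>z. (\<Sum>k=1..p. eps z ^ k * (dr_v k z * f_tube z))
      - (\<Sum>k=1..p. eps z ^ k * (\<Sum>i=1..<k. f_at i z * dr_v (k - i) z))) \<in> O[tube](\<lambda>z. eps z ^ (p + 1))"
proof (rule truncated_product_bigo[OF e_bigo_1 f_at_bigo v_tube_bigo(2)])
  fix k assume k: "k \<in> {1..p}"
  have "(\<lambda>z. (f_tube z - (\<Sum>i=1..<p. eps z ^ i * f_at i z)) * (eps z ^ k * dr_v k z))
     \<in> O[tube](\<lambda>z. eps z ^ p * (eps z ^ 1 * 1))"
    unfolding f_at_def using k
    by (intro landau_o.big.mult expansion_bigo_below_p f_expansion e_power_mono v_tube_bigo) auto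
  then show "(\<lambda>z. (f_tube z - (\<Sum>i=1..<p. eps z ^ i * f_at i z)) * (eps z ^ k * dr_v k z))
     \<in> O[tube](\<lambda>z. eps z ^ (p + 1))" by (simp add: mult.commute)
qed

lemma eventually_rad_nonzero: "eventually (\<lambda>z. rad z \<noteq> 0) tube"
  using eventually_tube_small[of 1] by (auto elim: eventually_mono)

text \<open>The remainder of \<open>g/r\<close> is \<open>O(e\<^sup>p / r)\<close>; the factor \<open>r\<close> from the angular derivatives of \<open>v\<close> cancels the denominator.\<close>
lemma product_g_bigo:
  "(\<lambda>z. (\<Sum>k=1..p. eps z ^ k * (dphi_v k z * (inverse (rad z) * g_tube z)))
      - (\<Sum>k=1..p. eps z ^ k * (\<Sum>i=1..<k. g_over_r i z * dphi_v (k - i) z))) \<in> O[tube](\<lambda>z. eps z ^ (p + 1))"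
proof (rule truncated_product_bigo[OF e_bigo_1 g_over_r_bigo v_tube_bigo(3)])
  fix k assume k: "k \<in> {1..p}"
  let ?g = "\<lambda>z. g_tube z"
  have eq: "inverse (rad z) * ?g z - (\<Sum>i=1..<p. eps z ^ i * g_over_r i z)
     = inverse (rad z) * (?g z - (\<Sum>i=1..<p. eps z ^ i * gk i (rad z) (ang z) (phs z)))" for z
    by (simp add: g_over_r_def algebra_simps sum_distrib_left)
  have "(\<lambda>z. inverse (rad z) * (?g z - (\<Sum>i=1..<p. eps z ^ i * gk i (rad z) (ang z) (phs z))) * (eps z ^ k * dphi_v k z))
     \<in> O[tube](\<lambda>z. inverse (rad z) * eps z ^ p * (rad z * eps z))"
    using k by (intro landau_o.big.mult expansion_bigo_below_p g_expansion rad_product_bigo) simp_all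
  also have "(\<lambda>z. inverse (rad z) * eps z ^ p * (rad z * eps z)) \<in> O[tube](\<lambda>z. eps z ^ (p + 1))"
    by (rule bigoI[of _ 1], rule eventually_mono[OF eventually_rad_nonzero]) (simp add: field_simps)
  finally show "(\<lambda>z. (inverse (rad z) * ?g z - (\<Sum>i=1..<p. eps z ^ i * g_over_r i z)) * (eps z ^ k * dphi_v k z))
     \<in> O[tube](\<lambda>z. eps z ^ (p + 1))" unfolding eq .
qed

lemma product_S_bigo:
  "(\<lambda>z. (\<Sum>k=1..p. eps z ^ k * (dS_v k z * (\<Sum>i=1..q. sigma q s i * eps z ^ i)))
      - (\<Sum>k=1..p. eps z ^ k * (\<Sum>i=1..<k. sigma q s i * dS_v (k - i) z))) \<in> O[tube](\<lambda>z. eps z ^ (p + 1))"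
proof (rule truncated_product_bigo[OF e_bigo_1 _ v_tube_bigo(4), where a = "\<lambda>i _. sigma q s i"])
  fix k assume k: "k \<in> {1..p}"
  have tail: "(\<Sum>i=1..q. sigma q s i * E ^ i) - (\<Sum>i=1..<p. E ^ i * sigma q s i)
      = (\<Sum>i\<in>{1..q} - {1..<p}. sigma q s i * E ^ i)" for E :: real
  proof -
    have "(\<Sum>i=1..<p. E ^ i * sigma q s i) = (\<Sum>i\<in>{1..q} \<inter> {1..<p}. sigma q s i * E ^ i)"
      by (rule sum.mono_neutral_cong_right) (auto simp: sigma_def)
    moreover have "(\<Sum>i=1..q. sigma q s i * E ^ i)
       = (\<Sum>i\<in>{1..q} - {1..<p}. sigma q s i * E ^ i) + (\<Sum>i\<in>{1..q} \<inter> {1..<p}. sigma q s i * E ^ i)"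
      by (subst sum.union_disjoint[symmetric]) (auto intro!: sum.cong)
    ultimately show ?thesis by simp
  qed
  have "(\<lambda>z. \<Sum>i\<in>{1..q} - {1..<p}. sigma q s i * eps z ^ i) \<in> O[tube](\<lambda>z. eps z ^ p)"
  proof (rule big_sum_in_bigo)
    fix i assume "i \<in> {1..q} - {1..<p}"
    then have "(\<lambda>z. sigma q s i * eps z ^ i) \<in> O[tube](\<lambda>z. 1 * eps z ^ p)"
      by (intro landau_o.big.mult e_power_mono) auto
    then show "(\<lambda>z. sigma q s i * eps z ^ i) \<in> O[tube](\<lambda>z. eps z ^ p)" by simp
  qed
  then have "(\<lambda>z. (\<Sum>i\<in>{1..q} - {1..<p}. sigma q s i * eps z ^ i) * (eps z ^ k * dS_v k z))
     \<in> O[tube](\<lambda>z. eps z ^ p * (eps z ^ 1 * 1))"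
    using k by (intro landau_o.big.mult e_power_mono v_tube_bigo) auto
  then show "(\<lambda>z. ((\<Sum>i=1..q. sigma q s i * eps z ^ i) - (\<Sum>i=1..<p. eps z ^ i * sigma q s i)) * (eps z ^ k * dS_v k z))
     \<in> O[tube](\<lambda>z. eps z ^ (p + 1))" unfolding tail by (simp add: mult.commute)
qed auto

lemma Lambda_lipschitz:
  assumes "k \<in> {1..N}"
  shows "(\<lambda>z. \<Lambda> k (rad z) - \<Lambda> k 0) \<in> O[tube](rad)"
proof -
  have "(\<lambda>(r, \<phi>, S). \<Lambda> k r - \<Lambda> k 0) \<in> O[zero_radius](fst)"
  proof -
    obtain L where L: "\<forall>x\<in>{-rs/2..rs/2}. \<forall>y\<in>{-rs/2..rs/2}. \<bar>\<Lambda> k x - \<Lambda> k y\<bar> \<le> L * norm (x - y)"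
      using smooth_on_lipschitz_compact[OF Lambda_smooth[OF assms], of "{-rs/2..rs/2}"] rs_pos by auto
    show ?thesis
    proof (rule bigoI[of _ L], rule eventually_mono[OF eventually_zero_radius[of "rs/2"]])
      fix z :: "real \<times> real \<times> real"
      assume "case z of (r, \<phi>, S) \<Rightarrow> r \<noteq> 0 \<and> \<bar>r\<bar> < rs / 2"
      then have "\<bar>fst z\<bar> < rs / 2" by auto
      then have "fst z \<in> {-rs/2..rs/2}" "0 \<in> {-rs/2..rs/2}" by auto
      then have "\<bar>\<Lambda> k (fst z) - \<Lambda> k 0\<bar> \<le> L * norm (fst z - 0)" by (rule L[THEN bspec, THEN bspec])
      then show "norm (case z of (r, \<phi>, S) \<Rightarrow> \<Lambda> k r - \<Lambda> k 0) \<le> L * norm (fst z)"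
        by (simp add: case_prod_unfold)
    qed (use rs_pos in simp)
  qed
  from tube_pullback[OF this] show ?thesis by simp
qed

lemma Lambda_n_quadratic: "(\<lambda>z. \<Lambda> n (rad z) - lam * rad z) \<in> O[tube](\<lambda>z. rad z * rad z)"
proof -
  obtain h where h: "h \<in> O[at 0](\<lambda>\<rho>. \<bar>\<rho>\<bar>)" "\<forall>\<rho>. \<bar>\<rho>\<bar> \<le> rs \<longrightarrow> \<Lambda> n \<rho> = \<rho> * (lam + h \<rho>)"
    using Lambda_n by blast
  have "filterlim rad (at 0) tube"
    using filterlim_tube_punctured unfolding zero_radius_def filterlim_filtercomap_iff by (simp add: o_def)
  from landau_o.big.compose[OF h(1) this] have "(\<lambda>z. h (rad z)) \<in> O[tube](rad)" by simp
  then have *: "(\<lambda>z. rad z * h (rad z)) \<in> O[tube](\<lambda>z. rad z * rad z)" by (intro landau_o.big.mult) simp_all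
  have "eventually (\<lambda>z. \<Lambda> n (rad z) - lam * rad z = rad z * h (rad z)) tube"
    by (rule eventually_mono[OF eventually_tube_small[OF rs_pos]]) (simp add: h(2) algebra_simps)
  then show ?thesis using * by (rule tube_bigo_cong)
qed

text \<open>Up to order \<open>n\<close> the Taylor terms vanish; beyond it, \<open>e\<^bsup>n+1\<^esup> r\<close> has order \<open>n + 1 + (p - n)\<close>.\<close>
lemma taylor_at_bigo:
  assumes "k \<in> {1..p}"
  shows "(\<lambda>z. eps z ^ k * taylor_at k z) \<in> O[tube](\<lambda>z. eps z ^ (p + 1))"
proof (cases "k \<le> n")
  case True
  have "eventually (\<lambda>z. eps z ^ k * taylor_at k z = 0) tube"
  proof (rule eventually_mono[OF eventually_tube_small[OF rs_pos]])
    fix z assume "rad z \<noteq> 0 \<and> \<bar>rad z\<bar> < rs"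
    then have "taylor_at k z = 0"
      unfolding taylor_at_def using True by (intro taylor_coeff_zero[of n rs]) (auto intro: Lambda_below_n)
    then show "eps z ^ k * taylor_at k z = 0" by simp
  qed
  then show ?thesis by (rule tube_zero_bigo)
next
  case False
  have "v i 0 \<phi> S = 0" if "1 \<le> i" "i < k" for i \<phi> S
    by (rule v_vanishes_at_zero) (use that assms in auto)
  from tube_pullback[OF taylor_bigo[OF index_range[OF assms] this]]
  have "taylor_at k \<in> O[tube](rad)" by (simp add: taylor_at_def[abs_def])
  then have "taylor_at k \<in> O[tube](\<lambda>z. eps z ^ (p - n))" using rad_bigo by (rule landau_o.big.trans)
  then have "(\<lambda>z. eps z ^ k * taylor_at k z) \<in> O[tube](\<lambda>z. eps z ^ (n + 1) * eps z ^ (p - n))"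
    using False by (intro landau_o.big.mult e_power_mono) auto
  then show ?thesis using n_range by (simp add: power_add[symmetric] del: power_Suc)
qed

text \<open>Counting powers with \<open>r\<close> of order \<open>e\<^bsup>p-n\<^esup>\<close>: the quadratic part of \<open>\<Lambda> n\<close> has order \<open>2 p - n \<ge> p + 1\<close>, and each \<open>\<Lambda> k\<close> with \<open>n < k \<le> p\<close> differs from its value at \<open>0\<close> by terms of order \<open>k + p - n\<close>. That value is \<open>0\<close> unless \<open>k = p\<close>.\<close>
lemma main_sum_bigo:
  "(\<lambda>z. (\<Sum>k=1..p. eps z ^ k * (\<Lambda> k (rad z) + taylor_at k z)) - (lam * eps z ^ n * rad z + eps z ^ p * \<Lambda> p 0))
     \<in> O[tube](\<lambda>z. eps z ^ (p + 1))"
proof -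
  define lead where "lead k z = (if k = n then lam * rad z else if k = p then \<Lambda> p 0 else 0)" for k z
  have lead_sum: "(\<Sum>k=1..p. eps z ^ k * lead k z) = lam * eps z ^ n * rad z + eps z ^ p * \<Lambda> p 0" for z
  proof -
    have "(\<Sum>k=1..p. eps z ^ k * lead k z) = (\<Sum>k\<in>{n, p}. eps z ^ k * lead k z)"
      by (rule sum.mono_neutral_right) (use n_range in \<open>auto simp: lead_def\<close>)
    then show ?thesis using n_range by (simp add: lead_def)
  qed
  have *: "(\<lambda>z. eps z ^ k * (\<Lambda> k (rad z) - lead k z)) \<in> O[tube](\<lambda>z. eps z ^ (p + 1))" if k: "k \<in> {1..p}" for k
  proof -
    consider "k < n" | "k = n" | "n < k" by linarith
    then show ?thesis
    proof cases
      case 1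
      have "eventually (\<lambda>z. eps z ^ k * (\<Lambda> k (rad z) - lead k z) = 0) tube"
        by (rule eventually_mono[OF eventually_tube_small[OF rs_pos]])
           (use 1 k n_range Lambda_below_n in \<open>auto simp: lead_def\<close>)
      then show ?thesis by (rule tube_zero_bigo)
    next
      case 2
      have "(\<lambda>z. eps z ^ n * (\<Lambda> n (rad z) - lam * rad z)) \<in> O[tube](\<lambda>z. eps z ^ n * (rad z * rad z))"
        by (intro landau_o.big.mult Lambda_n_quadratic) simp
      also have "(\<lambda>z. eps z ^ n * (rad z * rad z)) \<in> O[tube](\<lambda>z. eps z ^ n * (eps z ^ (p - n) * eps z ^ (p - n)))"
        by (intro landau_o.big.mult rad_bigo) simp
      also have "(\<lambda>z. eps z ^ n * (eps z ^ (p - n) * eps z ^ (p - n))) \<in> O[tube](\<lambda>z. eps z ^ (p + 1))"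
        unfolding power_add[symmetric] by (rule e_power_mono) (use n_range in auto)
      finally show ?thesis using 2 by (simp add: lead_def)
    next
      case 3
      have "lead k z = \<Lambda> k 0" for z
        using 3 k Lambda_below_p_at_zero[of k] by (auto simp: lead_def)
      then have "(\<lambda>z. eps z ^ k * (\<Lambda> k (rad z) - lead k z)) \<in> O[tube](\<lambda>z. eps z ^ (n + 1) * rad z)"
        using 3 k by (simp only:) (intro landau_o.big.mult e_power_mono Lambda_lipschitz index_range, auto)
      also have "(\<lambda>z. eps z ^ (n + 1) * rad z) \<in> O[tube](\<lambda>z. eps z ^ (n + 1) * eps z ^ (p - n))"
        by (intro landau_o.big.mult rad_bigo) simp
      finally show ?thesis using n_range by (simp add: power_add[symmetric] del: power_Suc)
    qed
  qed
  have "(\<lambda>z. (\<Sum>k=1..p. eps z ^ k * (\<Lambda> k (rad z) - lead k z)) + (\<Sum>k=1..p. eps z ^ k * taylor_at k z))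
     \<in> O[tube](\<lambda>z. eps z ^ (p + 1))"
    by (intro sum_in_bigo big_sum_in_bigo * taylor_at_bigo)
  then show ?thesis
    unfolding lead_sum[symmetric] by (simp add: algebra_simps sum.distrib sum_subtractf)
qed

text \<open>An exact identity: the homological equations replace the terms of order \<open>k \<le> p\<close> by \<open>\<Lambda> k\<close> plus the Taylor terms, and everything else is grouped into the five truncation errors estimated above.\<close>
lemma drift_decomposition:
  assumes "rad z \<noteq> 0" "\<bar>rad z\<bar> < rs"
  shows "drift (fst z) (rad z) (ang z) =
     (f_tube z - (\<Sum>i=1..p. eps z ^ i * f_at i z))
   + ((\<Sum>k=1..p. eps z ^ k * (dr_v k z * f_tube z))
      - (\<Sum>k=1..p. eps z ^ k * (\<Sum>i=1..<k. f_at i z * dr_v (k - i) z)))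
   + ((\<Sum>k=1..p. eps z ^ k * (dphi_v k z * (inverse (rad z) * g_tube z)))
      - (\<Sum>k=1..p. eps z ^ k * (\<Sum>i=1..<k. g_over_r i z * dphi_v (k - i) z)))
   + ((\<Sum>k=1..p. eps z ^ k * (dS_v k z * (\<Sum>i=1..q. sigma q s i * eps z ^ i)))
      - (\<Sum>k=1..p. eps z ^ k * (\<Sum>i=1..<k. sigma q s i * dS_v (k - i) z)))
   - ((\<Sum>k=1..p. eps z ^ k * (if k > q then (1 - real k / real q) * v_at (k - q) z else 0))
            + (\<Sum>k=1..p. real k / real q * eps z ^ (k + q) * v_at k z))
   + (\<Sum>k=1..p. eps z ^ k * (\<Lambda> k (rad z) + taylor_at k z))"
proof -
  define E F G D where "E = eps z" and "F = f_tube z"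
    and "G = inverse (rad z) * g_tube z" and "D = (\<Sum>i=1..q. sigma q s i * E ^ i)"
  have hom: "\<Lambda> k (rad z) + taylor_at k z = f_at k z + \<omega> (rad z) * dphi_v k z + s 0 * dS_v k z
      + (if k > q then (1 - real k / real q) * v_at (k - q) z else 0)
      + ((\<Sum>i=1..<k. f_at i z * dr_v (k - i) z) + (\<Sum>i=1..<k. g_over_r i z * dphi_v (k - i) z) + (\<Sum>i=1..<k. sigma q s i * dS_v (k - i) z))"
    if "k \<in> {1..p}" for k
    using v_equation[OF index_range[OF that], of "rad z" "phs z" "ang z"] assms
    unfolding homological_rhs_def averaging_R_def sum.distrib[symmetric]
    unfolding f_at_def g_over_r_def v_at_def dr_v_def dphi_v_def dS_v_def taylor_at_def by simp
  have main: "(\<Sum>k=1..p. E ^ k * (\<Lambda> k (rad z) + taylor_at k z)) = (\<Sum>k=1..p. E ^ k * f_at k z) + (\<Sum>k=1..p. E ^ k * (\<omega> (rad z) * dphi_v k z + s 0 * dS_v k z))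
      + (\<Sum>k=1..p. E ^ k * (if k > q then (1 - real k / real q) * v_at (k - q) z else 0))
      + (\<Sum>k=1..p. E ^ k * (\<Sum>i=1..<k. f_at i z * dr_v (k - i) z))
      + (\<Sum>k=1..p. E ^ k * (\<Sum>i=1..<k. g_over_r i z * dphi_v (k - i) z))
      + (\<Sum>k=1..p. E ^ k * (\<Sum>i=1..<k. sigma q s i * dS_v (k - i) z))"
    by (simp only: hom sum.distrib distrib_left add.assoc cong: sum.cong)
  have "drift (fst z) (rad z) (ang z) = F + (\<Sum>k=1..p. E ^ k * (dr_v k z * F + dphi_v k z * (\<omega> (rad z) + G) + dS_v k z * (s 0 + D))
     - real k / real q * E ^ (k + q) * v_at k z)"
    by (simp add: drift_def v_at_def dr_v_def dphi_v_def dS_v_def E_def F_def G_def D_def)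
  also have "\<dots> = F + ((\<Sum>k=1..p. E ^ k * (dr_v k z * F)) + (\<Sum>k=1..p. E ^ k * (dphi_v k z * G)) + (\<Sum>k=1..p. E ^ k * (dS_v k z * D))
     + (\<Sum>k=1..p. E ^ k * (\<omega> (rad z) * dphi_v k z + s 0 * dS_v k z)) - (\<Sum>k=1..p. real k / real q * E ^ (k + q) * v_at k z))"
    unfolding sum.distrib[symmetric] sum_subtractf[symmetric]
    by (intro arg_cong2[where f = "(+)"] refl sum.cong) (simp add: algebra_simps)
  finally show ?thesis
    using main unfolding E_def[symmetric] F_def[symmetric] G_def[symmetric] D_def[symmetric] by linarith
qed

text \<open>The averaged equation in the tube: linear damping with rate \<open>lam\<close> at order \<open>n\<close> and constant forcing at order \<open>p\<close>, which have the same size for \<open>r\<close> of order \<open>e\<^bsup>p-n\<^esup>\<close>.\<close>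
lemma drift_bigo:
  "(\<lambda>z. drift (fst z) (rad z) (ang z) - (lam * eps z ^ n * rad z + eps z ^ p * \<Lambda> p 0))
     \<in> O[tube](\<lambda>z. eps z ^ (p + 1))"
proof -
  have f: "(\<lambda>z. f_tube z - (\<Sum>i=1..p. eps z ^ i * f_at i z)) \<in> O[tube](\<lambda>z. eps z ^ (p + 1))"
    unfolding f_at_def by (rule expansion_bigo[OF f_expansion])
  note parts = sum_in_bigo(1)[OF sum_in_bigo(2)[OF sum_in_bigo(1)[OF sum_in_bigo(1)[OF sum_in_bigo(1)[OF f product_f_bigo]
      product_g_bigo] product_S_bigo] shifted_sum_bigo[where b = v_at, OF e_bigo_1 q_pos v_tube_bigo(1)]] main_sum_bigo]
  show ?thesis
    by (rule landau_o.big.in_cong[THEN iffD2, OF _ parts], rule eventually_mono[OF eventually_tube_small[OF rs_pos]],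
        subst drift_decomposition) (simp, simp, linarith)
qed

section \<open>The rescaled averaged radius\<close>

abbreviation avg_radius :: "real \<Rightarrow> real \<Rightarrow> real \<Rightarrow> real" where
  "avg_radius \<equiv> near_identity q s p v"

lemma near_identity_has_derivative:
  assumes "t > 0" "\<bar>r t\<bar> < rs"
    and r: "(r has_real_derivative f (r t) (\<phi> t) (phase q s t) t) (at t)"
    and \<phi>: "(\<phi> has_real_derivative \<omega> (r t) + inverse (r t) * g (r t) (\<phi> t) (phase q s t) t) (at t)"
  shows "((\<lambda>t. avg_radius (r t) (\<phi> t) t) has_real_derivative drift t (r t) (\<phi> t)) (at t)"
proof -
  define r' \<phi>' S' where "r' = f (r t) (\<phi> t) (phase q s t) t"
    and "\<phi>' = \<omega> (r t) + inverse (r t) * g (r t) (\<phi> t) (phase q s t) t"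
    and "S' = s 0 + (\<Sum>i=1..q. sigma q s i * e t ^ i)"
  have S: "(phase q s has_real_derivative S') (at t)"
    unfolding S'_def by (rule phase_has_derivative) (use assms(1) q_pos in auto)
  define v' where "v' k = deriv (\<lambda>x. v k x (\<phi> t) (phase q s t)) (r t) * r' + deriv (\<lambda>x. v k (r t) x (phase q s t)) (\<phi> t) * \<phi>'
      + deriv (\<lambda>x. v k (r t) (\<phi> t) x) (phase q s t) * S'" for k
  have vk: "((\<lambda>t. v k (r t) (\<phi> t) (phase q s t)) has_real_derivative v' k) (at t)" if k: "k \<in> {1..p}" for k
  proof -
    have "((\<lambda>t. (r t, \<phi> t, phase q s t)) has_derivative (\<lambda>h. (r' * h, \<phi>' * h, S' * h))) (at t)"
      using r \<phi> S unfolding has_field_derivative_def r'_def \<phi>'_def by (intro has_derivative_Pair)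
    from has_derivative_compose[OF this cylinder_total_derivative(1)[OF v_smooth_cylinder[OF index_range[OF k]] assms(2)]]
    have "((\<lambda>t. v k (r t) (\<phi> t) (phase q s t)) has_derivative
      (\<lambda>h. deriv (\<lambda>x. v k x (\<phi> t) (phase q s t)) (r t) * (r' * h) + deriv (\<lambda>x. v k (r t) x (phase q s t)) (\<phi> t) * (\<phi>' * h)
      + deriv (\<lambda>x. v k (r t) (\<phi> t) x) (phase q s t) * (S' * h))) (at t)" by simp
    moreover have "(\<lambda>h. D1 * (r' * h) + D2 * (\<phi>' * h) + D3 * (S' * h)) = (*) (D1 * r' + D2 * \<phi>' + D3 * S')" for D1 D2 D3
      by (rule ext) (simp add: algebra_simps)
    ultimately show ?thesis by (simp only: has_field_derivative_def v'_def)
  qed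
  have pw: "((\<lambda>t. t powr (- (real k / real q))) has_real_derivative - (real k / real q) * e t ^ (k + q)) (at t)" for k
  proof -
    have "((\<lambda>t. t powr (- (real k / real q))) has_real_derivative (- (real k / real q)) * t powr (- (real k / real q) - 1)) (at t)"
      using assms(1) by (rule has_real_derivative_powr)
    moreover have "t powr (- (real k / real q) - 1) = e t ^ (k + q)"
      using assms(1) q_pos by (simp add: small_parameter_power add_divide_distrib)
    ultimately show ?thesis by simp
  qed
  have "((\<lambda>t. r t + (\<Sum>k=1..p. t powr (- (real k / real q)) * v k (r t) (\<phi> t) (phase q s t))) has_real_derivative
     r' + (\<Sum>k=1..p. t powr (- (real k / real q)) * v' k + (- (real k / real q) * e t ^ (k + q)) * v k (r t) (\<phi> t) (phase q s t))) (at t)"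
    by (intro DERIV_add DERIV_sum DERIV_mult' vk pw r[folded r'_def])
  moreover have "drift t (r t) (\<phi> t) = r' + (\<Sum>k=1..p. t powr (- (real k / real q)) * v' k + (- (real k / real q) * e t ^ (k + q)) * v k (r t) (\<phi> t) (phase q s t))"
    unfolding drift_def v'_def r'_def[symmetric] \<phi>'_def[symmetric] S'_def[symmetric]
    using assms(1) by (simp add: small_parameter_power)
  ultimately show ?thesis by (simp add: near_identity_def[abs_def])
qed

definition avg :: "real \<times> real \<times> real \<Rightarrow> real" where
  "avg z = avg_radius (rad z) (ang z) (fst z)"

lemma near_identity_bigo: "(\<lambda>z. avg z - rad z) \<in> O[tube](\<lambda>z. eps z ^ (p - n + 1))"
proof -
  have "(\<lambda>z. eps z ^ k * v_at k z) \<in> O[tube](\<lambda>z. eps z ^ (p - n + 1))" if k: "k \<in> {1..p}" for k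
  proof (cases "k < p")
    case True
    have "v_at k \<in> O[tube](\<lambda>z. eps z ^ (p - n))"
      by (rule landau_o.big.trans[OF v_tube_bigo_rad(1) rad_bigo]) (use k True in auto)
    then have "(\<lambda>z. eps z ^ k * v_at k z) \<in> O[tube](\<lambda>z. eps z ^ 1 * eps z ^ (p - n))"
      using k by (intro landau_o.big.mult e_power_mono) auto
    then show ?thesis by (simp add: mult.commute)
  next
    case False
    have "(\<lambda>z. eps z ^ k * v_at k z) \<in> O[tube](\<lambda>z. eps z ^ (p - n + 1) * 1)"
      using k False n_range by (intro landau_o.big.mult e_power_mono v_tube_bigo) auto
    then show ?thesis by simp
  qed
  then have "(\<lambda>z. \<Sum>k=1..p. eps z ^ k * v_at k z) \<in> O[tube](\<lambda>z. eps z ^ (p - n + 1))"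
    by (rule big_sum_in_bigo)
  moreover have "eventually (\<lambda>z. avg z - rad z = (\<Sum>k=1..p. eps z ^ k * v_at k z)) tube"
    by (rule eventually_mono[OF eventually_tube_pos]) (simp add: avg_def near_identity_def v_at_def small_parameter_power)
  ultimately show ?thesis by (rule tube_bigo_cong[rotated])
qed

lemma powr_nu_cancel: "t > 0 \<Longrightarrow> t powr \<nu> * e t ^ (p - n) = 1"
  by (simp add: powr_nu_eq[symmetric] powr_add[symmetric])

lemma powr_nu_rad: "fst z > 0 \<Longrightarrow> fst z powr \<nu> * rad z = fst (snd z)"
  by (simp add: rad_def mult.assoc[symmetric] powr_add[symmetric])

lemma rescale_bigo:
  assumes "X \<in> O[tube](\<lambda>z. eps z ^ (p - n + j))"
  shows "(\<lambda>z. fst z powr \<nu> * X z) \<in> O[tube](\<lambda>z. eps z ^ j)"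
proof -
  have "(\<lambda>z. fst z powr \<nu> * X z) \<in> O[tube](\<lambda>z. fst z powr \<nu> * eps z ^ (p - n + j))"
    by (intro landau_o.big.mult assms) simp
  also have "(\<lambda>z. fst z powr \<nu> * eps z ^ (p - n + j)) \<in> O[tube](\<lambda>z. eps z ^ j)"
    by (rule bigoI[of _ 1], rule eventually_mono[OF eventually_tube_pos])
       (simp add: power_add mult.assoc[symmetric] powr_nu_cancel)
  finally show ?thesis .
qed

lemma deviation_bigo: "(\<lambda>z. fst z powr \<nu> * avg z - fst (snd z)) \<in> O[tube](\<lambda>z. eps z ^ 1)"
proof -
  have "(\<lambda>z. fst z powr \<nu> * (avg z - rad z)) \<in> O[tube](\<lambda>z. eps z ^ 1)"
    by (rule rescale_bigo[OF near_identity_bigo])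
  moreover have "eventually (\<lambda>z. fst z powr \<nu> * avg z - fst (snd z) = fst z powr \<nu> * (avg z - rad z)) tube"
    by (rule eventually_mono[OF eventually_tube_pos]) (simp add: right_diff_distrib powr_nu_rad)
  ultimately show ?thesis by (rule tube_bigo_cong[rotated])
qed

text \<open>The time derivative of \<open>t powr \<nu> * avg_radius r \<phi> t\<close> along the perturbed system.\<close>
definition scaled_drift :: "real \<Rightarrow> real \<Rightarrow> real \<Rightarrow> real" where
  "scaled_drift t r \<phi> = \<nu> * t powr (\<nu> - 1) * avg_radius r \<phi> t + t powr \<nu> * drift t r \<phi>"

text \<open>Differentiating the factor \<open>t powr \<nu>\<close> contributes \<open>\<nu>/t\<close> times the rescaled radius, which has order \<open>q\<close>. It is comparable with the damping exactly when \<open>n = q\<close>; this is the additional \<open>\<nu>\<close> in \<open>d\<close>. The choice of \<open>x0\<close> cancels the constant forcing.\<close>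
lemma scaled_drift_bigo:
  "(\<lambda>z. scaled_drift (fst z) (rad z) (ang z) - eps z ^ n * (d * (fst z powr \<nu> * avg z - x0)))
     \<in> O[tube](\<lambda>z. eps z ^ (n + 1))"
proof -
  define y where "y z = fst z powr \<nu> * avg z" for z
  define err where "err z = drift (fst z) (rad z) (ang z) - (lam * eps z ^ n * rad z + eps z ^ p * \<Lambda> p 0)" for z
  have err: "err \<in> O[tube](\<lambda>z. eps z ^ (p - n + (n + 1)))"
    using drift_bigo n_range unfolding err_def[abs_def] by simp
  have dev: "(\<lambda>z. y z - fst (snd z)) \<in> O[tube](\<lambda>z. eps z ^ 1)"
    unfolding y_def by (rule deviation_bigo)
  have y1: "y \<in> O[tube](\<lambda>_. 1)"
  proof -
    have "(\<lambda>z. y z - fst (snd z)) \<in> O[tube](\<lambda>z. eps z ^ 0)"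
      by (rule landau_o.big.trans[OF dev e_power_mono]) simp
    then have "(\<lambda>z. (y z - fst (snd z)) + fst (snd z)) \<in> O[tube](\<lambda>_. 1)"
      by (intro sum_in_bigo(1)[OF _ x_bigo_1]) simp
    then show ?thesis by (simp only: diff_add_cancel)
  qed
  have last: "(\<lambda>z. if n = q then 0 else \<nu> * eps z ^ q * y z) \<in> O[tube](\<lambda>z. eps z ^ (n + 1))"
  proof (cases "n = q")
    case False
    have "(\<lambda>z. \<nu> * eps z ^ q * y z) \<in> O[tube](\<lambda>z. 1 * eps z ^ (n + 1) * 1)"
      using False n_range by (intro landau_o.big.mult e_power_mono y1) auto
    then show ?thesis using False by simp
  qed simp
  have "(\<lambda>z. eps z ^ n * lam * (y z - fst (snd z))) \<in> O[tube](\<lambda>z. eps z ^ n * 1 * eps z ^ 1)"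
    by (intro landau_o.big.mult dev) auto
  then have mid: "(\<lambda>z. eps z ^ n * lam * (y z - fst (snd z))) \<in> O[tube](\<lambda>z. eps z ^ (n + 1))"
    by (simp add: mult.commute)
  have total: "(\<lambda>z. fst z powr \<nu> * err z - eps z ^ n * lam * (y z - fst (snd z)) + (if n = q then 0 else \<nu> * eps z ^ q * y z))
     \<in> O[tube](\<lambda>z. eps z ^ (n + 1))"
    by (intro sum_in_bigo rescale_bigo[OF err] mid last)
  have "eventually (\<lambda>z. scaled_drift (fst z) (rad z) (ang z) - eps z ^ n * (d * (y z - x0))
     = fst z powr \<nu> * err z - eps z ^ n * lam * (y z - fst (snd z)) + (if n = q then 0 else \<nu> * eps z ^ q * y z)) tube"
  proof (rule eventually_mono[OF eventually_tube_pos])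
    fix z :: "real \<times> real \<times> real" assume t: "fst z > 0"
    have "fst z powr (\<nu> - 1) = eps z ^ q * fst z powr \<nu>"
      using t q_pos by (simp add: small_parameter_power powr_diff powr_minus field_simps)
    then have 1: "\<nu> * fst z powr (\<nu> - 1) * avg_radius (rad z) (ang z) (fst z) = \<nu> * eps z ^ q * y z"
      by (simp add: y_def avg_def)
    have "eps z ^ p = eps z ^ (p - n) * eps z ^ n"
      using n_range by (simp add: power_add[symmetric])
    then have 2: "fst z powr \<nu> * (eps z ^ p * \<Lambda> p 0) = eps z ^ n * \<Lambda> p 0"
      using powr_nu_cancel[OF t] by (simp add: mult.assoc[symmetric])
    have 3: "fst z powr \<nu> * (lam * eps z ^ n * rad z) = lam * eps z ^ n * fst (snd z)"
      using powr_nu_rad[OF t] by (metis mult.assoc mult.commute)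
    have "fst z powr \<nu> * drift (fst z) (rad z) (ang z) = fst z powr \<nu> * err z + lam * eps z ^ n * fst (snd z) + eps z ^ n * \<Lambda> p 0"
      unfolding 2[symmetric] 3[symmetric] by (simp add: err_def algebra_simps)
    then have 4: "scaled_drift (fst z) (rad z) (ang z)
       = \<nu> * eps z ^ q * y z + (fst z powr \<nu> * err z + lam * eps z ^ n * fst (snd z) + eps z ^ n * \<Lambda> p 0)"
      unfolding scaled_drift_def 1 by simp
    have dx0: "d * x0 = - \<Lambda> p 0" using d_neg by (simp add: x0_def)
    have 5: "eps z ^ n * (d * (y z - x0)) = eps z ^ n * (d * y z + \<Lambda> p 0)"
      using dx0 by (simp add: right_diff_distrib)
    show "scaled_drift (fst z) (rad z) (ang z) - eps z ^ n * (d * (y z - x0))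
     = fst z powr \<nu> * err z - eps z ^ n * lam * (y z - fst (snd z)) + (if n = q then 0 else \<nu> * eps z ^ q * y z)"
      unfolding 4 5 by (cases "n = q") (simp_all add: d_eq algebra_simps)
  qed
  from tube_bigo_cong[OF this total] show ?thesis by (simp only: y_def)
qed

text \<open>The coefficients below \<open>p\<close> are \<open>O(r)\<close>, and the remainder \<open>O(e\<^sup>p / r)\<close> is \<open>O(e\<^sup>n)\<close> in the tube.\<close>
lemma angular_perturbation_bigo:
  "(\<lambda>z. inverse (rad z) * g_tube z) \<in> O[tube](\<lambda>z. eps z ^ 1)"
proof -
  have "(\<lambda>z. inverse (rad z) * (g_tube z - (\<Sum>i=1..<p. eps z ^ i * gk i (rad z) (ang z) (phs z))))
     \<in> O[tube](\<lambda>z. inverse (rad z) * eps z ^ p)"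
    by (intro landau_o.big.mult expansion_bigo_below_p g_expansion) simp
  also have "(\<lambda>z. inverse (rad z) * eps z ^ p) \<in> O[tube](\<lambda>z. eps z ^ n)"
  proof -
    have "(\<lambda>z. inverse (rad z) * eps z ^ (p - n) * eps z ^ n) \<in> O[tube](\<lambda>z. inverse (rad z) * rad z * eps z ^ n)"
      by (intro landau_o.big.mult e_bigo_rad) simp_all
    also have "(\<lambda>z. inverse (rad z) * rad z * eps z ^ n) \<in> O[tube](\<lambda>z. eps z ^ n)"
      by (rule bigoI[of _ 1], rule eventually_mono[OF eventually_rad_nonzero]) simp
    finally show ?thesis using n_range by (simp add: mult.assoc power_add[symmetric])
  qed
  also have "(\<lambda>z. eps z ^ n) \<in> O[tube](\<lambda>z. eps z ^ 1)" by (rule e_power_mono) (use n_range in auto)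
  finally have rem: "(\<lambda>z. inverse (rad z) * (g_tube z - (\<Sum>i=1..<p. eps z ^ i * gk i (rad z) (ang z) (phs z))))
     \<in> O[tube](\<lambda>z. eps z ^ 1)" .
  have "(\<lambda>z. eps z ^ i * g_over_r i z) \<in> O[tube](\<lambda>z. eps z ^ 1 * 1)" if "i \<in> {1..<p}" for i
    using that by (intro landau_o.big.mult e_power_mono g_over_r_bigo) auto
  then have "(\<lambda>z. \<Sum>i=1..<p. eps z ^ i * g_over_r i z) \<in> O[tube](\<lambda>z. eps z ^ 1)"
    by (intro big_sum_in_bigo) simp
  from sum_in_bigo(1)[OF rem this] show ?thesis
    by (simp add: g_over_r_def right_diff_distrib sum_distrib_left mult_ac)
qed

lemma tube_small_relative:
  assumes "X \<in> O[tube](\<lambda>z. eps z ^ (j + 1))" "\<kappa> > 0"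
  shows "eventually (\<lambda>z. \<bar>X z\<bar> \<le> \<kappa> * eps z ^ j) tube"
proof -
  have "(\<lambda>z. eps z ^ j * eps z) \<in> o[tube](\<lambda>z. eps z ^ j * 1)"
    by (intro landau_o.big_small_mult smalloI_tendsto) (use e_tendsto in auto)
  then have "X \<in> o[tube](\<lambda>z. eps z ^ j)"
    using landau_o.big_small_trans[OF assms(1), of "\<lambda>z. eps z ^ j"] by (simp add: mult.commute)
  from landau_o.smallD[OF this assms(2)] show ?thesis
    using eventually_tube_pos by eventually_elim (simp add: small_parameter_pos less_imp_le)
qed

abbreviation in_tube :: "real \<Rightarrow> real \<Rightarrow> bool" where
  "in_tube t r \<equiv> \<bar>t powr \<nu> * r - x0\<bar> \<le> \<bar>x0\<bar> / 2"

text \<open>What the analysis of solutions needs to know about a point of the tube, with one accuracy \<open>\<kappa>\<close> for all estimates.\<close>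
abbreviation controlled :: "real \<Rightarrow> real \<Rightarrow> real \<Rightarrow> real \<Rightarrow> bool" where
  "controlled \<kappa> t r \<phi> \<equiv>
     r \<noteq> 0 \<and> \<bar>r\<bar> < rs \<and> \<bar>r\<bar> \<le> \<kappa>
     \<and> \<bar>t powr \<nu> * avg_radius r \<phi> t - t powr \<nu> * r\<bar> \<le> \<kappa>
     \<and> \<bar>scaled_drift t r \<phi> - e t ^ n * (d * (t powr \<nu> * avg_radius r \<phi> t - x0))\<bar> \<le> \<kappa> * e t ^ n
     \<and> \<bar>inverse r * g r \<phi> (phase q s t) t\<bar> \<le> \<kappa>"

lemma tube_estimates:
  assumes "\<kappa> > 0"
  shows "\<exists>T>0. \<forall>t\<ge>T. \<forall>r \<phi>. in_tube t r \<longrightarrow>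
     controlled \<kappa> t r \<phi>"
proof -
  have "eventually (\<lambda>z. (rad z \<noteq> 0 \<and> \<bar>rad z\<bar> < rs) \<and> (rad z \<noteq> 0 \<and> \<bar>rad z\<bar> < \<kappa>) \<and>
     \<bar>fst z powr \<nu> * avg z - fst (snd z)\<bar> \<le> \<kappa> * eps z ^ 0 \<and>
     \<bar>scaled_drift (fst z) (rad z) (ang z) - eps z ^ n * (d * (fst z powr \<nu> * avg z - x0))\<bar> \<le> \<kappa> * eps z ^ n \<and>
     \<bar>inverse (rad z) * g_tube z\<bar> \<le> \<kappa> * eps z ^ 0) tube"
    using deviation_bigo angular_perturbation_bigo
    by (intro eventually_conj eventually_tube_small rs_pos assms tube_small_relative scaled_drift_bigo) simp_all
  then obtain T where T: "\<forall>t\<ge>T. \<forall>x \<phi>. \<bar>x - x0\<bar> \<le> \<bar>x0\<bar> / 2 \<longrightarrow>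
     ((rad (t, x, \<phi>) \<noteq> 0 \<and> \<bar>rad (t, x, \<phi>)\<bar> < rs) \<and> (rad (t, x, \<phi>) \<noteq> 0 \<and> \<bar>rad (t, x, \<phi>)\<bar> < \<kappa>) \<and>
     \<bar>t powr \<nu> * avg (t, x, \<phi>) - x\<bar> \<le> \<kappa> \<and>
     \<bar>scaled_drift t (rad (t, x, \<phi>)) \<phi> - e t ^ n * (d * (t powr \<nu> * avg (t, x, \<phi>) - x0))\<bar> \<le> \<kappa> * e t ^ n \<and>
     \<bar>inverse (rad (t, x, \<phi>)) * g (rad (t, x, \<phi>)) \<phi> (phase q s t) t\<bar> \<le> \<kappa>)"
    unfolding eventually_tube by (elim exE) (rule that, simp)
  show ?thesis
  proof (intro exI[of _ "max T 1"] conjI allI impI)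
    fix t r \<phi> :: real assume t: "t \<ge> max T 1" and x: "in_tube t r"
    have tp: "t > 0" "t \<ge> T" using t by auto
    have rad: "rad (t, t powr \<nu> * r, \<phi>) = r"
      using tp by (simp add: rad_def mult.assoc[symmetric] powr_add[symmetric])
    note * = T[rule_format, OF tp(2) x, of \<phi>, unfolded avg_def rad, unfolded fst_conv snd_conv]
    show "r \<noteq> 0" "\<bar>r\<bar> < rs" "\<bar>r\<bar> \<le> \<kappa>"
      "\<bar>t powr \<nu> * avg_radius r \<phi> t - t powr \<nu> * r\<bar> \<le> \<kappa>"
      "\<bar>scaled_drift t r \<phi> - e t ^ n * (d * (t powr \<nu> * avg_radius r \<phi> t - x0))\<bar> \<le> \<kappa> * e t ^ n"
      "\<bar>inverse r * g r \<phi> (phase q s t) t\<bar> \<le> \<kappa>"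
      using * by auto
  qed simp
qed

section \<open>Trapping\<close>

lemma near_identity_continuous_on:
  assumes "continuous_on A r" "continuous_on A \<phi>" "\<And>t. t \<in> A \<Longrightarrow> t > 0 \<and> \<bar>r t\<bar> < rs"
  shows "continuous_on A (\<lambda>t. avg_radius (r t) (\<phi> t) t)"
proof -
  have ph: "continuous_on A (phase q s)"
    unfolding phase_def[abs_def] using assms(3) by (intro continuous_intros) force+
  have vk: "continuous_on A (\<lambda>t. v k (r t) (\<phi> t) (phase q s t))" if "k \<in> {1..p}" for k
  proof -
    have "continuous_on A (\<lambda>t. (\<lambda>(r, \<phi>, S). v k r \<phi> S) (r t, \<phi> t, phase q s t))"
      by (rule continuous_on_compose2[OF smooth_on_imp_continuous_on[OF v_smooth_cylinder[OF index_range[OF that]]]])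
         (use assms ph in \<open>auto intro!: continuous_intros\<close>)
    then show ?thesis by simp
  qed
  show ?thesis
    unfolding near_identity_def using assms vk by (intro continuous_intros) force+
qed

abbreviation solves_at :: "(real \<Rightarrow> real) \<Rightarrow> (real \<Rightarrow> real) \<Rightarrow> real \<Rightarrow> bool" where
  "solves_at r \<phi> t \<equiv>
     (r has_real_derivative f (r t) (\<phi> t) (phase q s t) t) (at t) \<and>
     (\<phi> has_real_derivative \<omega> (r t) + inverse (r t) * g (r t) (\<phi> t) (phase q s t) t) (at t)"

text \<open>The differential equations are demanded only while the solution is in the tube, so that the notion covers the perturbed system as well as its modification outside the tube.\<close>
abbreviation traps :: "real \<Rightarrow> real \<Rightarrow> bool" where
  "traps \<epsilon> t0 \<equiv>
     \<forall>r \<phi>. \<bar>t0 powr \<nu> * r t0 - x0\<bar> \<le> \<epsilon> / 4 \<longrightarrow> continuous_on {t0..} r \<longrightarrow> continuous_on {t0..} \<phi> \<longrightarrow>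
       (\<forall>t>t0. in_tube t (r t) \<longrightarrow> solves_at r \<phi> t) \<longrightarrow>
       (\<forall>t\<ge>t0. \<bar>t powr \<nu> * r t - x0\<bar> < \<epsilon>)"

text \<open>While \<open>t powr \<nu> * r - x0\<close> is at most \<open>\<epsilon>\<close>, it differs by at most \<open>\<epsilon> / 8\<close> from the deviation \<open>w\<close> of the rescaled averaged radius, and \<open>w' = e\<^sup>n (d w + E)\<close> with \<open>|E| \<le> |d| \<epsilon> / 8\<close>. Since \<open>d < 0\<close>, \<open>w\<close> cannot leave the interval of radius \<open>3 \<epsilon> / 8\<close>, in which it starts, and so the deviation of \<open>r\<close> never reaches \<open>\<epsilon>\<close>.\<close>
lemma trapping:
  assumes "\<epsilon> > 0" "\<epsilon> \<le> \<bar>x0\<bar> / 2"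
  shows "\<exists>T>0. \<forall>t0\<ge>T. traps \<epsilon> t0"
proof -
  define \<kappa> where "\<kappa> = min (\<epsilon> / 8) (\<bar>d\<bar> * \<epsilon> / 8)"
  have \<kappa>: "\<kappa> > 0" "\<kappa> \<le> \<epsilon> / 8" "\<kappa> \<le> \<bar>d\<bar> * \<epsilon> / 8" using assms d_neg by (auto simp: \<kappa>_def mult_neg_pos)
  obtain T where T: "T > 0" "\<forall>t\<ge>T. \<forall>r \<phi>. in_tube t r \<longrightarrow>
     controlled \<kappa> t r \<phi>"
    using tube_estimates[OF \<kappa>(1)] by (elim exE conjE) (rule that)
  show ?thesis
  proof (intro exI[of _ T] conjI T(1) allI impI)
    fix t0 t2 :: real and r \<phi>
    assume t0: "t0 \<ge> T" and start: "\<bar>t0 powr \<nu> * r t0 - x0\<bar> \<le> \<epsilon> / 4"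
      and cr: "continuous_on {t0..} r" and c\<phi>: "continuous_on {t0..} \<phi>"
      and der: "\<forall>t>t0. in_tube t (r t) \<longrightarrow>
        solves_at r \<phi> t"
      and t2: "t2 \<ge> t0"
    define u where "u t = t powr \<nu> * r t - x0" for t
    define w where "w t = t powr \<nu> * avg_radius (r t) (\<phi> t) t - x0" for t
    show "\<bar>t2 powr \<nu> * r t2 - x0\<bar> < \<epsilon>"
    proof (rule ccontr)
      assume "\<not> \<bar>t2 powr \<nu> * r t2 - x0\<bar> < \<epsilon>"
      then have far: "\<epsilon> \<le> \<bar>u t2\<bar>" by (simp add: u_def)
      have cu: "continuous_on {t0..t2} u"
        unfolding u_def using t0 T(1) by (intro continuous_intros continuous_on_subset[OF cr]) auto
      have su: "\<bar>u t0\<bar> < \<epsilon>" using start assms(1) by (simp add: u_def)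
      obtain t1 where t1: "t0 \<le> t1" "t1 \<le> t2" "\<bar>u t1\<bar> = \<epsilon>" "\<And>t. t0 \<le> t \<Longrightarrow> t \<le> t1 \<Longrightarrow> \<bar>u t\<bar> \<le> \<epsilon>"
        by (rule first_exit[of t0 t2 u \<epsilon>, OF cu t2 su far]) (rule that)
      have inside: "in_tube t (r t)" if "t0 \<le> t" "t \<le> t1" for t
        using t1(4)[OF that] assms(2) by (simp add: u_def)
      have est: "\<bar>r t\<bar> < rs" "\<bar>w t - u t\<bar> \<le> \<kappa>" "\<bar>scaled_drift t (r t) (\<phi> t) - e t ^ n * (d * w t)\<bar> \<le> \<kappa> * e t ^ n"
        if "t0 \<le> t" "t \<le> t1" for t
        using T(2)[rule_format, OF _ inside[OF that], of "\<phi> t"] that t0 by (auto simp: w_def u_def)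
      have "\<bar>w t1\<bar> \<le> 3 * \<epsilon> / 8"
      proof (rule barrier[OF t1(1)])
        show "continuous_on {t0..t1} w"
          unfolding w_def using t0 T(1) est(1)
          by (intro continuous_intros near_identity_continuous_on continuous_on_subset[OF cr] continuous_on_subset[OF c\<phi>]) auto
        have "\<bar>w t0 - u t0\<bar> \<le> \<epsilon> / 8" using est(2)[of t0] t1(1) \<kappa>(2) by simp
        then show "\<bar>w t0\<bar> \<le> 3 * \<epsilon> / 8" using start unfolding u_def by linarith
      next
        fix t assume t: "t0 < t" "t < t1"
        then have tp: "t > 0" using t0 T(1) by simp
        have "((\<lambda>t. avg_radius (r t) (\<phi> t) t) has_real_derivative drift t (r t) (\<phi> t)) (at t)"
          using der[rule_format, of t] inside[of t] est(1)[of t] t tp by (intro near_identity_has_derivative) auto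
        from DERIV_mult[OF has_real_derivative_powr[OF tp, of \<nu>] this]
        show "(w has_real_derivative scaled_drift t (r t) (\<phi> t)) (at t)"
          unfolding w_def scaled_drift_def using DERIV_diff[OF _ DERIV_const[of x0]] by (force simp: mult_ac add_ac)
        assume big: "\<bar>w t\<bar> > 3 * \<epsilon> / 8"
        define E where "E = scaled_drift t (r t) (\<phi> t) - e t ^ n * (d * w t)"
        have E: "\<bar>E\<bar> \<le> \<kappa> * e t ^ n" using est(3)[of t] t by (simp add: E_def)
        have ep: "e t ^ n > 0" using small_parameter_pos[OF tp] by simp
        have "w t * E \<le> \<bar>w t\<bar> * \<bar>E\<bar>" by (metis abs_ge_self abs_mult)
        also have "\<dots> \<le> \<bar>w t\<bar> * (\<kappa> * e t ^ n)" using E by (intro mult_left_mono) auto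
        also have "\<dots> \<le> \<bar>w t\<bar> * ((\<bar>d\<bar> * \<bar>w t\<bar>) * e t ^ n)"
        proof -
          have "\<kappa> \<le> \<bar>d\<bar> * (\<epsilon> / 8)" using \<kappa>(3) by simp
          also have "\<dots> \<le> \<bar>d\<bar> * \<bar>w t\<bar>" using big assms(1) by (intro mult_left_mono) auto
          finally show ?thesis using ep by (intro mult_left_mono mult_right_mono) auto
        qed
        also have "\<dots> = - (d * e t ^ n * (w t * w t))" using d_neg by (simp add: abs_mult_self_eq mult_ac)
        finally have "w t * E + d * e t ^ n * (w t * w t) \<le> 0" by simp
        moreover have "w t * scaled_drift t (r t) (\<phi> t) = w t * E + d * e t ^ n * (w t * w t)"
          by (simp add: E_def algebra_simps)
        ultimately show "w t * scaled_drift t (r t) (\<phi> t) \<le> 0" by simp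
      qed
      moreover have "\<bar>w t1 - u t1\<bar> \<le> \<epsilon> / 8" using est(2)[of t1] t1(1) \<kappa>(2) by simp
      ultimately show False using t1(3) assms(1) by linarith
    qed
  qed
qed

section \<open>Existence of trapped solutions\<close>

text \<open>The projection of the radius onto the tube. Substituting it into the right-hand sides removes the singularity at \<open>r = 0\<close> and makes them globally bounded.\<close>
definition clamp :: "real \<Rightarrow> real \<Rightarrow> real" where
  "clamp t r = t powr (- \<nu>) * max (x0 - \<bar>x0\<bar> / 2) (min (x0 + \<bar>x0\<bar> / 2) (t powr \<nu> * r))"

lemma clamp_in_tube: "t > 0 \<Longrightarrow> in_tube t (clamp t r)"
proof -
  assume "t > 0"
  then have "t powr \<nu> * clamp t r = max (x0 - \<bar>x0\<bar> / 2) (min (x0 + \<bar>x0\<bar> / 2) (t powr \<nu> * r))"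
    by (simp add: clamp_def mult.assoc[symmetric] powr_add[symmetric])
  then show ?thesis by linarith
qed

lemma clamp_id: "t > 0 \<Longrightarrow> in_tube t r \<Longrightarrow> clamp t r = r"
proof -
  assume t: "t > 0" and "in_tube t r"
  then have "max (x0 - \<bar>x0\<bar> / 2) (min (x0 + \<bar>x0\<bar> / 2) (t powr \<nu> * r)) = t powr \<nu> * r" by linarith
  then show ?thesis using t by (simp add: clamp_def mult.assoc[symmetric] powr_add[symmetric])
qed

lemma clamp_lipschitz: "t > 0 \<Longrightarrow> \<bar>clamp t r - clamp t r'\<bar> \<le> \<bar>r - r'\<bar>"
proof -
  assume t: "t > 0"
  define y y' where "y = t powr \<nu> * r" and "y' = t powr \<nu> * r'"
  have "\<bar>clamp t r - clamp t r'\<bar> = t powr (- \<nu>) * \<bar>max (x0 - \<bar>x0\<bar> / 2) (min (x0 + \<bar>x0\<bar> / 2) y) - max (x0 - \<bar>x0\<bar> / 2) (min (x0 + \<bar>x0\<bar> / 2) y')\<bar>"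
    unfolding clamp_def right_diff_distrib[symmetric] abs_mult y_def y'_def by simp
  also have "\<dots> \<le> t powr (- \<nu>) * \<bar>y - y'\<bar>" by (rule mult_left_mono) (linarith, simp)
  also have "\<dots> = t powr (- \<nu>) * (t powr \<nu> * \<bar>r - r'\<bar>)"
    unfolding y_def y'_def right_diff_distrib[symmetric] abs_mult by simp
  also have "\<dots> = \<bar>r - r'\<bar>" using t by (simp add: mult.assoc[symmetric] powr_add[symmetric])
  finally show ?thesis .
qed

lemma expansion_bounded:
  assumes "uniform_expansion r0 q F Fk"
  shows "\<exists>C T. T > 0 \<and> (\<forall>t\<ge>T. \<forall>r \<phi> S. \<bar>r\<bar> \<le> r0 \<longrightarrow> \<bar>F r \<phi> S t\<bar> \<le> C)"
proof -
  obtain C T where CT: "T > 0" "\<forall>t\<ge>T. \<forall>r \<phi> S. \<bar>r\<bar> \<le> r0 \<longrightarrow>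
        \<bar>F r \<phi> S t - (\<Sum>k=1..0. t powr (- (real k / real q)) * Fk k r \<phi> S)\<bar>
          \<le> C * t powr (- (real (Suc 0) / real q))"
    using assms[unfolded uniform_expansion_def, THEN spec, of 0] by (elim exE conjE) (rule that)
  have "\<bar>F r \<phi> S t\<bar> \<le> \<bar>C\<bar>" if t: "t \<ge> max T 1" and r: "\<bar>r\<bar> \<le> r0" for t r \<phi> S
  proof -
    have "\<bar>F r \<phi> S t\<bar> \<le> C * t powr (- (real (Suc 0) / real q))"
      using CT(2)[rule_format, of t r \<phi> S] t r by simp
    also have "\<dots> \<le> \<bar>C\<bar> * 1"
      using t by (intro mult_mono) (auto intro!: powr_le1 simp: powr_minus_divide powr_mono2 ge_one_powr_ge_zero)
    finally show ?thesis by simp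
  qed
  then show ?thesis by (intro exI[of _ "\<bar>C\<bar>"] exI[of _ "max T 1"]) auto
qed

lemma phase_continuous_on: "(\<And>t. t \<in> A \<Longrightarrow> t > 0) \<Longrightarrow> continuous_on A (phase q s)"
  unfolding phase_def[abs_def] by (intro continuous_intros) force+

abbreviation phase_lipschitz :: "(real \<Rightarrow> real \<Rightarrow> real \<Rightarrow> real \<Rightarrow> real) \<Rightarrow> real \<Rightarrow> real \<Rightarrow> real \<Rightarrow> real \<Rightarrow> bool" where
  "phase_lipschitz F t0 T R L \<equiv>
     \<forall>t\<in>{t0..T}. \<forall>r r' \<phi> \<phi>'. \<bar>r\<bar> \<le> r0 \<longrightarrow> \<bar>r'\<bar> \<le> r0 \<longrightarrow> \<bar>\<phi>\<bar> \<le> R \<longrightarrow> \<bar>\<phi>'\<bar> \<le> R \<longrightarrow>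
     \<bar>F r \<phi> (phase q s t) t - F r' \<phi>' (phase q s t) t\<bar> \<le> L * (\<bar>r - r'\<bar> + \<bar>\<phi> - \<phi>'\<bar>)"

text \<open>On a bounded time interval the phase stays in a bounded interval, so all arguments lie in a compact box.\<close>
lemma lipschitz_along_phase:
  assumes F: "smooth_on ({-r0..r0} \<times> UNIV \<times> UNIV \<times> {0<..}) (\<lambda>(r, \<phi>, S, t). F r \<phi> S t)" and "t0 > 0"
  shows "\<exists>L\<ge>0. phase_lipschitz F t0 T R L"
proof -
  have "continuous_on {t0..T} (phase q s)" by (rule phase_continuous_on) (use assms(2) in auto)
  then have "bounded (phase q s ` {t0..T})" using compact_continuous_image compact_imp_bounded by blast
  then obtain P where P: "\<forall>x\<in>phase q s ` {t0..T}. norm x \<le> P" unfolding bounded_iff ..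
  define K :: "(real \<times> real \<times> real \<times> real) set" where "K = {-r0..r0} \<times> {-R..R} \<times> {-P..P} \<times> {t0..T}"
  have "compact K" "convex K" "K \<subseteq> {-r0..r0} \<times> UNIV \<times> UNIV \<times> {0<..}"
    unfolding K_def using assms(2) by (auto intro!: compact_Times convex_Times)
  from smooth_on_lipschitz_compact[OF F this] obtain L where L: "L \<ge> 0"
    "\<forall>x\<in>K. \<forall>y\<in>K. \<bar>(\<lambda>(r, \<phi>, S, t). F r \<phi> S t) x - (\<lambda>(r, \<phi>, S, t). F r \<phi> S t) y\<bar> \<le> L * norm (x - y)"
    by (elim exE conjE) (rule that)
  show ?thesis
  proof (intro exI[of _ L] conjI L(1) ballI allI impI)
    fix t r r' \<phi> \<phi>' assume *: "t \<in> {t0..T}" "\<bar>r\<bar> \<le> r0" "\<bar>r'\<bar> \<le> r0" "\<bar>\<phi>\<bar> \<le> R" "\<bar>\<phi>'\<bar> \<le> R"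
    have "\<bar>phase q s t\<bar> \<le> P" using P *(1) by auto
    then have mem: "(r, \<phi>, phase q s t, t) \<in> K" "(r', \<phi>', phase q s t, t) \<in> K"
      using * unfolding K_def by (auto simp: abs_le_iff)
    have "\<bar>F r \<phi> (phase q s t) t - F r' \<phi>' (phase q s t) t\<bar> \<le> L * norm ((r, \<phi>, phase q s t, t) - (r', \<phi>', phase q s t, t))"
      using L(2)[THEN bspec, OF mem(1), THEN bspec, OF mem(2)] by simp
    also have "norm ((r, \<phi>, phase q s t, t) - (r', \<phi>', phase q s t, t)) \<le> \<bar>r - r'\<bar> + \<bar>\<phi> - \<phi>'\<bar>"
      using norm_Pair_le[of "r - r'" "(\<phi> - \<phi>', 0 :: real \<times> real)"] norm_Pair_le[of "\<phi> - \<phi>'" "0 :: real \<times> real"] by simp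
    finally show "\<bar>F r \<phi> (phase q s t) t - F r' \<phi>' (phase q s t) t\<bar> \<le> L * (\<bar>r - r'\<bar> + \<bar>\<phi> - \<phi>'\<bar>)"
      using L(1) by (simp add: mult_left_mono)
  qed
qed

abbreviation clamped_f :: "real \<Rightarrow> real \<Rightarrow> real \<Rightarrow> real" where
  "clamped_f t r \<phi> \<equiv> f (clamp t r) \<phi> (phase q s t) t"

abbreviation clamped_g :: "real \<Rightarrow> real \<Rightarrow> real \<Rightarrow> real" where
  "clamped_g t r \<phi> \<equiv>
     \<omega> (clamp t r) + inverse (clamp t r) * g (clamp t r) \<phi> (phase q s t) t"

abbreviation clamped_solution :: "real \<Rightarrow> (real \<Rightarrow> real) \<Rightarrow> (real \<Rightarrow> real) \<Rightarrow> bool" where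
  "clamped_solution t0 r \<phi> \<equiv> \<forall>t\<ge>t0.
     (r has_real_derivative clamped_f t (r t) (\<phi> t)) (at t within {t0..}) \<and>
     (\<phi> has_real_derivative clamped_g t (r t) (\<phi> t)) (at t within {t0..})"

lemma clamped_system_solvable:
  assumes "in_tube t0 a" "t0 > 0"
    and tube: "\<And>t r \<phi>. t \<ge> t0 \<Longrightarrow> in_tube t r \<Longrightarrow>
       r \<noteq> 0 \<and> \<bar>r\<bar> < rs \<and> \<bar>inverse r * g r \<phi> (phase q s t) t\<bar> \<le> 1"
    and bounds: "\<And>t r \<phi> S. t \<ge> t0 \<Longrightarrow> \<bar>r\<bar> \<le> r0 \<Longrightarrow> \<bar>f r \<phi> S t\<bar> \<le> C" "\<And>t r \<phi> S. t \<ge> t0 \<Longrightarrow> \<bar>r\<bar> \<le> r0 \<Longrightarrow> \<bar>g r \<phi> S t\<bar> \<le> C"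
  shows "\<exists>r \<phi>. r t0 = a \<and> \<phi> t0 = b \<and> clamped_solution t0 r \<phi>"
proof -
  have c: "clamp t r \<noteq> 0" "\<bar>clamp t r\<bar> < rs" "\<bar>clamp t r\<bar> \<le> r0"
    "\<bar>inverse (clamp t r) * g (clamp t r) \<phi> (phase q s t) t\<bar> \<le> 1" if "t \<ge> t0" for t r \<phi>
    using tube[OF that clamp_in_tube] that assms(2) rs_range by (auto intro: less_imp_le order_less_trans)
  have cmem: "clamp t r \<in> {-r0..r0}" if "t \<ge> t0" for t r
    using c(3)[OF that, of r] by auto
  have ccont: "continuous_on ({t0..} \<times> UNIV) (\<lambda>z::real \<times> real \<times> real. clamp (fst z) (fst (snd z)))"
    unfolding clamp_def using assms(2) by (intro continuous_intros) auto
  have pcont: "continuous_on ({t0..} \<times> UNIV) (\<lambda>z::real \<times> real \<times> real. phase q s (fst z))"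
    by (rule continuous_on_compose2[OF phase_continuous_on[of "{t0..}"]]) (use assms(2) in \<open>auto intro!: continuous_intros\<close>)
  have Fcont: "continuous_on ({t0..} \<times> UNIV) (\<lambda>z. F (clamp (fst z) (fst (snd z))) (snd (snd z)) (phase q s (fst z)) (fst z))"
    if "smooth_on ({-r0..r0} \<times> UNIV \<times> UNIV \<times> {0<..}) (\<lambda>(r, \<phi>, S, t). F r \<phi> S t)" for F :: "real \<Rightarrow> real \<Rightarrow> real \<Rightarrow> real \<Rightarrow> real"
  proof -
    have "continuous_on ({t0..} \<times> UNIV) (\<lambda>z. (\<lambda>(r, \<phi>, S, t). F r \<phi> S t) (clamp (fst z) (fst (snd z)), snd (snd z), phase q s (fst z), fst z))"
    proof (rule continuous_on_compose2[OF smooth_on_imp_continuous_on[OF that]])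
      show "continuous_on ({t0..} \<times> UNIV) (\<lambda>z::real \<times> real \<times> real. (clamp (fst z) (fst (snd z)), snd (snd z), phase q s (fst z), fst z))"
        by (intro continuous_intros ccont pcont)
      show "(\<lambda>z::real \<times> real \<times> real. (clamp (fst z) (fst (snd z)), snd (snd z), phase q s (fst z), fst z)) ` ({t0..} \<times> UNIV)
         \<subseteq> {-r0..r0} \<times> UNIV \<times> UNIV \<times> {0<..}"
        using cmem assms(2) by auto
    qed
    then show ?thesis by simp
  qed
  have \<omega>_cont: "continuous_on ({t0..} \<times> UNIV) (\<lambda>z::real \<times> real \<times> real. \<omega> (clamp (fst z) (fst (snd z))))"
    by (rule continuous_on_compose2[OF smooth_on_imp_continuous_on[OF omega_smooth] ccont])
       (use cmem in auto)
  have "bounded (\<omega> ` {-r0..r0})"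
    by (intro compact_imp_bounded compact_continuous_image smooth_on_imp_continuous_on[OF omega_smooth]) simp
  then obtain W where W: "\<forall>x\<in>\<omega> ` {-r0..r0}. norm x \<le> W" unfolding bounded_iff ..
  have W': "\<bar>\<omega> r\<bar> \<le> W" if "\<bar>r\<bar> \<le> r0" for r
  proof -
    have "r \<in> {-r0..r0}" using that by auto
    then show ?thesis using W by auto
  qed
  have C0: "C \<ge> 0" using bounds(1)[of t0 0 0 0] r0_pos by simp
  show ?thesis
  proof (rule picard_global_existence_plane[where M = "max C (W + 1)"])
    show "continuous_on ({t0..} \<times> UNIV) (\<lambda>(t, r, \<phi>). clamped_f t r \<phi>)"
      using Fcont[OF f_smooth] by (simp add: case_prod_unfold)
    have "continuous_on ({t0..} \<times> UNIV) (\<lambda>z. \<omega> (clamp (fst z) (fst (snd z))) + inverse (clamp (fst z) (fst (snd z))) *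
        g (clamp (fst z) (fst (snd z))) (snd (snd z)) (phase q s (fst z)) (fst z))"
      by (intro continuous_intros \<omega>_cont ccont Fcont[OF g_smooth]) (use c(1) in auto)
    then show "continuous_on ({t0..} \<times> UNIV) (\<lambda>(t, r, \<phi>). clamped_g t r \<phi>)"
      by (simp add: case_prod_unfold)
  next
    fix t r \<phi> assume t: "t \<ge> t0"
    show "\<bar>clamped_f t r \<phi>\<bar> \<le> max C (W + 1)"
      using bounds(1)[OF t c(3)[OF t]] by (simp add: le_max_iff_disj)
    show "\<bar>clamped_g t r \<phi>\<bar> \<le> max C (W + 1)"
      using W'[OF c(3)[OF t, of r]] c(4)[OF t, of r \<phi>] by linarith
  next
    fix T R
    obtain Lf where Lf: "Lf \<ge> 0" "phase_lipschitz f t0 T R Lf"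
      using lipschitz_along_phase[OF f_smooth assms(2), of T R] by (elim exE conjE) (rule that)
    obtain Lg where Lg: "Lg \<ge> 0" "phase_lipschitz g t0 T R Lg"
      using lipschitz_along_phase[OF g_smooth assms(2), of T R] by (elim exE conjE) (rule that)
    have "\<exists>L\<ge>0. \<forall>x\<in>{-r0..r0}. \<forall>y\<in>{-r0..r0}. \<bar>\<omega> x - \<omega> y\<bar> \<le> L * norm (x - y)"
      by (rule smooth_on_lipschitz_compact[OF omega_smooth]) auto
    then obtain Lw where Lw: "Lw \<ge> 0" "\<forall>x\<in>{-r0..r0}. \<forall>y\<in>{-r0..r0}. \<bar>\<omega> x - \<omega> y\<bar> \<le> Lw * norm (x - y)"
      by (elim exE conjE) (rule that)
    define I where "I = T powr \<nu> * (2 / \<bar>x0\<bar>)"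
    have I: "\<bar>inverse (clamp t r)\<bar> \<le> I" if t: "t \<in> {t0..T}" for t r
    proof -
      define y where "y = t powr \<nu> * clamp t r"
      have tp: "t > 0" using t assms(2) by simp
      have "\<bar>y - x0\<bar> \<le> \<bar>x0\<bar> / 2" unfolding y_def by (rule clamp_in_tube[OF tp])
      then have y: "\<bar>y\<bar> \<ge> \<bar>x0\<bar> / 2" by linarith
      have "inverse (clamp t r) = t powr \<nu> * inverse y"
        using tp by (simp add: y_def)
      then have "\<bar>inverse (clamp t r)\<bar> = t powr \<nu> * inverse \<bar>y\<bar>" by (simp add: abs_mult)
      also have "\<dots> \<le> T powr \<nu> * inverse (\<bar>x0\<bar> / 2)"
        using t tp nu_pos y x0_nonzero by (intro mult_mono powr_mono2 le_imp_inverse_le) auto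
      finally show ?thesis by (simp add: I_def)
    qed
    define L where "L = max Lf (Lw + (I * Lg + C * (I * I)))"
    show "\<exists>L. \<forall>t\<in>{t0..T}. \<forall>r r' \<phi> \<phi>'. \<bar>\<phi>\<bar> \<le> R \<longrightarrow> \<bar>\<phi>'\<bar> \<le> R \<longrightarrow>
        \<bar>clamped_f t r \<phi> - clamped_f t r' \<phi>'\<bar> \<le> L * (\<bar>r - r'\<bar> + \<bar>\<phi> - \<phi>'\<bar>) \<and>
        \<bar>clamped_g t r \<phi>
         - clamped_g t r' \<phi>'\<bar> \<le> L * (\<bar>r - r'\<bar> + \<bar>\<phi> - \<phi>'\<bar>)"
    proof (intro exI[of _ L] ballI allI impI conjI)
      fix t r r' \<phi> \<phi>' assume t: "t \<in> {t0..T}" and R: "\<bar>\<phi>\<bar> \<le> R" "\<bar>\<phi>'\<bar> \<le> R"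
      define x x' D D' where "x = clamp t r" and "x' = clamp t r'"
        and "D = \<bar>x - x'\<bar> + \<bar>\<phi> - \<phi>'\<bar>" and "D' = \<bar>r - r'\<bar> + \<bar>\<phi> - \<phi>'\<bar>"
      have t': "t \<ge> t0" "t > 0" using t assms(2) by auto
      have xx: "\<bar>x\<bar> \<le> r0" "\<bar>x'\<bar> \<le> r0" "x \<noteq> 0" "x' \<noteq> 0" using c[OF t'(1)] by (auto simp: x_def x'_def)
      have ix: "\<bar>inverse x\<bar> \<le> I" "\<bar>inverse x'\<bar> \<le> I" using I[OF t] by (auto simp: x_def x'_def)
      have I0: "I \<ge> 0" using ix(1) abs_ge_zero order_trans by blast
      have DD: "0 \<le> D" "D \<le> D'" using clamp_lipschitz[OF t'(2), of r r'] by (auto simp: D_def D'_def x_def x'_def)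
      have xD: "\<bar>x - x'\<bar> \<le> D" by (simp add: D_def)
      have "\<bar>f x \<phi> (phase q s t) t - f x' \<phi>' (phase q s t) t\<bar> \<le> Lf * D"
        using Lf(2) t xx R unfolding D_def by blast
      also have "\<dots> \<le> L * D'" using DD Lf(1) by (intro mult_mono) (auto simp: L_def)
      finally show "\<bar>clamped_f t r \<phi> - clamped_f t r' \<phi>'\<bar> \<le> L * (\<bar>r - r'\<bar> + \<bar>\<phi> - \<phi>'\<bar>)"
        by (simp add: x_def x'_def D'_def)
      define G G' where "G = g x \<phi> (phase q s t) t" and "G' = g x' \<phi>' (phase q s t) t"
      have GG: "\<bar>G - G'\<bar> \<le> Lg * D" using Lg(2) t xx R unfolding D_def G_def G'_def by blast
      have G': "\<bar>G'\<bar> \<le> C" unfolding G'_def by (rule bounds(2)[OF t'(1) xx(2)])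
      have "x \<in> {-r0..r0}" "x' \<in> {-r0..r0}" using cmem[OF t'(1)] by (auto simp: x_def x'_def)
      then have "\<bar>\<omega> x - \<omega> x'\<bar> \<le> Lw * \<bar>x - x'\<bar>" using Lw(2) unfolding real_norm_def by blast
      also have "\<dots> \<le> Lw * D" using xD Lw(1) by (rule mult_left_mono)
      finally have 1: "\<bar>\<omega> x - \<omega> x'\<bar> \<le> Lw * D" .
      have "inverse x - inverse x' = - (inverse x * (x - x') * inverse x')"
        using inverse_diff_inverse[OF xx(3,4)] by simp
      then have "\<bar>inverse x - inverse x'\<bar> = \<bar>inverse x\<bar> * \<bar>inverse x'\<bar> * \<bar>x - x'\<bar>" by (simp add: abs_mult mult_ac)
      also have "\<dots> \<le> (I * I) * D" using ix xD I0 by (intro mult_mono) auto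
      finally have inv: "\<bar>inverse x - inverse x'\<bar> \<le> I * I * D" .
      have "inverse x * G - inverse x' * G' = inverse x * (G - G') + G' * (inverse x - inverse x')"
        by (simp add: algebra_simps)
      then have "\<bar>inverse x * G - inverse x' * G'\<bar> \<le> \<bar>inverse x\<bar> * \<bar>G - G'\<bar> + \<bar>G'\<bar> * \<bar>inverse x - inverse x'\<bar>"
        using abs_triangle_ineq[of "inverse x * (G - G')" "G' * (inverse x - inverse x')"] by (simp only: abs_mult)
      also have "\<dots> \<le> I * (Lg * D) + C * (I * I * D)"
        using ix(1) GG G' inv I0 C0 by (intro add_mono mult_mono) auto
      finally have 2: "\<bar>inverse x * G - inverse x' * G'\<bar> \<le> I * (Lg * D) + C * (I * I * D)" .
      have "\<bar>\<omega> x + inverse x * G - (\<omega> x' + inverse x' * G')\<bar> \<le> (Lw + (I * Lg + C * (I * I))) * D"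
        using 1 2 by (simp add: algebra_simps)
      also have "\<dots> \<le> L * D'"
        using DD Lf(1) by (intro mult_mono) (auto simp: L_def)
      finally show "\<bar>clamped_g t r \<phi>
         - clamped_g t r' \<phi>'\<bar> \<le> L * (\<bar>r - r'\<bar> + \<bar>\<phi> - \<phi>'\<bar>)"
        by (simp add: x_def x'_def D'_def G_def G'_def)
    qed
  qed
qed

text \<open>The clamped system has a global solution. It is trapped in the tube, where the clamp is the identity, so it solves the perturbed system.\<close>
lemma solution_exists_in_tube:
  assumes "\<epsilon> > 0" "\<epsilon> \<le> \<bar>x0\<bar> / 2"
  shows "\<exists>T>0. \<forall>t0\<ge>T. \<forall>a b. \<bar>t0 powr \<nu> * a - x0\<bar> \<le> \<epsilon> / 4 \<longrightarrow>
     (\<exists>r \<phi>. perturbed_solution r0 q s \<omega> f g t0 r \<phi> \<and> r t0 = a \<and> \<phi> t0 = b)"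
proof -
  obtain T1 where T1: "T1 > 0" "\<forall>t0\<ge>T1. traps \<epsilon> t0"
    using trapping[OF assms] by (elim exE conjE) (rule that)
  obtain T2 where T2: "T2 > 0" "\<forall>t\<ge>T2. \<forall>r \<phi>. in_tube t r \<longrightarrow>
     controlled 1 t r \<phi>"
    using tube_estimates[OF zero_less_one] by (elim exE conjE) (rule that)
  obtain C3 T3 where T3: "T3 > 0" "\<forall>t\<ge>T3. \<forall>r \<phi> S. \<bar>r\<bar> \<le> r0 \<longrightarrow> \<bar>f r \<phi> S t\<bar> \<le> C3"
    using expansion_bounded[OF f_expansion] by (elim exE conjE) (rule that)
  obtain C4 T4 where T4: "T4 > 0" "\<forall>t\<ge>T4. \<forall>r \<phi> S. \<bar>r\<bar> \<le> r0 \<longrightarrow> \<bar>g r \<phi> S t\<bar> \<le> C4"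
    using expansion_bounded[OF g_expansion] by (elim exE conjE) (rule that)
  define T where "T = max (max T1 T2) (max T3 T4)"
  show ?thesis
  proof (intro exI[of _ T] conjI allI impI)
    show "T > 0" using T1(1) by (simp add: T_def)
    fix t0 a b assume t0: "t0 \<ge> T" and a: "\<bar>t0 powr \<nu> * a - x0\<bar> \<le> \<epsilon> / 4"
    have ge: "t0 \<ge> T1" "t0 \<ge> T2" "t0 \<ge> T3" "t0 \<ge> T4" "t0 > 0" using t0 T1(1) by (auto simp: T_def)
    have tube: "r \<noteq> 0 \<and> \<bar>r\<bar> < rs \<and> \<bar>inverse r * g r \<phi> (phase q s t) t\<bar> \<le> 1"
      if "t \<ge> t0" "in_tube t r" for t r \<phi>
      using T2(2)[rule_format, OF _ that(2), of \<phi>] that(1) ge by simp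
    have bf: "\<bar>f r \<phi> S t\<bar> \<le> max C3 C4" if "t \<ge> t0" "\<bar>r\<bar> \<le> r0" for t r \<phi> S
      using T3(2)[rule_format, of t r \<phi> S] that ge by simp
    have bg: "\<bar>g r \<phi> S t\<bar> \<le> max C3 C4" if "t \<ge> t0" "\<bar>r\<bar> \<le> r0" for t r \<phi> S
      using T4(2)[rule_format, of t r \<phi> S] that ge by simp
    have "in_tube t0 a" using a assms by linarith
    then have "\<exists>r \<phi>. r t0 = a \<and> \<phi> t0 = b \<and> clamped_solution t0 r \<phi>"
      using ge(5) by (rule clamped_system_solvable) (rule tube bf bg; assumption)+
    then obtain r \<phi> where r\<phi>: "r t0 = a" "\<phi> t0 = b"
      and der: "clamped_solution t0 r \<phi>"
      by (elim exE conjE) (rule that)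
    have cont: "continuous_on {t0..} r" "continuous_on {t0..} \<phi>"
      unfolding continuous_on_eq_continuous_within using der by (blast intro: DERIV_continuous)+
    have stay: "\<bar>t powr \<nu> * r t - x0\<bar> < \<epsilon>" if t: "t \<ge> t0" for t
    proof (rule T1(2)[rule_format, OF ge(1) _ cont _ t])
      show "\<bar>t0 powr \<nu> * r t0 - x0\<bar> \<le> \<epsilon> / 4" using a r\<phi> by simp
      fix t assume t: "t > t0" and "in_tube t (r t)"
      then have "clamp t (r t) = r t" using ge(5) by (intro clamp_id) auto
      moreover have "at t within {t0..} = at t"
        by (rule at_within_interior) (use t in simp)
      ultimately show "solves_at r \<phi> t"
        using der[rule_format, of t] t by simp
    qed
    have inside: "in_tube t (r t)" if "t \<ge> t0" for t
      using stay[OF that] assms(2) by linarith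
    have "perturbed_solution r0 q s \<omega> f g t0 r \<phi>"
      unfolding perturbed_solution_def
    proof (intro allI impI)
      fix t assume t: "t \<ge> t0"
      have "clamp t (r t) = r t" using ge(5) t inside[OF t] by (intro clamp_id) auto
      moreover have rt: "r t \<noteq> 0 \<and> \<bar>r t\<bar> < rs" using tube[OF t inside[OF t]] by blast
      moreover have "\<bar>r t\<bar> \<le> r0" using rt rs_range by linarith
      ultimately show "r t \<noteq> 0 \<and> \<bar>r t\<bar> \<le> r0 \<and>
        (r has_real_derivative f (r t) (\<phi> t) (phase q s t) t) (at t within {t0..}) \<and>
        (\<phi> has_real_derivative \<omega> (r t) + inverse (r t) * g (r t) (\<phi> t) (phase q s t) t) (at t within {t0..})"
        using der[rule_format, OF t] by simp
    qed
    then show "\<exists>r \<phi>. perturbed_solution r0 q s \<omega> f g t0 r \<phi> \<and> r t0 = a \<and> \<phi> t0 = b" using r\<phi> by blast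
  qed
qed

section \<open>Stability\<close>

lemma solution_stays_in_tube:
  assumes "\<epsilon> > 0" "\<epsilon> \<le> \<bar>x0\<bar> / 2"
  shows "\<exists>T>0. \<forall>t0\<ge>T. \<forall>r \<phi>. perturbed_solution r0 q s \<omega> f g t0 r \<phi> \<longrightarrow> \<bar>t0 powr \<nu> * r t0 - x0\<bar> \<le> \<epsilon> / 4 \<longrightarrow>
     (\<forall>t\<ge>t0. \<bar>t powr \<nu> * r t - x0\<bar> < \<epsilon>)"
proof -
  obtain T where T: "T > 0" "\<forall>t0\<ge>T. traps \<epsilon> t0"
    using trapping[OF assms] by (elim exE conjE) (rule that)
  show ?thesis
  proof (intro exI[of _ T] conjI T(1) allI impI)
    fix t0 t r \<phi> assume t0: "t0 \<ge> T" and sol: "perturbed_solution r0 q s \<omega> f g t0 r \<phi>"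
      and start: "\<bar>t0 powr \<nu> * r t0 - x0\<bar> \<le> \<epsilon> / 4" and t: "t \<ge> t0"
    have der: "(r has_real_derivative f (r t) (\<phi> t) (phase q s t) t) (at t within {t0..})"
        "(\<phi> has_real_derivative \<omega> (r t) + inverse (r t) * g (r t) (\<phi> t) (phase q s t) t) (at t within {t0..})" if "t \<ge> t0" for t
      using sol that unfolding perturbed_solution_def by auto
    have cont: "continuous_on {t0..} r" "continuous_on {t0..} \<phi>"
      unfolding continuous_on_eq_continuous_within using der by (blast intro: DERIV_continuous)+
    show "\<bar>t powr \<nu> * r t - x0\<bar> < \<epsilon>"
    proof (rule T(2)[rule_format, OF t0 start cont _ t])
      fix t assume t: "t > t0"
      have "at t within {t0..} = at t" by (rule at_within_interior) (use t in simp)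
      then show "solves_at r \<phi> t"
        using der[of t] t by simp
    qed
  qed
qed

text \<open>In the tube the radius and the angular perturbation tend to \<open>0\<close>, so the angular velocity tends to \<open>\<omega> 0\<close>.\<close>
lemma phase_asymptotics:
  assumes sol: "perturbed_solution r0 q s \<omega> f g t0 r \<phi>"
    and inside: "\<And>t. t \<ge> t0 \<Longrightarrow> in_tube t (r t)"
  shows "\<phi> \<sim>[at_top] (\<lambda>t. \<omega> 0 * t)"
proof (rule asymp_equiv_linear)
  define G where "G t = inverse (r t) * g (r t) (\<phi> t) (phase q s t) t" for t
  show "(\<phi> has_real_derivative \<omega> (r t) + G t) (at t)" if t: "t > t0" for t
  proof -
    have "at t within {t0..} = at t" by (rule at_within_interior) (use t in simp)
    then show ?thesis using sol[unfolded perturbed_solution_def, rule_format, of t] t by (simp add: G_def)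
  qed
  have small: "eventually (\<lambda>t. \<bar>r t\<bar> \<le> \<kappa> \<and> \<bar>G t\<bar> \<le> \<kappa>) at_top" if \<kappa>: "\<kappa> > 0" for \<kappa>
  proof -
    obtain T where T: "T > 0" "\<forall>t\<ge>T. \<forall>r \<phi>. in_tube t r \<longrightarrow>
     controlled \<kappa> t r \<phi>"
      using tube_estimates[OF \<kappa>] by (elim exE conjE) (rule that)
    have "eventually (\<lambda>t. t \<ge> max T t0) at_top" by (rule eventually_ge_at_top)
    then show ?thesis
    proof (rule eventually_mono)
      fix t assume "t \<ge> max T t0"
      then show "\<bar>r t\<bar> \<le> \<kappa> \<and> \<bar>G t\<bar> \<le> \<kappa>"
        using T(2)[rule_format, of t "r t" "\<phi> t"] inside[of t] by (simp add: G_def)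
    qed
  qed
  have "(r \<longlongrightarrow> 0) at_top"
  proof (rule tendstoI)
    fix \<kappa> :: real assume "\<kappa> > 0"
    then show "eventually (\<lambda>t. dist (r t) 0 < \<kappa>) at_top"
      by (intro eventually_mono[OF small[of "\<kappa> / 2"]]) auto
  qed
  moreover have "isCont \<omega> 0"
  proof -
    have "continuous_on {-r0<..<r0} \<omega>"
      by (rule continuous_on_subset[OF smooth_on_imp_continuous_on[OF omega_smooth]]) auto
    then show ?thesis using r0_pos by (simp add: continuous_on_eq_continuous_at)
  qed
  ultimately have "((\<lambda>t. \<omega> (r t)) \<longlongrightarrow> \<omega> 0) at_top" by (rule isCont_tendsto_compose[rotated])
  moreover have "(G \<longlongrightarrow> 0) at_top"
  proof (rule tendstoI)
    fix \<kappa> :: real assume "\<kappa> > 0"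
    then show "eventually (\<lambda>t. dist (G t) 0 < \<kappa>) at_top"
      by (intro eventually_mono[OF small[of "\<kappa> / 2"]]) auto
  qed
  ultimately have "((\<lambda>t. \<omega> (r t) + G t) \<longlongrightarrow> \<omega> 0 + 0) at_top" by (rule tendsto_add)
  then show "((\<lambda>t. \<omega> (r t) + G t) \<longlongrightarrow> \<omega> 0) at_top" by simp
  show "\<omega> 0 > 0" using omega_pos r0_pos by simp
qed

text \<open>Both \<open>t powr \<nu> * r\<close> and \<open>t powr \<nu> * \<rho>1\<close> are eventually close to the same number \<open>x0\<close>. The radius \<open>\<delta>0\<close> of admissible initial values has to shrink like \<open>t0 powr (- \<nu>)\<close>, as the tube does.\<close>
lemma stability:
  assumes \<rho>1: "((\<lambda>t. t powr \<nu> * \<rho>1 t) \<longlongrightarrow> x0) at_top"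
    and \<phi>1: "\<phi>1 \<sim>[at_top] (\<lambda>t. \<omega> 0 * t)" and "\<epsilon> > 0"
  shows "\<exists>\<delta>0>0. \<exists>t0\<ge>ts. \<forall>a b. \<bar>a - \<rho>1 t0\<bar> \<le> \<delta>0 \<longrightarrow>
    (\<exists>r \<phi>. perturbed_solution r0 q s \<omega> f g t0 r \<phi> \<and> r t0 = a \<and> \<phi> t0 = b) \<and>
    (\<forall>r \<phi>. perturbed_solution r0 q s \<omega> f g t0 r \<phi> \<and> r t0 = a \<and> \<phi> t0 = b \<longrightarrow>
       bdd_above ((\<lambda>t. t powr \<nu> * \<bar>r t - \<rho>1 t\<bar>) ` {t0..}) \<and>
       (SUP t\<in>{t0..}. t powr \<nu> * \<bar>r t - \<rho>1 t\<bar>) < \<epsilon> \<and>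
       \<phi> \<sim>[at_top] \<phi>1)"
proof -
  define \<eta> where "\<eta> = min (\<epsilon> / 4) (\<bar>x0\<bar> / 2)"
  have \<eta>: "\<eta> > 0" "\<eta> \<le> \<bar>x0\<bar> / 2" "\<eta> \<le> \<epsilon> / 4" using x0_nonzero assms(3) by (auto simp: \<eta>_def)
  obtain T1 where T1: "T1 > 0" "\<forall>t0\<ge>T1. \<forall>a b. \<bar>t0 powr \<nu> * a - x0\<bar> \<le> \<eta> / 4 \<longrightarrow>
     (\<exists>r \<phi>. perturbed_solution r0 q s \<omega> f g t0 r \<phi> \<and> r t0 = a \<and> \<phi> t0 = b)"
    using solution_exists_in_tube[OF \<eta>(1,2)] by (elim exE conjE) (rule that)
  obtain T2 where T2: "T2 > 0" "\<forall>t0\<ge>T2. \<forall>r \<phi>. perturbed_solution r0 q s \<omega> f g t0 r \<phi> \<longrightarrow> \<bar>t0 powr \<nu> * r t0 - x0\<bar> \<le> \<eta> / 4 \<longrightarrow>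
     (\<forall>t\<ge>t0. \<bar>t powr \<nu> * r t - x0\<bar> < \<eta>)"
    using solution_stays_in_tube[OF \<eta>(1,2)] by (elim exE conjE) (rule that)
  have "\<eta> / 8 > 0" using \<eta>(1) by simp
  \<comment> \<open>The admissible start \<open>\<eta> / 4\<close> is shared equally between \<open>\<rho>1\<close> and the initial value.\<close>
  from tendstoD[OF \<rho>1 this] obtain T3 where T3: "\<And>t. t \<ge> T3 \<Longrightarrow> \<bar>t powr \<nu> * \<rho>1 t - x0\<bar> < \<eta> / 8"
    unfolding eventually_at_top_linorder dist_real_def by blast
  define t0 where "t0 = max (max T1 T2) (max T3 ts)"
  have ge: "t0 \<ge> T1" "t0 \<ge> T2" "t0 \<ge> T3" "t0 \<ge> ts" "t0 > 0" using T1(1) by (auto simp: t0_def)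
  define \<delta>0 where "\<delta>0 = t0 powr (- \<nu>) * (\<eta> / 8)"
  have "\<delta>0 > 0" using ge(5) \<eta>(1) by (simp add: \<delta>0_def)
  moreover have "(\<exists>r \<phi>. perturbed_solution r0 q s \<omega> f g t0 r \<phi> \<and> r t0 = a \<and> \<phi> t0 = b) \<and>
    (\<forall>r \<phi>. perturbed_solution r0 q s \<omega> f g t0 r \<phi> \<and> r t0 = a \<and> \<phi> t0 = b \<longrightarrow>
       bdd_above ((\<lambda>t. t powr \<nu> * \<bar>r t - \<rho>1 t\<bar>) ` {t0..}) \<and>
       (SUP t\<in>{t0..}. t powr \<nu> * \<bar>r t - \<rho>1 t\<bar>) < \<epsilon> \<and>
       \<phi> \<sim>[at_top] \<phi>1)" if a: "\<bar>a - \<rho>1 t0\<bar> \<le> \<delta>0" for a b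
  proof -
    have "t0 powr \<nu> * \<bar>a - \<rho>1 t0\<bar> \<le> t0 powr \<nu> * \<delta>0" using a by (intro mult_left_mono) auto
    also have "\<dots> = \<eta> / 8" using ge(5) by (simp add: \<delta>0_def mult.assoc[symmetric] powr_add[symmetric])
    finally have "\<bar>t0 powr \<nu> * a - t0 powr \<nu> * \<rho>1 t0\<bar> \<le> \<eta> / 8"
      by (simp add: right_diff_distrib[symmetric] abs_mult)
    then have start: "\<bar>t0 powr \<nu> * a - x0\<bar> \<le> \<eta> / 4" using T3[OF ge(3)] by linarith
    show ?thesis
    proof (intro conjI allI impI)
      show "\<exists>r \<phi>. perturbed_solution r0 q s \<omega> f g t0 r \<phi> \<and> r t0 = a \<and> \<phi> t0 = b"
        using T1(2)[rule_format, OF ge(1) start] .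
    next
      fix r \<phi> assume sol: "perturbed_solution r0 q s \<omega> f g t0 r \<phi> \<and> r t0 = a \<and> \<phi> t0 = b"
      have inside: "\<bar>t powr \<nu> * r t - x0\<bar> < \<eta>" if "t \<ge> t0" for t
        by (rule T2(2)[rule_format, OF ge(2), of r \<phi>]) (use sol start that in auto)
      have bound: "t powr \<nu> * \<bar>r t - \<rho>1 t\<bar> \<le> \<epsilon> / 2" if "t \<in> {t0..}" for t
      proof -
        have "t powr \<nu> * \<bar>r t - \<rho>1 t\<bar> = \<bar>t powr \<nu> * r t - t powr \<nu> * \<rho>1 t\<bar>"
          by (simp add: right_diff_distrib[symmetric] abs_mult)
        moreover have "\<bar>t powr \<nu> * \<rho>1 t - x0\<bar> < \<eta> / 8" using T3 that ge(3) by simp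
        moreover have "\<bar>t powr \<nu> * r t - x0\<bar> < \<eta>" using inside that by simp
        ultimately show ?thesis using \<eta> by linarith
      qed
      show "bdd_above ((\<lambda>t. t powr \<nu> * \<bar>r t - \<rho>1 t\<bar>) ` {t0..})"
        by (rule bdd_aboveI2[OF bound])
      have "(SUP t\<in>{t0..}. t powr \<nu> * \<bar>r t - \<rho>1 t\<bar>) \<le> \<epsilon> / 2"
        by (rule cSUP_least[OF _ bound]) auto
      then show "(SUP t\<in>{t0..}. t powr \<nu> * \<bar>r t - \<rho>1 t\<bar>) < \<epsilon>" using assms(3) by linarith
      have "\<phi> \<sim>[at_top] (\<lambda>t. \<omega> 0 * t)"
      proof (rule phase_asymptotics)
        show "perturbed_solution r0 q s \<omega> f g t0 r \<phi>" using sol by simp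
        show "in_tube t (r t)" if "t \<ge> t0" for t
          using inside[OF that] \<eta>(2) by linarith
      qed
      then show "\<phi> \<sim>[at_top] \<phi>1"
        by (rule asymp_equiv_trans) (subst asymp_equiv_sym, rule \<phi>1)
    qed
  qed
  ultimately show ?thesis using ge(4) by blast
qed

end

text \<open>The case \<open>K = 0\<close> of the expansion, in which the polynomial in \<open>ln t\<close> is constant.\<close>
lemma log_power_expansion_leading_term:
  assumes "log_power_expansion x \<nu> q P" "P 0 = [:c:]"
  shows "((\<lambda>t. t powr \<nu> * x t) \<longlongrightarrow> c) at_top"
proof -
  have "(\<lambda>t. x t - t powr (- \<nu>) * c) \<in> o[at_top](\<lambda>t. t powr (- \<nu>))"
    using assms(1)[unfolded log_power_expansion_def, THEN spec, of 0] assms(2) by simp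
  then have "((\<lambda>t. (x t - t powr (- \<nu>) * c) / t powr (- \<nu>)) \<longlongrightarrow> 0) at_top"
    by (rule smalloD_tendsto)
  then have "((\<lambda>t. (x t - t powr (- \<nu>) * c) / t powr (- \<nu>) + c) \<longlongrightarrow> 0 + c) at_top"
    by (intro tendsto_intros)
  moreover have "eventually (\<lambda>t. (x t - t powr (- \<nu>) * c) / t powr (- \<nu>) + c = t powr \<nu> * x t) at_top"
  proof (rule eventually_mono[OF eventually_gt_at_top[of 0]])
    fix t :: real assume "t > 0"
    then have nz: "t powr \<nu> \<noteq> 0" by simp
    have gen: "(y - inverse A * c) / inverse A + c = A * y" if "A \<noteq> 0" for A y :: real
    proof -
      have "(y - inverse A * c) / inverse A = (y - inverse A * c) * A"
        by (simp only: divide_inverse inverse_inverse_eq)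
      also have "\<dots> = A * y - c * (inverse A * A)" by (simp only: right_diff_distrib left_diff_distrib mult_ac)
      also have "\<dots> = A * y - c" using that by simp
      finally show ?thesis by simp
    qed
    show "(x t - t powr (- \<nu>) * c) / t powr (- \<nu>) + c = t powr \<nu> * x t"
      unfolding powr_minus by (rule gen[OF nz])
  qed
  ultimately have "((\<lambda>t. t powr \<nu> * x t) \<longlongrightarrow> 0 + c) at_top" by (rule Lim_transform_eventually)
  then show ?thesis by simp
qed

theorem theorem2:
  fixes r0 rs ts lam \<mu> \<nu>0 d :: real and q p N n :: nat
    and \<omega> :: "real \<Rightarrow> real"
    and f g :: "real \<Rightarrow> real \<Rightarrow> real \<Rightarrow> real \<Rightarrow> real"
    and fk gk v :: "nat \<Rightarrow> real \<Rightarrow> real \<Rightarrow> real \<Rightarrow> real"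
    and s :: "nat \<Rightarrow> real"
    and \<Lambda> :: "nat \<Rightarrow> real \<Rightarrow> real"
    and \<rho>1 \<phi>1 :: "real \<Rightarrow> real"
    and P :: "nat \<Rightarrow> real poly"
  assumes "averaging r0 q p \<omega> f g fk gk s N rs ts \<Lambda> v"
    and "1 \<le> n" and "n < p" and "n \<le> q"
    and "\<forall>k\<in>{1..<n}. \<forall>\<rho>. \<bar>\<rho>\<bar> \<le> rs \<longrightarrow> \<Lambda> k \<rho> = 0"
    and "\<exists>\<rho>. \<bar>\<rho>\<bar> \<le> rs \<and> \<Lambda> n \<rho> \<noteq> 0"
    and "\<exists>h\<in>O[at 0](\<lambda>\<rho>. \<bar>\<rho>\<bar>). \<forall>\<rho>. \<bar>\<rho>\<bar> \<le> rs \<longrightarrow> \<Lambda> n \<rho> = \<rho> * (lam + h \<rho>)"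
    and "lam \<noteq> 0"
    and "\<mu> = Re (fourier_coeff (fk p 0) 0 0)"
    and "\<nu>0 = (real p - real n) / real q"
    and "d = lam + (if n = q then \<nu>0 else 0)" and "d < 0"
    and "truncated_solution q N \<omega> \<Lambda> rs ts \<rho>1 \<phi>1"
    and "log_power_expansion \<rho>1 \<nu>0 q P" and "P 0 = [:- \<mu> / d:]"
    and "\<phi>1 \<sim>[at_top] (\<lambda>t. \<omega> 0 * t)"
  shows "\<forall>\<epsilon>>0. \<exists>\<delta>0>0. \<exists>t0\<ge>ts. \<forall>a b. \<bar>a - \<rho>1 t0\<bar> \<le> \<delta>0 \<longrightarrow>
    (\<exists>r \<phi>. perturbed_solution r0 q s \<omega> f g t0 r \<phi> \<and> r t0 = a \<and> \<phi> t0 = b) \<and>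
    (\<forall>r \<phi>. perturbed_solution r0 q s \<omega> f g t0 r \<phi> \<and> r t0 = a \<and> \<phi> t0 = b \<longrightarrow>
       bdd_above ((\<lambda>t. t powr \<nu>0 * \<bar>r t - \<rho>1 t\<bar>) ` {t0..}) \<and>
       (SUP t\<in>{t0..}. t powr \<nu>0 * \<bar>r t - \<rho>1 t\<bar>) < \<epsilon> \<and>
       \<phi> \<sim>[at_top] \<phi>1)"
proof -
  interpret averaging r0 q p \<omega> f g fk gk s N rs ts \<Lambda> v by fact
  interpret stable_averaging r0 q p \<omega> f g fk gk s N rs ts \<Lambda> v n lam \<nu>0 d
    by unfold_locales (use assms in auto)
  have "\<mu> = \<Lambda> p 0"
    unfolding assms(9) Lambda_p_at_zero[symmetric] by simp
  then have "x0 = - \<mu> / d" by (simp add: x0_def)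
  then have lim: "((\<lambda>t. t powr \<nu>0 * \<rho>1 t) \<longlongrightarrow> x0) at_top"
    using log_power_expansion_leading_term[OF assms(14,15)] by simp
  show ?thesis by (intro allI impI, rule stability[OF lim assms(16)])
qed

end
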